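(* Let $X$ be any of the finite classical groups $GU(2m,q^2)$, $GU(2m+1,q^2)$, $Sp(2m,q)$, $O^+(2m,q)$, $O^-(2m+2,q)$, $O(2m+1,q)$, with field of definition $\mathbb{F}$, natural module $V=\mathbb{F}^n$, defining form $h\in\mathbb{F}[V]$ and associated $p$-subgroup $\mathfrak{G}\le X$ as specified in the context. Let $R$ be the $\mathbb{F}$-subalgebra of $\mathbb{F}[V]^{\mathfrak{G}}$ generated by the $\mathfrak{G}$-orbit products of the variables $x_1,\dots,x_n$ and the Steenrod images of $h$. Then $\mathbb{F}[V]^{\mathfrak{G}}$ is equal to the integral closure of $R$ in its fraction field $\mathrm{Quot}(R)$.
   Context: Let $q$ be a power of a prime $p$ and $m\ge 1$. The field $\mathbb{F}$ is $\mathbb{F}_{q^2}$ for the unitary groups and $\mathbb{F}_q$ otherwise; $r=|\mathbb{F}|$. $V=\mathbb{F}^n$ (column vectors), $x_1,\dots,x_n$ is the dual basis of the standard basis, $\mathbb{F}[V]=\mathbb{F}[x_1,\dots,x_n]$, and a group $G\le GL_n(\mathbb{F})$ acts by $(g\cdot f)(v)=f(g^{-1}v)$. The $G$-orbit product of $x_i$ is $N(x_i)=\prod_{y\in G\cdot x_i}y$ (product over the orbit). For a matrix $A$ put $\bar A=[a_{ij}^q]$ (so $\bar A=A$ over $\mathbb{F}_q$). $U(n,\mathbb{F})$ is the group of lower triangular $n\times n$ matrices with ones on the diagonal. $J_k$ is the $k\times k$ matrix with ones on the antidiagonal and zeros elsewhere (blocks of size $0$ are omitted). Steenrod operations: for $f\in\mathbb{F}[V]$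 the elements $\mathcal{P}^i(f)$ are defined by $\sum_{i\ge0}\mathcal{P}^i(f)\zeta^i=\mathcal{P}(\zeta)(f)$, where $\mathcal{P}(\zeta):\mathbb{F}[V]\to\mathbb{F}[V][[\zeta]]$ is the $\mathbb{F}$-algebra homomorphism with $x_j\mapsto x_j+x_j^{r}\zeta$. The Steenrod algebra $\mathcal{A}$ is the $\mathbb{F}$-subalgebra of $\mathrm{End}_{\mathbb{F}}(\mathbb{F}[V])$ generated by all $\mathcal{P}^i$, $i\ge 0$ ($\mathcal{P}^0=\mathrm{id}$). A Steenrod image of $h$ is an element $\theta(h)$ with $\theta\in\mathcal{A}$. Block notation: for $k,l\ge 0$ write $N\in U(2k+l,\mathbb{F})$ as $N=\begin{pmatrix}A&0&0\\ B&F&0\\ C&D&E\end{pmatrix}$ with $A,E\in U(k,\mathbb{F})$, $F\in U(l,\mathbb{F})$. For $\epsilon=\pm1$ and $X_2$ an $l\times l$ matrix with $X_2=\epsilon\bar X_2^T$ put $$\mathfrak{G}^{\epsilon}_{J_k,X_2}=\{N\in U(2k+l,\mathbb{F}) : N^TY\bar N=Y\},\qquad Y=\begin{pmatrix}0&0&J_k\\ 0&X_2&0\\ \epsilon J_k&0&0\end{pmatrix}.$$ For $N$ in this group put $S=A^TJ_k\bar C$ (entries $s_{ij}$), and let $b_{ij}$ be the entries of $B$. The groups $X$ (each the stabilizer of $h$, equivalently of the indicated form), the forms $h$ and the subgroups $\mathfrak{G}$: (1) $X=GU(2m,q^2)=\{M\in GL_{2m}(\mathbb{F}_{q^2}):M^TJ_{2m}\bar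 M=J_{2m}\}$, $n=2m$, $h=\sum_{i=1}^m(x_{2m-i+1}^qx_i+x_{2m-i+1}x_i^q)$, $\mathfrak{G}=\mathfrak{G}^{+}_{J_{m-1},J_2}$. (2) $X=GU(2m+1,q^2)=\{M\in GL_{2m+1}(\mathbb{F}_{q^2}):M^TJ_{2m+1}\bar M=J_{2m+1}\}$, $n=2m+1$, $h=\sum_{i=1}^m(x_{2m+2-i}^qx_i+x_{2m+2-i}x_i^q)+x_{m+1}^{q+1}$, $\mathfrak{G}=\mathfrak{G}^{+}_{J_m,[1]}$. (3) $X=Sp(2m,q)$, the group of $M\in GL_{2m}(\mathbb{F}_q)$ with $M^TYM=Y$ where $Y=\begin{pmatrix}0&0&J_{m-1}\\ 0&X_2&0\\ -J_{m-1}&0&0\end{pmatrix}$ and $X_2=\begin{pmatrix}0&1\\ -1&0\end{pmatrix}$; $n=2m$, $h=\sum_{i=1}^m(x_{2m-i+1}^qx_i-x_{2m-i+1}x_i^q)$, $\mathfrak{G}=\mathfrak{G}^{-}_{J_{m-1},X_2}$. In the orthogonal cases $X$ is the group of all invertible matrices over $\mathbb{F}_q$ preserving the quadratic form $h$: (4) $X=O^+(2m,q)$, $n=2m$, $h=\sum_{i=1}^mx_{2m-i+1}x_i$. If $q$ is odd, $\mathfrak{G}=\mathfrak{G}^{+}_{J_{m-1},J_2}$. If $q$ is even, $\mathfrak{G}=G_1$ is the group of all $N\in\mathfrak{G}^{+}_{J_{m-1},J_2}$ with $F=I_2$ and $s_{ii}=b_{1i}b_{2i}$ for $1\le i\le m-1$.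 (5) $X=O^-(2m+2,q)$, $n=2m+2$, $h=\sum_{i=1}^mx_{2m+3-i}x_i+x_{m+1}^2+x_{m+1}x_{m+2}+ax_{m+2}^2$, where $a\in\mathbb{F}_q$ is such that $T^2+T+a$ is irreducible in $\mathbb{F}_q[T]$. If $q$ is odd, $\mathfrak{G}=\mathfrak{G}^{+}_{J_m,X_2}$ with $X_2=\begin{pmatrix}2&1\\ 1&2a\end{pmatrix}$. If $q$ is even, $\mathfrak{G}=G_1$ is the group of all $N\in\mathfrak{G}^{+}_{J_m,J_2}$ with $F=I_2$ and $s_{ii}=b_{1i}^2+b_{1i}b_{2i}+ab_{2i}^2$ for $1\le i\le m$. (6) $X=O(2m+1,q)$, $n=2m+1$, $h=\sum_{i=1}^mx_{2m+2-i}x_i+x_{m+1}^2$. If $q$ is odd, $\mathfrak{G}=\mathfrak{G}^{+}_{J_m,[2]}$. If $q$ is even, $\mathfrak{G}$ is the group of all $N\in\mathfrak{G}^{+}_{J_m,[0]}$ with $s_{ii}=b_{1i}^2$ for $1\le i\le m$. (In all cases except (4),(5) with $q$ even, $\mathfrak{G}$ is a Sylow $p$-subgroup of $X$; in those two cases it is a maximal subgroup of a Sylow $2$-subgroup.) *)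

theory Defs
  imports
    "HOL-Library.Cardinality"
    "HOL-Library.Poly_Mapping"
    "HOL-Computational_Algebra.Computational_Algebra"
    "Jordan_Normal_Form.Gauss_Jordan_Elimination"
begin

section \<open>Polynomial rings and linear actions\<close>

text \<open>
  All indices start at \<open>0\<close>: the variable \<open>x\<^sub>i\<close> of the usual notation is \<open>Var (i - 1)\<close>, and
  the \<open>(i,j)\<close> entry of a matrix \<open>M\<close> is \<open>M $$ (i - 1, j - 1)\<close>.  Polynomials live in one ring
  with countably many variables; \<open>\<F>[V]\<close> with \<open>dim V = n\<close> is the subring \<open>polys n\<close>.
\<close>

type_synonym 'a mpoly = "(nat \<Rightarrow>\<^sub>0 nat) \<Rightarrow>\<^sub>0 'a"

definition Const :: "'a::comm_ring_1 \<Rightarrow> 'a mpoly" where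
  "Const c = Poly_Mapping.single 0 c"

definition Var :: "nat \<Rightarrow> 'a::comm_ring_1 mpoly" where
  "Var i = Poly_Mapping.single (Poly_Mapping.single i 1) 1"

definition polys :: "nat \<Rightarrow> 'a::comm_ring_1 mpoly set" where
  "polys n = {f. \<forall>\<alpha>\<in>Poly_Mapping.keys f. Poly_Mapping.keys \<alpha> \<subseteq> {..<n}}"

text \<open>The ring homomorphism that is \<open>\<phi>\<close> on coefficients and maps the variable \<open>i\<close> to \<open>\<sigma> i\<close>.\<close>

definition subst_hom :: "('a::comm_ring_1 \<Rightarrow> 'b::comm_ring_1) \<Rightarrow> (nat \<Rightarrow> 'b) \<Rightarrow> 'a mpoly \<Rightarrow> 'b" where
  "subst_hom \<phi> \<sigma> f =
     (\<Sum>\<alpha>\<in>Poly_Mapping.keys f. \<phi> (Poly_Mapping.lookup f \<alpha>) *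
        (\<Prod>i\<in>Poly_Mapping.keys \<alpha>. \<sigma> i ^ Poly_Mapping.lookup \<alpha> i))"

text \<open>
  \<open>(g \<cdot> f)(v) = f (g\<^sup>-\<^sup>1 v)\<close>, so \<open>g \<cdot> x\<^sub>i\<close> is the linear form given by row \<open>i\<close> of \<open>g\<^sup>-\<^sup>1\<close>.
  Variables outside \<open>\<F>[V]\<close> are irrelevant and left fixed.
\<close>

definition act :: "'a::field mat \<Rightarrow> 'a mpoly \<Rightarrow> 'a mpoly" where
  "act g = subst_hom Const
     (\<lambda>i. if i < dim_row g
          then \<Sum>j<dim_row g. Const (the (mat_inverse g) $$ (i, j)) * Var j
          else Var i)"

definition invariants :: "nat \<Rightarrow> 'a::field mat set \<Rightarrow> 'a mpoly set" where
  "invariants n G = {f \<in> polys n. \<forall>g\<in>G. act g f = f}"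

definition orbit_product :: "'a::field mat set \<Rightarrow> 'a mpoly \<Rightarrow> 'a mpoly" where
  "orbit_product G f = (\<Prod>y\<in>(\<lambda>g. act g f) ` G. y)"

inductive_set subalgebra_gen :: "'a::comm_ring_1 mpoly set \<Rightarrow> 'a mpoly set"
  for S :: "'a mpoly set" where
  gen: "s \<in> S \<Longrightarrow> s \<in> subalgebra_gen S"
| const: "Const c \<in> subalgebra_gen S"
| add: "f \<in> subalgebra_gen S \<Longrightarrow> g \<in> subalgebra_gen S \<Longrightarrow> f + g \<in> subalgebra_gen S"
| mult: "f \<in> subalgebra_gen S \<Longrightarrow> g \<in> subalgebra_gen S \<Longrightarrow> f * g \<in> subalgebra_gen S"


section \<open>Steenrod operations\<close>

text \<open>The finite field is the coefficient type \<open>'a\<close>, so \<open>r = CARD('a)\<close>.\<close>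

definition steenrod_hom :: "'a::{field,finite} mpoly \<Rightarrow> 'a mpoly fps" where
  "steenrod_hom = subst_hom (\<lambda>c. fps_const (Const c))
     (\<lambda>j. fps_const (Var j) + fps_const (Var j ^ CARD('a)) * fps_X)"

definition steenrod_op :: "nat \<Rightarrow> 'a::{field,finite} mpoly \<Rightarrow> 'a mpoly" where
  "steenrod_op i f = fps_nth (steenrod_hom f) i"

text \<open>
  The operators are defined on the ambient ring; they preserve \<open>polys n\<close>, and restricting them
  to \<open>polys n\<close> gives the Steenrod algebra acting on \<open>\<F>[V]\<close>.
\<close>

inductive_set steenrod_algebra :: "('a::{field,finite} mpoly \<Rightarrow> 'a mpoly) set" where
  op: "steenrod_op i \<in> steenrod_algebra"
| id: "id \<in> steenrod_algebra"
| add: "\<theta> \<in> steenrod_algebra \<Longrightarrow> \<eta> \<in> steenrod_algebra \<Longrightarrow> (\<lambda>f. \<theta> f + \<eta> f) \<in> steenrod_algebra"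
| scale: "\<theta> \<in> steenrod_algebra \<Longrightarrow> (\<lambda>f. Const c * \<theta> f) \<in> steenrod_algebra"
| comp: "\<theta> \<in> steenrod_algebra \<Longrightarrow> \<eta> \<in> steenrod_algebra \<Longrightarrow> \<theta> \<circ> \<eta> \<in> steenrod_algebra"


section \<open>Fraction fields and integral closure\<close>

definition Quot :: "'a::idom set \<Rightarrow> 'a fract set" where
  "Quot R = {to_fract a / to_fract b | a b. a \<in> R \<and> b \<in> R \<and> b \<noteq> 0}"

definition integral_closure :: "'a::idom set \<Rightarrow> 'a fract set \<Rightarrow> 'a fract set" where
  "integral_closure R K =
     {z \<in> K. \<exists>f. lead_coeff f = 1 \<and> (\<forall>i. coeff f i \<in> to_fract ` R) \<and> poly f z = 0}"


section \<open>The classical groups\<close>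

definition GL :: "nat \<Rightarrow> 'a::field mat set" where
  "GL n = {M \<in> carrier_mat n n. invertible_mat M}"

definition unitri :: "nat \<Rightarrow> 'a::field mat set" where
  "unitri n = {M \<in> carrier_mat n n. (\<forall>i<n. M $$ (i, i) = 1) \<and>
     (\<forall>i<n. \<forall>j<n. i < j \<longrightarrow> M $$ (i, j) = 0)}"

definition J :: "nat \<Rightarrow> 'a::field mat" where
  "J k = mat k k (\<lambda>(i, j). if i + j + 1 = k then 1 else 0)"

definition bar :: "nat \<Rightarrow> 'a::field mat \<Rightarrow> 'a mat" where
  "bar q M = map_mat (\<lambda>x. x ^ q) M"

text \<open>\<open>J_form \<epsilon> k X\<^sub>2\<close> has the rows of blocks \<open>(0, 0, J\<^sub>k)\<close>, \<open>(0, X\<^sub>2, 0)\<close>, \<open>(\<epsilon> J\<^sub>k, 0, 0)\<close>.\<close>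

definition J_form :: "'a::field \<Rightarrow> nat \<Rightarrow> 'a mat \<Rightarrow> 'a mat" where
  "J_form \<epsilon> k X2 = (let l = dim_row X2 in
     four_block_mat
       (four_block_mat (0\<^sub>m k k) (0\<^sub>m k l) (0\<^sub>m l k) X2)
       (J k @\<^sub>r 0\<^sub>m l k)
       (four_block_mat (\<epsilon> \<cdot>\<^sub>m J k) (0\<^sub>m k l) (0\<^sub>m 0 k) (0\<^sub>m 0 l))
       (0\<^sub>m k k))"

definition G_form :: "nat \<Rightarrow> 'a::field \<Rightarrow> nat \<Rightarrow> 'a mat \<Rightarrow> 'a mat set" where
  "G_form q \<epsilon> k X2 = {N \<in> unitri (2 * k + dim_row X2).
     transpose_mat N * J_form \<epsilon> k X2 * bar q N = J_form \<epsilon> k X2}"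

text \<open>The blocks \<open>A\<close>, \<open>B\<close>, \<open>C\<close>, \<open>F\<close> of \<open>N\<close>, with block sizes \<open>k\<close>, \<open>l\<close>, \<open>k\<close>.\<close>

definition blk_A :: "nat \<Rightarrow> 'a mat \<Rightarrow> 'a mat" where
  "blk_A k N = mat k k (\<lambda>(i, j). N $$ (i, j))"

definition blk_B :: "nat \<Rightarrow> nat \<Rightarrow> 'a mat \<Rightarrow> 'a mat" where
  "blk_B k l N = mat l k (\<lambda>(i, j). N $$ (k + i, j))"

definition blk_C :: "nat \<Rightarrow> nat \<Rightarrow> 'a mat \<Rightarrow> 'a mat" where
  "blk_C k l N = mat k k (\<lambda>(i, j). N $$ (k + l + i, j))"

definition blk_F :: "nat \<Rightarrow> nat \<Rightarrow> 'a mat \<Rightarrow> 'a mat" where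
  "blk_F k l N = mat l l (\<lambda>(i, j). N $$ (k + i, k + j))"

definition blk_S :: "nat \<Rightarrow> nat \<Rightarrow> nat \<Rightarrow> 'a::field mat \<Rightarrow> 'a mat" where
  "blk_S q k l N = transpose_mat (blk_A k N) * J k * bar q (blk_C k l N)"

text \<open>
  \<open>classical_group q m X n h G\<close>: \<open>X\<close> is one of the six families of classical groups with
  parameters \<open>q\<close> and \<open>m\<close>, of degree \<open>n\<close> over the field \<open>'a\<close>, \<open>h\<close> is its defining form and \<open>G\<close>
  the associated \<open>p\<close>-subgroup.  The operation \<open>bar q\<close> is trivial if \<open>CARD('a) = q\<close>.
\<close>

inductive classical_group ::
  "nat \<Rightarrow> nat \<Rightarrow> 'a::{field,finite} mat set \<Rightarrow> nat \<Rightarrow> 'a mpoly \<Rightarrow> 'a mat set \<Rightarrow> bool"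
  for q m :: nat where
  GU_even: "\<lbrakk>CARD('a) = q\<^sup>2; n = 2 * m;
    X = {M \<in> GL n. transpose_mat M * J n * bar q M = J n};
    h = (\<Sum>i<m. Var (2 * m - 1 - i) ^ q * Var i + Var (2 * m - 1 - i) * Var i ^ q);
    G = G_form q 1 (m - 1) (J 2)\<rbrakk>
    \<Longrightarrow> classical_group q m (X :: 'a mat set) n h G"
| GU_odd: "\<lbrakk>CARD('a) = q\<^sup>2; n = 2 * m + 1;
    X = {M \<in> GL n. transpose_mat M * J n * bar q M = J n};
    h = (\<Sum>i<m. Var (2 * m - i) ^ q * Var i + Var (2 * m - i) * Var i ^ q) + Var m ^ (q + 1);
    G = G_form q 1 m (mat_of_rows_list 1 [[1]])\<rbrakk>
    \<Longrightarrow> classical_group q m (X :: 'a mat set) n h G"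
| Sp: "\<lbrakk>CARD('a) = q; n = 2 * m; X2 = mat_of_rows_list 2 [[0, 1], [-1, 0]];
    X = {M \<in> GL n. transpose_mat M * J_form (-1) (m - 1) X2 * M = J_form (-1) (m - 1) X2};
    h = (\<Sum>i<m. Var (2 * m - 1 - i) ^ q * Var i - Var (2 * m - 1 - i) * Var i ^ q);
    G = G_form q (-1) (m - 1) X2\<rbrakk>
    \<Longrightarrow> classical_group q m (X :: 'a mat set) n h G"
| O_plus: "\<lbrakk>CARD('a) = q; n = 2 * m;
    X = {M \<in> GL n. act M h = h};
    h = (\<Sum>i<m. Var (2 * m - 1 - i) * Var i);
    G = (if odd q then G_form q 1 (m - 1) (J 2)
         else {N \<in> G_form q 1 (m - 1) (J 2). blk_F (m - 1) 2 N = 1\<^sub>m 2 \<and>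
           (\<forall>i<m - 1. blk_S q (m - 1) 2 N $$ (i, i) =
              blk_B (m - 1) 2 N $$ (0, i) * blk_B (m - 1) 2 N $$ (1, i))})\<rbrakk>
    \<Longrightarrow> classical_group q m (X :: 'a mat set) n h G"
| O_minus: "\<lbrakk>CARD('a) = q; n = 2 * m + 2; irreducible [:a, 1, 1:];
    X = {M \<in> GL n. act M h = h};
    h = (\<Sum>i<m. Var (2 * m + 1 - i) * Var i) +
        Var m ^ 2 + Var m * Var (m + 1) + Const a * Var (m + 1) ^ 2;
    G = (if odd q then G_form q 1 m (mat_of_rows_list 2 [[2, 1], [1, 2 * a]])
         else {N \<in> G_form q 1 m (J 2). blk_F m 2 N = 1\<^sub>m 2 \<and>
           (\<forall>i<m. blk_S q m 2 N $$ (i, i) =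
              (blk_B m 2 N $$ (0, i))\<^sup>2 + blk_B m 2 N $$ (0, i) * blk_B m 2 N $$ (1, i) +
              a * (blk_B m 2 N $$ (1, i))\<^sup>2)})\<rbrakk>
    \<Longrightarrow> classical_group q m (X :: 'a mat set) n h G"
| O_odd: "\<lbrakk>CARD('a) = q; n = 2 * m + 1;
    X = {M \<in> GL n. act M h = h};
    h = (\<Sum>i<m. Var (2 * m - i) * Var i) + Var m ^ 2;
    G = (if odd q then G_form q 1 m (mat_of_rows_list 1 [[2]])
         else {N \<in> G_form q 1 m (mat_of_rows_list 1 [[0]]).
           \<forall>i<m. blk_S q m 1 N $$ (i, i) = (blk_B m 1 N $$ (0, i))\<^sup>2})\<rbrakk>
    \<Longrightarrow> classical_group q m (X :: 'a mat set) n h G"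

end

theory Submission
  imports Defs "Jordan_Normal_Form.Char_Poly"
begin

text \<open>
  Let \<open>K = Quot(R)\<close>, \<open>r = |F|\<close>, and let \<open>H\<close> be the matrix of the sesquilinear form belonging to \<open>h\<close>.
  The Steenrod images of \<open>h\<close> include all \<open>\<Sum> H\<^sub>i\<^sub>j x\<^sub>i x\<^sub>j\<^sup>s\<close> with \<open>s = q r\<^sup>k\<close>.  Reading these as Gram entries of the
  vectors \<open>x\<close>, \<open>Fr x\<close>, \<open>Fr\<^sup>2 x\<close> and so on shows that \<open>Fr\<^sup>n\<close> is a \<open>K\<close>-linear combination of the lower powers of the
  \<open>r\<close>-Frobenius \<open>Fr\<close> on \<open>x\<close>, as if the Dickson invariants lay in \<open>K\<close>.  Hence the sum \<open>w\<close> of the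
  \<open>Fr\<^sup>i x\<^sub>i\<close> is a root of a polynomial over \<open>K\<close> whose roots are the elements \<open>w(gx)\<close>, for \<open>g\<close>
  any matrix over \<open>F\<close>, and the \<open>x\<^sub>i\<close> are polynomials in \<open>w\<close> over \<open>K\<close>.  By Galois descent a polynomial lies in
  \<open>K\<close> as soon as it is fixed by every matrix \<open>g\<close> that fixes \<open>R\<close>.

  Such a \<open>g\<close> preserves \<open>h\<close> and the orbit products \<open>N(x\<^sub>i)\<close>.  Linear forms are prime and the orbit
  lengths are powers of \<open>p\<close>, so every row of \<open>g\<close> is a row of an element of \<open>G\<close>; thus \<open>g\<close> is
  unitriangular, and it lies in \<open>G\<close>.  Hence \<open>K\<close> contains all invariants; these are integral over \<open>R\<close> because
  the orbit products are, up to lower variables, monic in \<open>x\<^sub>i\<close>, and \<open>F[V]\<close> is integrally closed.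
\<close>

section \<open>Subfields and Galois descent\<close>

text \<open>The choice of \<open>w\<close> lets counting replace separability theory. The
  \<open>n * n\<close> Frobenius powers of the variables that occur in the \<open>w(gx)\<close> are
  independent over \<open>F\<close>, so the \<open>r ^ (n * n)\<close> matrices \<open>g\<close>,
  singular ones included, give that many distinct values: exactly the degree of the additive
  polynomial over \<open>K\<close> that kills them.

  Gram entries reach \<open>K\<close> because a Steenrod operation multiplies the exponent of the
  second argument of the form by \<open>r\<close>, while the power map multiplies both exponents.
  The second argument is therefore twisted in advance by \<open>q * r ^ n\<close>, which keeps it
  ahead of the first in every entry.

  The obstacle is \<open>O(2m+1,q)\<close> with \<open>q\<close> even: the polar form has a radical,
  so the Gram matrix of all variables is singular. There the relation is found on the other
  variables and then extended. In the even-dimensional orthogonal groups with \<open>q\<close> even,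
  the condition that the middle block is the identity is imposed besides fixing \<open>h\<close>; it
  concerns a single row, so orbit products still see it.\<close>

definition is_subring :: "'b::comm_ring_1 set \<Rightarrow> bool" where
  "is_subring C \<longleftrightarrow> 1 \<in> C \<and> (\<forall>x\<in>C. \<forall>y\<in>C. x - y \<in> C \<and> x * y \<in> C)"

definition is_subfield :: "'b::field set \<Rightarrow> bool" where
  "is_subfield K \<longleftrightarrow> is_subring K \<and> (\<forall>x\<in>K. inverse x \<in> K)"

definition polys_over :: "'b::comm_ring_1 set \<Rightarrow> 'b poly set" where
  "polys_over C = {P. \<forall>i. coeff P i \<in> C}"

lemma is_subring_diff: "is_subring C \<Longrightarrow> x \<in> C \<Longrightarrow> y \<in> C \<Longrightarrow> x - y \<in> C"
  and is_subring_mult: "is_subring C \<Longrightarrow> x \<in> C \<Longrightarrow> y \<in> C \<Longrightarrow> x * y \<in> C"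
  and is_subring_1: "is_subring C \<Longrightarrow> 1 \<in> C"
  by (auto simp: is_subring_def)

lemma is_subring_0: "is_subring C \<Longrightarrow> 0 \<in> C"
  using is_subring_diff is_subring_1 by fastforce

lemma is_subring_uminus: "is_subring C \<Longrightarrow> x \<in> C \<Longrightarrow> - x \<in> C"
  using is_subring_diff[of C 0 x] is_subring_0 by auto

lemma is_subring_add: "is_subring C \<Longrightarrow> x \<in> C \<Longrightarrow> y \<in> C \<Longrightarrow> x + y \<in> C"
  using is_subring_diff[of C x "- y"] is_subring_uminus by auto

lemma is_subring_power: "is_subring C \<Longrightarrow> x \<in> C \<Longrightarrow> x ^ k \<in> C"
  by (induction k) (auto simp: is_subring_1 is_subring_mult)

lemma is_subring_sum: "is_subring C \<Longrightarrow> (\<And>i. i \<in> I \<Longrightarrow> f i \<in> C) \<Longrightarrow> sum f I \<in> C"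
  by (induction I rule: infinite_finite_induct) (auto simp: is_subring_0 is_subring_add)

lemma is_subring_prod: "is_subring C \<Longrightarrow> (\<And>i. i \<in> I \<Longrightarrow> f i \<in> C) \<Longrightarrow> prod f I \<in> C"
  by (induction I rule: infinite_finite_induct) (auto simp: is_subring_1 is_subring_mult)

lemmas is_subring_intros = is_subring_diff is_subring_mult is_subring_1 is_subring_0
  is_subring_uminus is_subring_add is_subring_power is_subring_sum is_subring_prod

lemma is_subfield_subring: "is_subfield K \<Longrightarrow> is_subring K"
  and is_subfield_inverse: "is_subfield K \<Longrightarrow> x \<in> K \<Longrightarrow> inverse x \<in> K"
  by (auto simp: is_subfield_def)

lemma is_subfield_divide: "is_subfield K \<Longrightarrow> x \<in> K \<Longrightarrow> y \<in> K \<Longrightarrow> x / y \<in> K"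
  by (simp add: divide_inverse is_subring_mult is_subfield_subring is_subfield_inverse)

lemma is_subring_polys_over:
  assumes "is_subring C"
  shows "is_subring (polys_over C)"
  unfolding is_subring_def polys_over_def
  using assms by (auto simp: coeff_mult coeff_1 intro!: is_subring_intros)

lemma polys_over_const: "is_subring C \<Longrightarrow> c \<in> C \<Longrightarrow> [:c:] \<in> polys_over C"
  by (auto simp: polys_over_def coeff_pCons is_subring_0 split: nat.splits)

lemma polys_over_monom: "is_subring C \<Longrightarrow> c \<in> C \<Longrightarrow> monom c k \<in> polys_over C"
  by (auto simp: polys_over_def is_subring_0)

lemma polys_over_smult: "is_subring C \<Longrightarrow> c \<in> C \<Longrightarrow> P \<in> polys_over C \<Longrightarrow> Polynomial.smult c P \<in> polys_over C"
  by (auto simp: polys_over_def is_subring_mult)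

lemma polys_over_mono: "C \<subseteq> D \<Longrightarrow> P \<in> polys_over C \<Longrightarrow> P \<in> polys_over D"
  by (auto simp: polys_over_def)

section \<open>Determinants, division and inverses with coefficients in a subset\<close>

lemma det_mem:
  assumes "is_subring C" "A \<in> carrier_mat n n" "\<And>i j. i < n \<Longrightarrow> j < n \<Longrightarrow> A $$ (i, j) \<in> C"
  shows "det A \<in> C"
proof -
  have "signof \<pi> \<in> C" for \<pi>
    using assms(1) by (auto simp: sign_def intro!: is_subring_intros)
  moreover have "(\<Prod>i = 0..<n. A $$ (i, \<pi> i)) \<in> C" if "\<pi> permutes {0..<n}" for \<pi>
  proof (rule is_subring_prod[OF assms(1)])
    fix i assume "i \<in> {0..<n}"
    then have "\<pi> i \<in> {0..<n}" using permutes_in_image[OF that] by blast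
    then show "A $$ (i, \<pi> i) \<in> C" using assms(3) \<open>i \<in> {0..<n}\<close> by simp
  qed
  ultimately show ?thesis
    unfolding det_def'[OF assms(2)]
    by (intro is_subring_sum[OF assms(1)] is_subring_mult[OF assms(1)]) auto
qed

text \<open>Long division by a monic polynomial uses only ring operations on the coefficients. They
  are tracked in a set because \<open>K\<close> is a subset of a field type and not a type of its
  own.\<close>

lemma monic_division:
  fixes C :: "'b::idom set"
  assumes C: "is_subring C" and \<mu>: "\<mu> \<in> polys_over C" "lead_coeff \<mu> = 1"
    and P: "P \<in> polys_over C" and pos: "degree \<mu> > 0"
  shows "\<exists>a b. a \<in> polys_over C \<and> b \<in> polys_over C \<and> P = a * \<mu> + b \<and> degree b < degree \<mu>"
  using P
proof (induction "degree P" arbitrary: P rule: less_induct)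
  case less
  note PC = is_subring_polys_over[OF C]
  show ?case
  proof (cases "degree P < degree \<mu>")
    case True
    then show ?thesis
      using less.prems is_subring_0[OF PC] by (intro exI[of _ 0] exI[of _ P]) auto
  next
    case False
    define t where "t = monom (lead_coeff P) (degree P - degree \<mu>)"
    define P' where "P' = P - t * \<mu>"
    have tC: "t \<in> polys_over C"
      using less.prems by (auto simp: t_def polys_over_def is_subring_0[OF C])
    have P'C: "P' \<in> polys_over C"
      unfolding P'_def using tC less.prems \<mu> by (intro is_subring_intros PC)
    have nz: "P \<noteq> 0" using False pos by auto
    have \<mu>0: "\<mu> \<noteq> 0" using pos by auto
    have dt: "degree (t * \<mu>) = degree P"
      using nz \<mu>0 False by (subst degree_mult_eq) (auto simp: t_def degree_monom_eq monom_eq_0_iff)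
    have lt: "coeff (t * \<mu>) (degree P) = lead_coeff P"
    proof -
      have "lead_coeff (t * \<mu>) = lead_coeff P"
        using \<mu>(2) nz by (simp add: lead_coeff_mult t_def degree_monom_eq)
      then show ?thesis by (simp add: dt)
    qed
    have "degree P' < degree P"
    proof -
      have "degree P' \<le> degree P" unfolding P'_def using dt by (intro degree_diff_le) auto
      moreover have "coeff P' (degree P) = 0" by (simp add: P'_def lt)
      moreover have "degree P > 0" using False pos by auto
      ultimately show ?thesis
        by (metis degree_0 eq_zero_or_degree_less le_neq_implies_less)
    qed
    from less.hyps[OF this P'C] obtain a b where
      "a \<in> polys_over C" "b \<in> polys_over C" "P' = a * \<mu> + b" "degree b < degree \<mu>" by auto
    then show ?thesis
      using tC is_subring_add[OF PC, of a t]
      by (intro exI[of _ "a + t"] exI[of _ b]) (auto simp: P'_def algebra_simps)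
  qed
qed

text \<open>The inverse is the adjugate divided by the determinant, and both are polynomial in the
  entries. So it stays over \<open>K\<close>, although the kernel is tested with vectors over the
  whole field.\<close>

lemma matrix_inverse_over_subfield:
  fixes a :: "nat \<Rightarrow> nat \<Rightarrow> 'm::field"
  assumes K: "is_subfield K" and a: "\<And>i j. i < n \<Longrightarrow> j < n \<Longrightarrow> a i j \<in> K"
    and ker: "\<And>v. (\<And>i. i < n \<Longrightarrow> (\<Sum>j<n. a i j * v j) = 0) \<Longrightarrow> (\<forall>j<n. v j = 0)"
  obtains b where "\<And>i j. i < n \<Longrightarrow> j < n \<Longrightarrow> b i j \<in> K"
    and "\<And>i k. i < n \<Longrightarrow> k < n \<Longrightarrow> (\<Sum>j<n. b i j * a j k) = (if i = k then 1 else 0)"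
    and "\<And>i k. i < n \<Longrightarrow> k < n \<Longrightarrow> (\<Sum>j<n. a i j * b j k) = (if i = k then 1 else 0)"
proof -
  define A where "A = mat n n (\<lambda>(i, j). a i j)"
  note SK = is_subfield_subring[OF K]
  have A: "A \<in> carrier_mat n n" by (simp add: A_def)
  have d0: "det A \<noteq> 0"
  proof
    assume "det A = 0"
    then obtain v where v: "v \<in> carrier_vec n" "v \<noteq> 0\<^sub>v n" "A *\<^sub>v v = 0\<^sub>v n"
      using det_0_iff_vec_prod_zero[OF A] by auto
    have "(\<Sum>j<n. a i j * v $ j) = 0" if "i < n" for i
    proof -
      have "(A *\<^sub>v v) $ i = (\<Sum>j<n. a i j * v $ j)"
        using that v(1) by (auto simp: A_def scalar_prod_def lessThan_atLeast0)
      then show ?thesis using v(3) that by simp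
    qed
    from ker[OF this] have "v = 0\<^sub>v n" using v(1) by auto
    then show False using v(2) by simp
  qed
  define b where "b = (\<lambda>i j. adj_mat A $$ (i, j) / det A)"
  have ac: "adj_mat A \<in> carrier_mat n n" using adj_mat[OF A] by simp
  have dK: "det A \<in> K"
    using a by (intro det_mem[OF SK A]) (auto simp: A_def)
  show ?thesis
  proof (rule that[of b])
    fix i j assume ij: "i < n" "j < n"
    have "adj_mat A $$ (i, j) = (- 1) ^ (j + i) * det (mat_delete A j i)"
      using ij by (simp add: adj_mat_def A_def cofactor_def)
    moreover have "det (mat_delete A j i) \<in> K"
      using ij A a by (intro det_mem[OF SK mat_delete_carrier[OF A]]) (auto simp: mat_delete_def A_def)
    ultimately have "adj_mat A $$ (i, j) \<in> K"
      using SK by (auto intro!: is_subring_intros)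
    then show "b i j \<in> K" using K dK by (auto simp: b_def is_subfield_divide)
  next
    fix i k assume ik: "i < n" "k < n"
    have "(\<Sum>j<n. adj_mat A $$ (i, j) * a j k) = (adj_mat A * A) $$ (i, k)"
      using ik ac A by (auto simp: scalar_prod_def A_def lessThan_atLeast0)
    also have "\<dots> = (if i = k then det A else 0)"
      using adj_mat(3)[OF A] ik by simp
    finally show "(\<Sum>j<n. b i j * a j k) = (if i = k then 1 else 0)"
      using d0 by (auto simp: b_def sum_divide_distrib[symmetric])
  next
    fix i k assume ik: "i < n" "k < n"
    have "(\<Sum>j<n. a i j * adj_mat A $$ (j, k)) = (A * adj_mat A) $$ (i, k)"
      using ik ac A by (auto simp: scalar_prod_def A_def lessThan_atLeast0)
    also have "\<dots> = (if i = k then det A else 0)"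
      using adj_mat(2)[OF A] ik by simp
    finally show "(\<Sum>j<n. a i j * b j k) = (if i = k then 1 else 0)"
      using d0 by (auto simp: b_def sum_divide_distrib[symmetric])
  qed
qed

lemma poly_eq_0_if_many_roots:
  fixes P :: "'b::idom poly"
  assumes "A \<subseteq> {x. poly P x = 0}" "degree P < card A"
  shows "P = 0"
proof (rule ccontr)
  assume "P \<noteq> 0"
  have "card A \<le> card {x. poly P x = 0}"
    by (rule card_mono[OF poly_roots_finite[OF \<open>P \<noteq> 0\<close>] assms(1)])
  then show False using assms(2) card_poly_roots_bound[OF \<open>P \<noteq> 0\<close>] by simp
qed

text \<open>Let \<open>\<mu>\<close> be the minimal polynomial of \<open>w\<close>.  Reduced modulo \<open>\<mu>\<close>, the polynomial \<open>\<gamma> - f \<beta>\<close>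
  has at least \<open>deg \<mu>\<close> roots, so it vanishes and \<open>f\<close> is a quotient of two coefficients.\<close>

lemma galois_descent:
  fixes K :: "'m::field set"
  assumes K: "is_subfield K" and Q: "Q \<in> polys_over K" "Q \<noteq> 0"
    and A: "finite A" "degree Q = card A" "\<And>a. a \<in> A \<Longrightarrow> poly Q a = 0" and w: "w \<in> A"
    and \<beta>: "\<beta> \<in> polys_over K" "poly \<beta> w \<noteq> 0" and \<gamma>: "\<gamma> \<in> polys_over K"
    and conj: "\<And>w'. w' \<in> A \<Longrightarrow> (\<And>P. P \<in> polys_over K \<Longrightarrow> poly P w = 0 \<Longrightarrow> poly P w' = 0) \<Longrightarrow>
      poly \<gamma> w' = f * poly \<beta> w'"
  shows "f \<in> K"
proof -
  note S = is_subfield_subring[OF K]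
  define I where "I = {P \<in> polys_over K. P \<noteq> 0 \<and> poly P w = 0}"
  have "Q \<in> I" using Q A(3)[OF w] by (simp add: I_def)
  from ex_has_least_nat[of "\<lambda>P. P \<in> I", OF this, of degree]
  obtain \<mu>0 where \<mu>0: "\<mu>0 \<in> I" and min0: "\<And>P. P \<in> I \<Longrightarrow> degree \<mu>0 \<le> degree P"
    by blast
  define \<mu> where "\<mu> = Polynomial.smult (inverse (lead_coeff \<mu>0)) \<mu>0"
  have \<mu>: "\<mu> \<in> polys_over K" "\<mu> \<noteq> 0" "poly \<mu> w = 0" "lead_coeff \<mu> = 1" "degree \<mu> = degree \<mu>0"
    using \<mu>0 K S by (auto simp: \<mu>_def I_def polys_over_def intro!: is_subring_intros is_subfield_inverse)
  have pos: "degree \<mu> > 0"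
  proof (rule ccontr)
    assume "\<not> degree \<mu> > 0"
    then obtain c where "\<mu> = [:c:]" by (auto elim: degree_eq_zeroE)
    then show False using \<mu>(2,3) by auto
  qed
  have divides: "\<exists>a. P = a * \<mu>" if P: "P \<in> polys_over K" "poly P w = 0" for P
  proof -
    obtain a b where ab: "b \<in> polys_over K" "P = a * \<mu> + b" "degree b < degree \<mu>"
      using monic_division[OF S \<mu>(1,4) P(1) pos] by auto
    then have "poly b w = 0" using P(2) \<mu>(3) by simp
    then have "b = 0" using ab min0[of b] \<mu>(5) by (force simp: I_def)
    then show ?thesis using ab by auto
  qed
  define Z where "Z = {a \<in> A. poly \<mu> a = 0}"
  \<comment> \<open>\<open>Q\<close> has as many distinct roots in \<open>A\<close> as its degree,
    and the cofactor \<open>a\<close> accounts for at most \<open>degree a\<close> of them; the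
    others are roots of \<open>\<mu>\<close>. This is where separability enters.\<close>
  have cardZ: "degree \<mu> \<le> card Z"
  proof -
    obtain a where a: "Q = a * \<mu>" using divides[OF Q(1) A(3)[OF w]] by auto
    then have "a \<noteq> 0" using Q(2) by auto
    have "A \<subseteq> Z \<union> {x. poly a x = 0}" using A(3) a by (auto simp: Z_def)
    moreover have "finite (Z \<union> {x. poly a x = 0})"
      using poly_roots_finite[OF \<open>a \<noteq> 0\<close>] A(1) by (simp add: Z_def)
    ultimately have "card A \<le> card (Z \<union> {x. poly a x = 0})" by (rule card_mono[rotated])
    also have "\<dots> \<le> card Z + card {x. poly a x = 0}" by (rule card_Un_le)
    also have "card {x. poly a x = 0} \<le> degree a" by (rule card_poly_roots_bound[OF \<open>a \<noteq> 0\<close>])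
    finally show ?thesis using A(2) a \<mu>(2) \<open>a \<noteq> 0\<close> by (simp add: degree_mult_eq)
  qed
  \<comment> \<open>A root of \<open>\<mu>\<close> is a root of every polynomial over
    \<open>K\<close> that vanishes at \<open>w\<close>, as \<open>conj\<close> requires.\<close>
  have conjZ: "poly \<gamma> w' = f * poly \<beta> w'" if "w' \<in> Z" for w'
    using that divides by (intro conj) (fastforce simp: Z_def)+
  obtain a1 \<beta>' where \<beta>': "\<beta>' \<in> polys_over K" "\<beta> = a1 * \<mu> + \<beta>'" "degree \<beta>' < degree \<mu>"
    using monic_division[OF S \<mu>(1,4) \<beta>(1) pos] by auto
  obtain a2 \<gamma>' where \<gamma>': "\<gamma>' \<in> polys_over K" "\<gamma> = a2 * \<mu> + \<gamma>'" "degree \<gamma>' < degree \<mu>"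
    using monic_division[OF S \<mu>(1,4) \<gamma> pos] by auto
  define \<delta> where "\<delta> = \<gamma>' - Polynomial.smult f \<beta>'"
  have "degree \<delta> < degree \<mu>"
    unfolding \<delta>_def by (meson \<beta>'(3) \<gamma>'(3) degree_diff_less degree_smult_le le_less_trans)
  moreover have "Z \<subseteq> {x. poly \<delta> x = 0}"
    using conjZ by (auto simp: \<delta>_def \<beta>'(2) \<gamma>'(2) Z_def)
  ultimately have "\<delta> = 0"
    using cardZ by (intro poly_eq_0_if_many_roots[of Z]) auto
  then have eq: "\<gamma>' = Polynomial.smult f \<beta>'" by (simp add: \<delta>_def)
  have "\<beta>' \<noteq> 0" using \<beta>(2) \<beta>'(2) \<mu>(3) by auto
  then have "lead_coeff \<beta>' \<noteq> 0" by simp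
  then have "f = coeff \<gamma>' (degree \<beta>') / lead_coeff \<beta>'" by (simp add: eq)
  then show "f \<in> K" using \<beta>'(1) \<gamma>'(1) K by (auto simp: polys_over_def intro!: is_subfield_divide)
qed

section \<open>Frobenius-linear relations\<close>

text \<open>In a nontrivial ring, \<open>of_nat p = 0\<close> with \<open>p\<close> prime forces
  characteristic \<open>p\<close>. Commutative rings are allowed because the rule is also applied to
  polynomials and power series.\<close>

lemma frobenius_add:
  assumes "prime p" "of_nat p = (0::'b::comm_ring_1)"
  shows "(x + y :: 'b) ^ p ^ k = x ^ p ^ k + y ^ p ^ k"
proof -
  have "CHAR('b) = p"
  proof -
    have "CHAR('b) dvd p" using assms(2) by (simp add: of_nat_eq_0_iff_char_dvd)
    then have "CHAR('b) = 1 \<or> CHAR('b) = p" using assms(1) by (auto simp: prime_nat_iff)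
    moreover have "CHAR('b) \<noteq> 1" by simp
    ultimately show ?thesis by simp
  qed
  then show ?thesis using freshmans_dream'[where ?'a='b, of "p ^ k" k x y] assms(1) by auto
qed

lemma frobenius_sum:
  assumes "prime p" "of_nat p = (0::'b::comm_ring_1)"
  shows "(\<Sum>i\<in>I. f i :: 'b) ^ p ^ k = (\<Sum>i\<in>I. f i ^ p ^ k)"
  using frobenius_add[OF assms] prime_gt_0_nat[OF assms(1)]
  by (induction I rule: infinite_finite_induct) (auto simp: power_0_left)

lemma frobenius_uminus:
  assumes "prime p" "of_nat p = (0::'b::comm_ring_1)"
  shows "(- x :: 'b) ^ p ^ k = - (x ^ p ^ k)"
  using frobenius_add[OF assms, of x "- x" k] prime_gt_0_nat[OF assms(1)]
  by (simp add: power_0_left eq_neg_iff_add_eq_0 add.commute)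

lemma frobenius_diff:
  assumes "prime p" "of_nat p = (0::'b::comm_ring_1)"
  shows "(x - y :: 'b) ^ p ^ k = x ^ p ^ k - y ^ p ^ k"
  using frobenius_add[OF assms, of x "- y" k] frobenius_uminus[OF assms, of y k] by simp

text \<open>Translation by \<open>1\<close> permutes the ring, so the sum of all elements does not
  change when \<open>1\<close> is added to each of them.\<close>

lemma of_nat_card_eq_0: "of_nat CARD('a) = (0::'a::{finite,comm_ring_1})"
proof -
  have "(\<Sum>x\<in>UNIV. x :: 'a) = (\<Sum>x\<in>UNIV. x + 1)"
    by (rule sum.reindex_bij_witness[of _ "\<lambda>x. x + 1" "\<lambda>x. x - 1"]) auto
  then show ?thesis by (simp add: sum.distrib)
qed

lemma finite_field_power_card:
  fixes x :: "'a::{field,finite}"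
  shows "x ^ CARD('a) = x"
proof (cases "x = 0")
  case False
  have "x ^ (CARD('a) - 1) * \<Prod>(UNIV - {0}) = (\<Prod>y\<in>UNIV - {0}. x * y)"
    by (simp add: prod.distrib card_Diff_singleton)
  also have "\<dots> = \<Prod>(UNIV - {0})"
    by (rule prod.reindex_bij_witness[of _ "\<lambda>y. y / x" "\<lambda>y. x * y"]) (use False in auto)
  finally have "x ^ (CARD('a) - 1) = 1" by simp
  then have "x ^ Suc (CARD('a) - 1) = x" by (simp only: power_Suc mult_1_right)
  moreover have "Suc (CARD('a) - 1) = CARD('a)" using zero_less_card_finite[where ?'a='a] by simp
  ultimately show ?thesis by metis
qed (simp add: power_0_left)

lemma finite_field_power_card_power:
  fixes x :: "'a::{field,finite}"
  shows "x ^ CARD('a) ^ k = x"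
  by (induction k) (simp_all add: finite_field_power_card power_mult)

text \<open>A pair \<open>(i, k)\<close> of indices below \<open>N\<close> is coded as
  \<open>i * N + k\<close>, so that families indexed by matrix positions become vectors of length
  \<open>N * N\<close>.\<close>

lemma sum_div_mod:
  fixes f :: "nat \<Rightarrow> nat \<Rightarrow> 'b::comm_monoid_add"
  shows "(\<Sum>s<N * N. f (s div N) (s mod N)) = (\<Sum>i<N. \<Sum>k<N. f i k)"
proof -
  have "(\<Sum>i<N. \<Sum>k<N. f i k) = (\<Sum>(i, k)\<in>{..<N} \<times> {..<N}. f i k)"
    by (simp add: sum.cartesian_product)
  also have "\<dots> = (\<Sum>s<N * N. f (s div N) (s mod N))"
  proof (rule sum.reindex_bij_witness[of _ "\<lambda>s. (s div N, s mod N)" "\<lambda>(i, k). i * N + k"])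
    fix a :: "nat \<times> nat" assume a: "a \<in> {..<N} \<times> {..<N}"
    obtain i k where ik: "a = (i, k)" "i < N" "k < N" using a by auto
    have "i * N + k < Suc i * N" using ik by simp
    also have "\<dots> \<le> N * N" using ik by (intro mult_le_mono1) auto
    finally show "(case a of (i, k) \<Rightarrow> i * N + k) \<in> {..<N * N}" using ik by simp
  qed (auto simp: less_mult_imp_div_less intro!: mod_less_divisor, (metis gr0I less_nat_zero_code mult_is_0)?)
  finally show ?thesis by simp
qed

section \<open>A finite field embedded in a larger field\<close>

locale finite_subfield =
  fixes \<iota> :: "'a::{field,finite} \<Rightarrow> 'm::field" and p :: nat and r :: nat
  assumes \<iota>_add: "\<iota> (x + y) = \<iota> x + \<iota> y"
    and \<iota>_mult: "\<iota> (x * y) = \<iota> x * \<iota> y"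
    and \<iota>_1: "\<iota> 1 = 1"
    and p: "prime p" and r_def: "r = CARD('a)" and r_power: "\<exists>e. r = p ^ e"
begin

lemma \<iota>_0: "\<iota> 0 = 0"
  by (metis add.right_neutral add_left_cancel \<iota>_add)

lemma \<iota>_power: "\<iota> (x ^ k) = \<iota> x ^ k"
  by (induction k) (auto simp: \<iota>_1 \<iota>_mult)

lemma \<iota>_minus: "\<iota> (x - y) = \<iota> x - \<iota> y"
  using \<iota>_add[of "x - y" y] by simp

lemma \<iota>_frob: "\<iota> x ^ r ^ k = \<iota> x"
  unfolding r_def \<iota>_power[symmetric] by (simp add: finite_field_power_card_power)

lemma r_gt_1: "r > 1"
proof -
  have "card {0, 1 :: 'a} \<le> CARD('a)" by (intro card_mono) auto
  then show ?thesis by (simp add: r_def)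
qed

lemma of_nat_p: "of_nat p = (0::'m)"
proof -
  obtain e where "r = p ^ e" using r_power by auto
  then have "(of_nat p :: 'a) ^ e = 0" using of_nat_card_eq_0[where ?'a='a] by (simp add: r_def)
  then have "of_nat p = (0::'a)" by simp
  moreover have "\<iota> (of_nat k) = of_nat k" for k
    by (induction k) (auto simp: \<iota>_0 \<iota>_add \<iota>_1)
  ultimately show ?thesis by (metis \<iota>_0)
qed

lemma r_pow: "\<exists>e. r ^ k = p ^ e"
  using r_power by (metis power_mult)

lemma frob_sum: "(\<Sum>i\<in>I. f i :: 'm) ^ r ^ k = (\<Sum>i\<in>I. f i ^ r ^ k)"
  using r_pow[of k] frobenius_sum[OF p of_nat_p] by metis

lemma frob_diff: "(x - y :: 'm) ^ r ^ k = x ^ r ^ k - y ^ r ^ k"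
  using r_pow[of k] frobenius_diff[OF p of_nat_p] by metis

lemma frob_comb: "(\<Sum>l\<in>I. \<iota> (a l) * u l) ^ r ^ k = (\<Sum>l\<in>I. \<iota> (a l) * u l ^ r ^ k)"
  by (simp add: frob_sum power_mult_distrib \<iota>_frob)

definition indep :: "nat \<Rightarrow> (nat \<Rightarrow> 'm) \<Rightarrow> bool" where
  "indep N u \<longleftrightarrow> (\<forall>a. (\<Sum>l<N. \<iota> (a l) * u l) = 0 \<longrightarrow> (\<forall>l<N. a l = 0))"

definition span :: "nat \<Rightarrow> (nat \<Rightarrow> 'm) \<Rightarrow> 'm set" where
  "span N u = (\<lambda>a. \<Sum>l<N. \<iota> (a l) * u l) ` ({..<N} \<rightarrow>\<^sub>E UNIV)"

lemma span_memI: "(\<Sum>l<N. \<iota> (a l) * u l) \<in> span N u"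
  unfolding span_def
  by (rule image_eqI[of _ _ "restrict a {..<N}"]) auto

lemma span_elem: "l < N \<Longrightarrow> u l \<in> span N u"
  using span_memI[of "\<lambda>k. if k = l then 1 else 0" u N]
  by (simp add: \<iota>_0 \<iota>_1 if_distrib[of \<iota>] if_distrib[of "\<lambda>x. x * _"] cong: if_cong)

lemma finite_span: "finite (span N u)"
  unfolding span_def by (intro finite_imageI finite_PiE) auto

lemma card_span:
  assumes "indep N u"
  shows "card (span N u) = r ^ N"
proof -
  have "inj_on (\<lambda>a. \<Sum>l<N. \<iota> (a l) * u l) ({..<N} \<rightarrow>\<^sub>E UNIV)"
  proof (rule inj_onI)
    fix a b assume ab: "a \<in> {..<N} \<rightarrow>\<^sub>E (UNIV::'a set)" "b \<in> {..<N} \<rightarrow>\<^sub>E (UNIV::'a set)"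
      and eq: "(\<Sum>l<N. \<iota> (a l) * u l) = (\<Sum>l<N. \<iota> (b l) * u l)"
    have "(\<Sum>l<N. \<iota> (a l - b l) * u l) = 0"
      using eq by (simp add: \<iota>_minus left_diff_distrib sum_subtractf)
    then have "\<forall>l<N. a l - b l = 0" using assms unfolding indep_def by (elim allE[of _ "\<lambda>l. a l - b l"]) auto
    then show "a = b" using ab by (intro PiE_ext[of a _ _ b]) auto
  qed
  then show ?thesis unfolding span_def by (simp add: card_image card_PiE r_def)
qed

text \<open>The polynomial with coefficient \<open>c t\<close> at \<open>r ^ t\<close> is linear
  over the finite field as a function, so it vanishes on the span of the \<open>u l\<close>. The
  span has \<open>r ^ N\<close> elements, more than the degree allows. This is the nonsingularity of
  the Moore matrix of independent elements.\<close>

lemma additive_vanish: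
  assumes u: "indep N u" and v: "\<And>l. l < N \<Longrightarrow> (\<Sum>t<N. c t * u l ^ r ^ t) = 0" and t: "t < N"
  shows "c t = 0"
proof -
  define P where "P = (\<Sum>t<N. monom (c t) (r ^ t))"
  have "degree P \<le> r ^ (N - 1)"
    unfolding P_def using r_gt_1
    by (intro degree_sum_le) (auto intro!: order.trans[OF degree_monom_le] power_increasing)
  also have "\<dots> < r ^ N" using t r_gt_1 by (intro power_strict_increasing) auto
  finally have deg: "degree P < r ^ N" .
  have "poly P y = 0" if y: "y \<in> span N u" for y
  proof -
    obtain a where a: "y = (\<Sum>l<N. \<iota> (a l) * u l)" using y unfolding span_def by blast
    have "poly P y = (\<Sum>t<N. c t * (\<Sum>l<N. \<iota> (a l) * u l ^ r ^ t))"
      by (simp add: P_def poly_sum poly_monom a frob_comb)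
    also have "\<dots> = (\<Sum>l<N. \<Sum>t<N. c t * (\<iota> (a l) * u l ^ r ^ t))"
      unfolding sum_distrib_left by (rule sum.swap)
    also have "\<dots> = (\<Sum>l<N. \<iota> (a l) * (\<Sum>t<N. c t * u l ^ r ^ t))"
      by (simp add: sum_distrib_left mult.left_commute)
    also have "\<dots> = 0" using v by simp
    finally show ?thesis .
  qed
  then have "span N u \<subseteq> {y. poly P y = 0}" by auto
  then have "P = 0"
    using deg card_span[OF u] by (intro poly_eq_0_if_many_roots[of "span N u"]) auto
  then have "coeff P (r ^ t) = 0" by simp
  then show ?thesis
    using t r_gt_1 by (simp add: P_def coeff_sum power_inject_exp)
qed

end

section \<open>Primitive elements and Frobenius relations over a subfield\<close>

context finite_subfield begin

text \<open>The relation for the \<open>x j\<close> holds with the same coefficients for all their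
  combinations over the finite field. Thus the powers \<open>W g ^ r ^ t\<close> depend on the
  coordinates \<open>v g s\<close> through a matrix \<open>E\<close> over \<open>K\<close> that does
  not involve \<open>g\<close>. Inverting \<open>E\<close> expresses the coordinates as additive
  polynomials in \<open>W g\<close>, the same ones for every \<open>g\<close>.\<close>

lemma primitive_element:
  assumes K: "is_subfield K" and \<iota>K: "\<And>a. \<iota> a \<in> K"
    and d: "\<And>i. i < N \<Longrightarrow> d i \<in> K"
    and rel: "\<And>j. j < N \<Longrightarrow> x j ^ r ^ N = (\<Sum>i<N. d i * x j ^ r ^ i)"
    and ind: "indep (N * N) (\<lambda>t. x (t mod N) ^ r ^ (t div N))"
  shows "\<exists>w A Q X. finite A \<and> w \<in> A \<and> Q \<in> polys_over K \<and> Q \<noteq> 0 \<and> degree Q = card A \<and>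
    (\<forall>a\<in>A. poly Q a = 0) \<and> (\<forall>j<N. X j \<in> polys_over K \<and> poly (X j) w = x j) \<and>
    (\<forall>w'\<in>A. \<exists>g. \<forall>j<N. poly (X j) w' = (\<Sum>l<N. \<iota> (g j l) * x l))"
proof -
  note S = is_subfield_subring[OF K] and PS = is_subring_polys_over[OF is_subfield_subring[OF K]]
  define u where "u = (\<lambda>t. x (t mod N) ^ r ^ (t div N))"
  define y where "y = (\<lambda>g i. \<Sum>l<N. \<iota> (g (i::nat) l) * x l)"
  define A where "A = span (N * N) u"
  have ind_u: "indep (N * N) u" using ind by (simp add: u_def)
  have cardA: "card A = r ^ (N * N)" using card_span[OF ind_u] by (simp add: A_def)
  have y_rel: "y g j ^ r ^ N = (\<Sum>i<N. d i * y g j ^ r ^ i)" for g j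
  proof -
    have "y g j ^ r ^ N = (\<Sum>l<N. \<Sum>i<N. \<iota> (g j l) * (d i * x l ^ r ^ i))"
      by (simp add: y_def frob_comb rel sum_distrib_left)
    also have "\<dots> = (\<Sum>i<N. \<Sum>l<N. \<iota> (g j l) * (d i * x l ^ r ^ i))" by (rule sum.swap)
    also have "\<dots> = (\<Sum>i<N. d i * y g j ^ r ^ i)"
      by (simp add: y_def frob_comb sum_distrib_left mult.left_commute)
    finally show ?thesis .
  qed
  have "\<exists>e. (\<forall>k<N. e k \<in> K) \<and> (\<forall>g j. y g j ^ r ^ t = (\<Sum>k<N. e k * y g j ^ r ^ k))" for t
  proof (induction t)
    case 0
    show ?case
    proof (cases "N = 0")
      case True
      then show ?thesis by (simp add: y_def)
    next
      case False
      then show ?thesis using S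
        by (intro exI[of _ "\<lambda>k. if k = 0 then 1 else 0"])
          (auto simp: is_subring_0 is_subring_1 if_distrib[of "\<lambda>x. x * _"] cong: if_cong)
    qed
  next
    case (Suc t)
    then obtain e where e: "\<And>k. k < N \<Longrightarrow> e k \<in> K"
      "\<And>g j. y g j ^ r ^ t = (\<Sum>k<N. e k * y g j ^ r ^ k)" by blast
    show ?case
    proof (cases N)
      case 0
      then show ?thesis using r_gt_1 by (simp add: y_def power_0_left)
    next
      case (Suc M)
      \<comment> \<open>Raising to the power \<open>r\<close> shifts the Frobenius exponents by one;
        the top term becomes \<open>y g j ^ r ^ N\<close> and is expanded again by the
        relation.\<close>
      define e' where "e' = (\<lambda>k. (if k = 0 then 0 else e (k - 1) ^ r) + e M ^ r * d k)"
      have "y g j ^ r ^ Suc t = (\<Sum>k<N. e' k * y g j ^ r ^ k)" for g j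
      proof -
        have "y g j ^ r ^ Suc t = (y g j ^ r ^ t) ^ r ^ 1" by (simp flip: power_mult add: mult.commute)
        also have "\<dots> = (\<Sum>k<N. e k ^ r * y g j ^ r ^ Suc k)"
          unfolding e(2) frob_sum by (simp add: power_mult_distrib mult.commute flip: power_mult)
        also have "\<dots> = (\<Sum>k<M. e k ^ r * y g j ^ r ^ Suc k) + e M ^ r * y g j ^ r ^ N"
          by (simp add: Suc)
        also have "\<dots> = (\<Sum>k<M. e k ^ r * y g j ^ r ^ Suc k) + (\<Sum>k<N. e M ^ r * d k * y g j ^ r ^ k)"
          unfolding y_rel by (simp add: sum_distrib_left mult.assoc)
        also have "(\<Sum>k<M. e k ^ r * y g j ^ r ^ Suc k) =
          (\<Sum>k<N. (if k = 0 then 0 else e (k - 1) ^ r) * y g j ^ r ^ k)"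
          unfolding Suc sum.lessThan_Suc_shift by simp
        finally show ?thesis by (simp add: e'_def sum.distrib distrib_right)
      qed
      moreover have "e' k \<in> K" if "k < N" for k
        using that Suc e(1) d S by (auto simp: e'_def intro!: is_subring_intros)
      ultimately show ?thesis by blast
    qed
  qed
  then obtain e where e: "\<And>t k. k < N \<Longrightarrow> e t k \<in> K"
    "\<And>t g j. y g j ^ r ^ t = (\<Sum>k<N. e t k * y g j ^ r ^ k)" by metis
  \<comment> \<open>The index \<open>s\<close> codes the coordinate \<open>y g i ^ r ^ k\<close>
    with \<open>i = s div N\<close> and \<open>k = s mod N\<close>; \<open>E t s\<close> is its
    coefficient in \<open>W g ^ r ^ t\<close>.\<close>
  define E where "E = (\<lambda>t s. e (s div N + t) (s mod N))"
  define v where "v = (\<lambda>g s. y g (s div N) ^ r ^ (s mod N))"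
  define W where "W = (\<lambda>g. \<Sum>i<N. y g i ^ r ^ i)"
  have W_pow: "W g ^ r ^ t = (\<Sum>s<N * N. E t s * v g s)" for g t
  proof -
    have "W g ^ r ^ t = (\<Sum>i<N. y g i ^ r ^ (i + t))"
      by (simp add: W_def frob_sum power_add flip: power_mult)
    also have "\<dots> = (\<Sum>i<N. \<Sum>k<N. e (i + t) k * y g i ^ r ^ k)"
      by (simp flip: e(2))
    also have "\<dots> = (\<Sum>s<N * N. E t s * v g s)"
      unfolding E_def v_def by (rule sum_div_mod[symmetric])
    finally show ?thesis .
  qed
  have W_eq: "W g = (\<Sum>t<N * N. \<iota> (g (t div N) (t mod N)) * u t)" for g
  proof -
    have "W g = (\<Sum>i<N. \<Sum>l<N. \<iota> (g i l) * x l ^ r ^ i)"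
      by (simp add: W_def y_def frob_comb)
    then show ?thesis unfolding u_def
      by (simp only: sum_div_mod[of "\<lambda>i l. \<iota> (g i l) * x l ^ r ^ i" N])
  qed
  have A_W: "\<exists>g. w' = W g" if w': "w' \<in> A" for w'
  proof -
    obtain a where a: "w' = (\<Sum>t<N * N. \<iota> (a t) * u t)" using w' unfolding A_def span_def by blast
    have "W (\<lambda>i l. a (i * N + l)) = w'" unfolding W_eq a by (intro sum.cong) auto
    then show ?thesis by metis
  qed
  have W_A: "W g \<in> A" for g unfolding W_eq A_def by (rule span_memI)
  \<comment> \<open>A vector \<open>c\<close> orthogonal to all columns of \<open>E\<close> gives an
    additive polynomial that vanishes at every \<open>W g\<close>. The independent elements
    \<open>u l\<close> are among these values.\<close>
  have Enz: "\<forall>t<N * N. c t = 0" if c: "\<And>s. s < N * N \<Longrightarrow> (\<Sum>t<N * N. E t s * c t) = 0" for c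
  proof -
    have "(\<Sum>t<N * N. c t * W g ^ r ^ t) = 0" for g
    proof -
      have "(\<Sum>t<N * N. c t * W g ^ r ^ t) = (\<Sum>t<N * N. \<Sum>s<N * N. c t * (E t s * v g s))"
        unfolding W_pow by (simp add: sum_distrib_left)
      also have "\<dots> = (\<Sum>s<N * N. \<Sum>t<N * N. c t * (E t s * v g s))" by (rule sum.swap)
      also have "\<dots> = (\<Sum>s<N * N. (\<Sum>t<N * N. E t s * c t) * v g s)"
        by (simp add: sum_distrib_left sum_distrib_right mult_ac)
      also have "\<dots> = 0" using c by simp
      finally show ?thesis .
    qed
    then have "(\<Sum>t<N * N. c t * u l ^ r ^ t) = 0" if "l < N * N" for l
      using A_W[of "u l"] span_elem[OF that] by (auto simp: A_def)
    from additive_vanish[OF ind_u this] show ?thesis by blast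
  qed
  have EK: "E t s \<in> K" if "s < N * N" for t s
    using that unfolding E_def by (intro e(1)) (metis less_nat_zero_code mod_less_divisor mult_0 not_gr_zero)
  obtain b where b: "\<And>i j. i < N * N \<Longrightarrow> j < N * N \<Longrightarrow> b i j \<in> K"
    "\<And>i k. i < N * N \<Longrightarrow> k < N * N \<Longrightarrow> (\<Sum>j<N * N. E j i * b j k) = (if i = k then 1 else 0)"
    by (rule matrix_inverse_over_subfield[OF K, of "N * N" "\<lambda>i j. E j i"]) (use EK Enz that in blast)+
  define Xs where "Xs = (\<lambda>s. \<Sum>t<N * N. monom (b t s) (r ^ t))"
  have Xs_K: "Xs s \<in> polys_over K" if "s < N * N" for s
    unfolding Xs_def using that b(1) by (intro is_subring_sum[OF PS] polys_over_monom[OF S]) auto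
  have Xs_W: "poly (Xs s) (W g) = v g s" if s: "s < N * N" for s g
  proof -
    have "poly (Xs s) (W g) = (\<Sum>t<N * N. \<Sum>s'<N * N. b t s * (E t s' * v g s'))"
      by (simp add: Xs_def poly_sum poly_monom W_pow sum_distrib_left)
    also have "\<dots> = (\<Sum>s'<N * N. \<Sum>t<N * N. b t s * (E t s' * v g s'))" by (rule sum.swap)
    also have "\<dots> = (\<Sum>s'<N * N. (\<Sum>t<N * N. E t s' * b t s) * v g s')"
      by (simp add: sum_distrib_left sum_distrib_right mult_ac)
    also have "\<dots> = v g s" using b(2) s by (simp add: if_distrib[of "\<lambda>x. x * _"] cong: if_cong)
    finally show ?thesis .
  qed
  \<comment> \<open>The power \<open>W g ^ r ^ (N * N)\<close> is also a combination of the
    coordinates, hence the value at \<open>W g\<close> of a polynomial of smaller degree. The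
    difference \<open>Q\<close> has exactly the \<open>r ^ (N * N)\<close> elements of
    \<open>A\<close> as its roots.\<close>
  define Y where "Y = (\<Sum>s<N * N. Polynomial.smult (E (N * N) s) (Xs s))"
  have degY: "degree Y < r ^ (N * N)"
  proof (cases "N = 0")
    case False
    have "degree Y \<le> r ^ (N * N - 1)"
      unfolding Y_def Xs_def using r_gt_1
      by (intro degree_sum_le order.trans[OF degree_smult_le])
        (auto intro!: order.trans[OF degree_monom_le] power_increasing)
    also have "\<dots> < r ^ (N * N)" using False r_gt_1 by (intro power_strict_increasing) auto
    finally show ?thesis .
  qed (simp add: Y_def)
  define Q where "Q = monom 1 (r ^ (N * N)) - Y"
  have degQ: "degree Q = r ^ (N * N)"
    using degree_add_eq_left[of "- Y" "monom 1 (r ^ (N * N))"] degY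
    by (simp add: Q_def degree_monom_eq)
  have "Q \<in> polys_over K"
    unfolding Q_def Y_def using S EK Xs_K
    by (intro is_subring_diff[OF PS] is_subring_sum[OF PS] polys_over_monom polys_over_smult)
      (auto simp: is_subring_1)
  moreover have "poly Q a = 0" if "a \<in> A" for a
    using A_W[OF that] Xs_W by (auto simp: Q_def Y_def poly_monom poly_sum W_pow)
  \<comment> \<open>The index \<open>j * N\<close> codes the zeroth Frobenius power of
    \<open>y g j\<close>, which is \<open>x j\<close> for the identity matrix.\<close>
  moreover have "Xs (j * N) \<in> polys_over K"
    "poly (Xs (j * N)) (W (\<lambda>i l. if i = l then 1 else 0)) = x j" if j: "j < N" for j
  proof -
    have lt: "j * N < N * N" using j by simp
    show "Xs (j * N) \<in> polys_over K" by (rule Xs_K[OF lt])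
    show "poly (Xs (j * N)) (W (\<lambda>i l. if i = l then 1 else 0)) = x j"
      using j by (simp add: Xs_W[OF lt] v_def y_def if_distrib[of \<iota>] \<iota>_0 \<iota>_1 if_distrib[of "\<lambda>x. x * _"] cong: if_cong)
  qed
  moreover have "\<exists>g. \<forall>j<N. poly (Xs (j * N)) w' = (\<Sum>l<N. \<iota> (g j l) * x l)" if w': "w' \<in> A" for w'
  proof -
    obtain g where g: "w' = W g" using A_W[OF w'] by auto
    have "poly (Xs (j * N)) w' = (\<Sum>l<N. \<iota> (g j l) * x l)" if "j < N" for j
      using that by (simp add: g Xs_W v_def y_def)
    then show ?thesis by blast
  qed
  moreover have "finite A" unfolding A_def by (rule finite_span)
  moreover have "Q \<noteq> 0" "degree Q = card A" using degQ r_gt_1 by (auto simp: cardA)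
  ultimately show ?thesis
    using W_A[of "\<lambda>i l. if i = l then 1 else 0"]
    by (intro exI[of _ "W (\<lambda>i l. if i = l then 1 else 0)"] exI[of _ A] exI[of _ Q] exI[of _ "\<lambda>j. Xs (j * N)"] conjI ballI allI impI) simp_all
qed

text \<open>Over the large field the \<open>d i\<close> exist because the Moore matrix of the
  \<open>x j\<close> is invertible. Pairing the relation with the vectors
  \<open>(x j ^ s) ^ r ^ b\<close> through \<open>H\<close> turns it into a linear system for the
  \<open>d i\<close> whose entries are Gram values in \<open>K\<close>. Its matrix is a product of
  two Moore matrices with \<open>H\<close> in between, so the system can be solved in
  \<open>K\<close>.\<close>

lemma frobenius_relation:
  assumes K: "is_subfield K" and ind: "indep N x" and ind_s: "indep N (\<lambda>j. x j ^ s)"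
    and H: "\<And>u. (\<And>j. j < N \<Longrightarrow> (\<Sum>i<N. u i * H i j) = 0) \<Longrightarrow> (\<forall>i<N. u i = 0)"
    and gram: "\<And>a b. a \<le> N \<Longrightarrow> b < N \<Longrightarrow>
      (\<Sum>i<N. \<Sum>j<N. H i j * x i ^ r ^ a * (x j ^ s) ^ r ^ b) \<in> K"
  obtains d where "\<And>i. i < N \<Longrightarrow> d i \<in> K" "\<And>j. j < N \<Longrightarrow> x j ^ r ^ N = (\<Sum>i<N. d i * x j ^ r ^ i)"
proof -
  have moore: "\<forall>i<N. c i = 0" if "indep N z" "\<And>j. j < N \<Longrightarrow> (\<Sum>i<N. z j ^ r ^ i * c i) = 0" for c z
  proof -
    have "(\<Sum>t<N. c t * z l ^ r ^ t) = 0" if "l < N" for l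
      using \<open>\<And>j. j < N \<Longrightarrow> (\<Sum>i<N. z j ^ r ^ i * c i) = 0\<close>[OF that] by (simp add: mult.commute)
    from additive_vanish[OF \<open>indep N z\<close> this] show ?thesis by blast
  qed
  have UNIV: "is_subfield (UNIV :: 'm set)" by (simp add: is_subfield_def is_subring_def)
  obtain b where b: "\<And>i k. i < N \<Longrightarrow> k < N \<Longrightarrow> (\<Sum>j<N. x i ^ r ^ j * b j k) = (if i = k then 1 else 0)"
    by (rule matrix_inverse_over_subfield[OF UNIV, of N "\<lambda>j i. x j ^ r ^ i"]) (use moore[OF ind] that in blast)+
  obtain b' where b': "\<And>i k. i < N \<Longrightarrow> k < N \<Longrightarrow> (\<Sum>j<N. (x i ^ s) ^ r ^ j * b' j k) = (if i = k then 1 else 0)"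
    by (rule matrix_inverse_over_subfield[OF UNIV, of N "\<lambda>j i. (x j ^ s) ^ r ^ i"]) (use moore[OF ind_s] that in blast)+
  define d where "d = (\<lambda>i. \<Sum>l<N. b i l * x l ^ r ^ N)"
  have d: "x j ^ r ^ N = (\<Sum>i<N. d i * x j ^ r ^ i)" if j: "j < N" for j
  proof -
    have "(\<Sum>i<N. d i * x j ^ r ^ i) = (\<Sum>i<N. \<Sum>l<N. b i l * x l ^ r ^ N * x j ^ r ^ i)"
      by (simp add: d_def sum_distrib_right)
    also have "\<dots> = (\<Sum>l<N. \<Sum>i<N. b i l * x l ^ r ^ N * x j ^ r ^ i)" by (rule sum.swap)
    also have "\<dots> = (\<Sum>l<N. (\<Sum>i<N. x j ^ r ^ i * b i l) * x l ^ r ^ N)"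
      by (simp add: sum_distrib_left sum_distrib_right mult_ac)
    also have "\<dots> = x j ^ r ^ N" using b j by (simp add: if_distrib[of "\<lambda>x. x * _"] cong: if_cong)
    finally show ?thesis by simp
  qed
  define G where "G = (\<lambda>b a. \<Sum>i<N. \<Sum>j<N. H i j * x i ^ r ^ a * (x j ^ s) ^ r ^ b)"
  have G_comb: "(\<Sum>a<N. G b a * c a) =
      (\<Sum>j<N. (\<Sum>i<N. (\<Sum>a<N. c a * x i ^ r ^ a) * H i j) * (x j ^ s) ^ r ^ b)" for b c
  proof -
    have "(\<Sum>a<N. G b a * c a) = (\<Sum>a<N. \<Sum>j<N. \<Sum>i<N. H i j * x i ^ r ^ a * (x j ^ s) ^ r ^ b * c a)"
      unfolding G_def sum_distrib_right by (intro sum.cong refl sum.swap)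
    also have "\<dots> = (\<Sum>j<N. \<Sum>a<N. \<Sum>i<N. H i j * x i ^ r ^ a * (x j ^ s) ^ r ^ b * c a)"
      by (rule sum.swap)
    also have "\<dots> = (\<Sum>j<N. \<Sum>i<N. \<Sum>a<N. H i j * x i ^ r ^ a * (x j ^ s) ^ r ^ b * c a)"
      by (intro sum.cong refl sum.swap)
    also have "\<dots> = (\<Sum>j<N. (\<Sum>i<N. (\<Sum>a<N. c a * x i ^ r ^ a) * H i j) * (x j ^ s) ^ r ^ b)"
      by (simp add: sum_distrib_left sum_distrib_right mult_ac)
    finally show ?thesis .
  qed
  \<comment> \<open>The factors are cancelled in turn: the Moore matrix of the
    \<open>x j ^ s\<close> by its inverse \<open>b'\<close>, then \<open>H\<close> by hypothesis,
    and last the Moore matrix of the \<open>x j\<close>.\<close>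
  have Gnz: "\<forall>a<N. c a = 0" if c: "\<And>b. b < N \<Longrightarrow> (\<Sum>a<N. G b a * c a) = 0" for c
  proof -
    define z where "z = (\<lambda>j. \<Sum>i<N. (\<Sum>a<N. c a * x i ^ r ^ a) * H i j)"
    have z0: "(\<Sum>j<N. z j * (x j ^ s) ^ r ^ b) = 0" if "b < N" for b
      using c[OF that] unfolding G_comb z_def .
    have "z k = 0" if k: "k < N" for k
    proof -
      have "z k = (\<Sum>j<N. z j * (\<Sum>b<N. (x j ^ s) ^ r ^ b * b' b k))"
        using b' k by (simp add: if_distrib[of "\<lambda>x. _ * x"] cong: if_cong)
      also have "\<dots> = (\<Sum>j<N. \<Sum>b<N. z j * (x j ^ s) ^ r ^ b * b' b k)"
        by (simp add: sum_distrib_left mult.assoc)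
      also have "\<dots> = (\<Sum>b<N. \<Sum>j<N. z j * (x j ^ s) ^ r ^ b * b' b k)" by (rule sum.swap)
      also have "\<dots> = (\<Sum>b<N. (\<Sum>j<N. z j * (x j ^ s) ^ r ^ b) * b' b k)"
        by (simp add: sum_distrib_right)
      also have "\<dots> = 0" using z0 by simp
      finally show ?thesis .
    qed
    then have "\<forall>i<N. (\<Sum>a<N. c a * x i ^ r ^ a) = 0" unfolding z_def by (rule H)
    then show ?thesis by (intro moore[OF ind]) (simp add: mult.commute)
  qed
  have GK: "G b a \<in> K" if "a \<le> N" "b < N" for a b
    using gram[OF that] by (simp add: G_def)
  obtain c where c: "\<And>i j. i < N \<Longrightarrow> j < N \<Longrightarrow> c i j \<in> K"
    "\<And>i k. i < N \<Longrightarrow> k < N \<Longrightarrow> (\<Sum>j<N. c i j * G j k) = (if i = k then 1 else 0)"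
    by (rule matrix_inverse_over_subfield[OF K, of N G]) (use GK[OF less_imp_le] Gnz that in blast)+
  have Gd: "G b N = (\<Sum>a<N. G b a * d a)" for b
    unfolding G_comb by (simp add: d[symmetric]) (unfold G_def, subst sum.swap, simp add: sum_distrib_left sum_distrib_right mult_ac)
  have dK: "d i \<in> K" if i: "i < N" for i
  proof -
    have "d i = (\<Sum>a<N. (\<Sum>j<N. c i j * G j a) * d a)"
      using c(2) i by (simp add: if_distrib[of "\<lambda>x. x * _"] cong: if_cong)
    also have "\<dots> = (\<Sum>a<N. \<Sum>j<N. c i j * G j a * d a)" by (simp add: sum_distrib_right)
    also have "\<dots> = (\<Sum>j<N. \<Sum>a<N. c i j * G j a * d a)" by (rule sum.swap)
    also have "\<dots> = (\<Sum>j<N. c i j * G j N)" unfolding Gd by (simp add: sum_distrib_left mult.assoc)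
    also have "\<dots> \<in> K" using c(1) GK i is_subfield_subring[OF K] by (auto intro!: is_subring_intros)
    finally show ?thesis .
  qed
  show ?thesis using that[of d] dK d by blast
qed

end

section \<open>Homomorphisms of polynomial rings\<close>

definition monomial_value :: "(nat \<Rightarrow> 'b::comm_ring_1) \<Rightarrow> (nat \<Rightarrow>\<^sub>0 nat) \<Rightarrow> 'b" where
  "monomial_value \<sigma> \<alpha> = (\<Prod>i\<in>Poly_Mapping.keys \<alpha>. \<sigma> i ^ Poly_Mapping.lookup \<alpha> i)"

lemma monomial_value_superset:
  assumes "finite S" "Poly_Mapping.keys \<alpha> \<subseteq> S"
  shows "monomial_value \<sigma> \<alpha> = (\<Prod>i\<in>S. \<sigma> i ^ Poly_Mapping.lookup \<alpha> i)"
  unfolding monomial_value_def using assms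
  by (intro prod.mono_neutral_left) (auto simp: in_keys_iff)

lemma monomial_value_add: "monomial_value \<sigma> (\<alpha> + \<beta>) = monomial_value \<sigma> \<alpha> * monomial_value \<sigma> \<beta>"
proof -
  let ?S = "Poly_Mapping.keys \<alpha> \<union> Poly_Mapping.keys \<beta>"
  have "monomial_value \<sigma> (\<alpha> + \<beta>) = (\<Prod>i\<in>?S. \<sigma> i ^ Poly_Mapping.lookup (\<alpha> + \<beta>) i)"
    using keys_add[of \<alpha> \<beta>] by (intro monomial_value_superset) auto
  also have "\<dots> = (\<Prod>i\<in>?S. \<sigma> i ^ Poly_Mapping.lookup \<alpha> i) * (\<Prod>i\<in>?S. \<sigma> i ^ Poly_Mapping.lookup \<beta> i)"
    by (simp add: lookup_add power_add prod.distrib)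
  finally show ?thesis by (simp add: monomial_value_superset[of ?S])
qed

lemma monomial_value_single: "monomial_value \<sigma> (Poly_Mapping.single i k) = \<sigma> i ^ k"
  by (cases "k = 0") (simp_all add: monomial_value_def)

lemma mpoly_sum_single:
  fixes f :: "'a::comm_ring_1 mpoly"
  shows "f = (\<Sum>\<alpha>\<in>Poly_Mapping.keys f. Poly_Mapping.single \<alpha> (Poly_Mapping.lookup f \<alpha>))"
proof (rule poly_mapping_eqI)
  fix \<beta>
  show "Poly_Mapping.lookup f \<beta> =
    Poly_Mapping.lookup (\<Sum>\<alpha>\<in>Poly_Mapping.keys f. Poly_Mapping.single \<alpha> (Poly_Mapping.lookup f \<alpha>)) \<beta>"
    by (cases "\<beta> \<in> Poly_Mapping.keys f")
      (auto simp: lookup_sum lookup_single when_def in_keys_iff cong: if_cong)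
qed

context comm_ring_hom begin

lemma subst_hom_superset:
  assumes "finite S" "Poly_Mapping.keys f \<subseteq> S"
  shows "subst_hom hom \<sigma> f = (\<Sum>\<alpha>\<in>S. hom (Poly_Mapping.lookup f \<alpha>) * monomial_value \<sigma> \<alpha>)"
  unfolding subst_hom_def monomial_value_def using assms
  by (intro sum.mono_neutral_left) (auto simp: in_keys_iff)

lemma subst_hom_add: "subst_hom hom \<sigma> (f + g) = subst_hom hom \<sigma> f + subst_hom hom \<sigma> g"
proof -
  let ?S = "Poly_Mapping.keys f \<union> Poly_Mapping.keys g"
  have "subst_hom hom \<sigma> (f + g) = (\<Sum>\<alpha>\<in>?S. hom (Poly_Mapping.lookup (f + g) \<alpha>) * monomial_value \<sigma> \<alpha>)"
    using keys_add[of f g] by (intro subst_hom_superset) auto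
  also have "\<dots> = (\<Sum>\<alpha>\<in>?S. hom (Poly_Mapping.lookup f \<alpha>) * monomial_value \<sigma> \<alpha>)
      + (\<Sum>\<alpha>\<in>?S. hom (Poly_Mapping.lookup g \<alpha>) * monomial_value \<sigma> \<alpha>)"
    by (simp add: lookup_add hom_add distrib_right sum.distrib)
  finally show ?thesis by (simp add: subst_hom_superset[of ?S])
qed

lemma subst_hom_0: "subst_hom hom \<sigma> 0 = 0"
  by (simp add: subst_hom_def)

lemma subst_hom_sum: "subst_hom hom \<sigma> (sum f I) = (\<Sum>i\<in>I. subst_hom hom \<sigma> (f i))"
  by (induction I rule: infinite_finite_induct) (auto simp: subst_hom_0 subst_hom_add)

lemma subst_hom_single: "subst_hom hom \<sigma> (Poly_Mapping.single \<alpha> c) = hom c * monomial_value \<sigma> \<alpha>"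
  by (cases "c = 0") (auto simp: subst_hom_def monomial_value_def)

lemma subst_hom_mult: "subst_hom hom \<sigma> (f * g) = subst_hom hom \<sigma> f * subst_hom hom \<sigma> g"
proof -
  let ?s = "\<lambda>f \<alpha>. Poly_Mapping.single \<alpha> (Poly_Mapping.lookup f \<alpha>)"
  have "f * g = (\<Sum>\<alpha>\<in>Poly_Mapping.keys f. \<Sum>\<beta>\<in>Poly_Mapping.keys g. ?s f \<alpha> * ?s g \<beta>)"
    by (subst (1) mpoly_sum_single[of f], subst (1) mpoly_sum_single[of g]) (rule sum_product)
  then have "subst_hom hom \<sigma> (f * g) = (\<Sum>\<alpha>\<in>Poly_Mapping.keys f. \<Sum>\<beta>\<in>Poly_Mapping.keys g.
      subst_hom hom \<sigma> (?s f \<alpha>) * subst_hom hom \<sigma> (?s g \<beta>))"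
    by (simp add: subst_hom_sum mult_single subst_hom_single monomial_value_add hom_mult mult_ac)
  also have "\<dots> = subst_hom hom \<sigma> (\<Sum>\<alpha>\<in>Poly_Mapping.keys f. ?s f \<alpha>) * subst_hom hom \<sigma> (\<Sum>\<beta>\<in>Poly_Mapping.keys g. ?s g \<beta>)"
    by (simp add: subst_hom_sum sum_product)
  finally show ?thesis by (simp flip: mpoly_sum_single)
qed

lemma subst_hom_Const: "subst_hom hom \<sigma> (Const c) = hom c"
  by (simp add: Const_def subst_hom_single monomial_value_def)

lemma subst_hom_Var: "subst_hom hom \<sigma> (Var i) = \<sigma> i"
  by (simp add: Var_def subst_hom_single monomial_value_single)

lemma comm_ring_hom_subst_hom: "comm_ring_hom (subst_hom hom \<sigma>)"
proof -
  have one: "(1 :: 'a mpoly) = Const 1" by (simp add: Const_def)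
  show ?thesis
    by unfold_locales
      (auto simp: subst_hom_add subst_hom_mult subst_hom_0 one subst_hom_Const simp del: single_one)
qed

end

lemma comm_ring_hom_Const: "comm_ring_hom (Const :: 'a::comm_ring_1 \<Rightarrow> 'a mpoly)"
  by unfold_locales (auto simp: Const_def single_add mult_single)

lemma comm_ring_hom_to_fract: "comm_ring_hom (to_fract :: 'b::idom \<Rightarrow> 'b fract)"
  by unfold_locales (auto simp: to_fract_add to_fract_mult)

lemma comm_ring_hom_comp:
  "comm_ring_hom f \<Longrightarrow> comm_ring_hom g \<Longrightarrow> comm_ring_hom (\<lambda>x. f (g x))"
proof -
  assume "comm_ring_hom f" "comm_ring_hom g"
  then interpret f: comm_ring_hom f + g: comm_ring_hom g by auto
  show ?thesis by unfold_locales (auto simp: f.hom_add f.hom_mult g.hom_add g.hom_mult)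
qed

lemma Var_power: "(Var i :: 'a::comm_ring_1 mpoly) ^ k = Poly_Mapping.single (Poly_Mapping.single i k) 1"
  by (induction k) (auto simp: Var_def mult_single single_add[symmetric] simp flip: single_one)

lemma Const_mult_single: "Const c * Poly_Mapping.single \<alpha> a = Poly_Mapping.single \<alpha> (c * a)"
  by (simp add: Const_def mult_single)

lemma single_prod_Var:
  "Poly_Mapping.single \<alpha> (c :: 'a::comm_ring_1) =
    Const c * (\<Prod>i\<in>Poly_Mapping.keys \<alpha>. Var i ^ Poly_Mapping.lookup \<alpha> i)"
proof -
  have "(\<Prod>i\<in>I. Poly_Mapping.single (s i) (1::'a)) = Poly_Mapping.single (\<Sum>i\<in>I. s i) 1" for I and s :: "nat \<Rightarrow> nat \<Rightarrow>\<^sub>0 nat"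
    by (induction I rule: infinite_finite_induct) (auto simp: mult_single simp flip: single_one)
  moreover have "(\<Sum>i\<in>Poly_Mapping.keys \<alpha>. Poly_Mapping.single i (Poly_Mapping.lookup \<alpha> i)) = \<alpha>"
    by (rule poly_mapping_eqI)
      (auto simp: lookup_sum lookup_single when_def in_keys_iff cong: if_cong)
  ultimately show ?thesis by (simp add: Var_power Const_mult_single)
qed

lemma is_subring_subalgebra_gen: "is_subring (subalgebra_gen S :: 'a::comm_ring_1 mpoly set)"
proof -
  have 1: "(1 :: 'a mpoly) = Const 1" by (simp add: Const_def)
  have "x - y \<in> subalgebra_gen S" if "x \<in> subalgebra_gen S" "y \<in> subalgebra_gen S" for x y :: "'a mpoly"
  proof -
    have "x - y = x + Const (-1) * y" by (simp add: Const_def single_uminus)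
    then show ?thesis using that by (simp only:) (intro subalgebra_gen.add subalgebra_gen.mult subalgebra_gen.const)
  qed
  then show ?thesis unfolding is_subring_def 1 by (auto intro: subalgebra_gen.intros)
qed

lemma subalgebra_gen_least:
  assumes "is_subring C" "\<And>c. Const c \<in> C" "S \<subseteq> C"
  shows "subalgebra_gen S \<subseteq> C"
proof
  fix f assume "f \<in> subalgebra_gen S"
  then show "f \<in> C" by induction (use assms in \<open>auto intro: is_subring_add is_subring_mult\<close>)
qed

lemma is_subring_polys: "is_subring (polys n :: 'a::comm_ring_1 mpoly set)"
proof -
  have "x * y \<in> polys n" if "x \<in> polys n" "y \<in> polys n" for x y :: "'a mpoly"
    unfolding polys_def
  proof (intro CollectI ballI)
    fix \<gamma> assume "\<gamma> \<in> Poly_Mapping.keys (x * y)"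
    then obtain \<alpha> \<beta> where "\<gamma> = \<alpha> + \<beta>" "\<alpha> \<in> Poly_Mapping.keys x" "\<beta> \<in> Poly_Mapping.keys y"
      using keys_mult[of x y] by blast
    then show "Poly_Mapping.keys \<gamma> \<subseteq> {..<n}"
      using that keys_add[of \<alpha> \<beta>] unfolding polys_def by blast
  qed
  moreover have "x - y \<in> polys n" if "x \<in> polys n" "y \<in> polys n" for x y :: "'a mpoly"
    unfolding polys_def
  proof (intro CollectI ballI)
    fix \<gamma> assume "\<gamma> \<in> Poly_Mapping.keys (x - y)"
    then have "\<gamma> \<in> Poly_Mapping.keys x \<or> \<gamma> \<in> Poly_Mapping.keys y"
      by (auto simp: in_keys_iff lookup_minus)
    then show "Poly_Mapping.keys \<gamma> \<subseteq> {..<n}"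
      using that unfolding polys_def by blast
  qed
  moreover have "1 \<in> polys n" by (simp add: polys_def)
  ultimately show ?thesis unfolding is_subring_def by blast
qed

lemma Const_in_polys: "Const c \<in> polys n"
  by (auto simp: polys_def Const_def)

lemma Var_in_polys: "i < n \<Longrightarrow> Var i \<in> polys n"
  by (auto simp: polys_def Var_def)

lemma polys_eq_subalgebra_gen: "polys n = subalgebra_gen (Var ` {..<n} :: 'a::comm_ring_1 mpoly set)"
proof
  show "subalgebra_gen (Var ` {..<n}) \<subseteq> (polys n :: 'a mpoly set)"
    by (rule subalgebra_gen_least) (auto simp: is_subring_polys Const_in_polys Var_in_polys)
  show "polys n \<subseteq> subalgebra_gen (Var ` {..<n} :: 'a mpoly set)"
  proof
    fix f :: "'a mpoly" assume f: "f \<in> polys n"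
    note S = is_subring_subalgebra_gen[of "Var ` {..<n}"]
    have "(\<Sum>\<alpha>\<in>Poly_Mapping.keys f. Poly_Mapping.single \<alpha> (Poly_Mapping.lookup f \<alpha>)) \<in> subalgebra_gen (Var ` {..<n})"
      unfolding single_prod_Var using f
      by (intro is_subring_sum[OF S] is_subring_mult[OF S] is_subring_prod[OF S] is_subring_power[OF S])
        (auto simp: polys_def intro!: subalgebra_gen.const subalgebra_gen.gen)
    then show "f \<in> subalgebra_gen (Var ` {..<n})" by (simp flip: mpoly_sum_single)
  qed
qed

lemma polys_induct [consumes 1, case_names Const Var add mult]:
  assumes "f \<in> polys n" "\<And>c. P (Const c)" "\<And>i. i < n \<Longrightarrow> P (Var i)"
    "\<And>f g. f \<in> polys n \<Longrightarrow> g \<in> polys n \<Longrightarrow> P f \<Longrightarrow> P g \<Longrightarrow> P (f + g)" "\<And>f g. f \<in> polys n \<Longrightarrow> g \<in> polys n \<Longrightarrow> P f \<Longrightarrow> P g \<Longrightarrow> P (f * g)"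
  shows "P f"
  using assms(1) unfolding polys_eq_subalgebra_gen
  by induction (use assms(2-5) in \<open>auto simp: polys_eq_subalgebra_gen\<close>)

lemma polys_exhaust: "\<exists>n. f \<in> polys n"
proof -
  have fin: "finite (\<Union>\<alpha>\<in>Poly_Mapping.keys f. Poly_Mapping.keys \<alpha>)" by auto
  then obtain n where "(\<Union>\<alpha>\<in>Poly_Mapping.keys f. Poly_Mapping.keys \<alpha>) \<subseteq> {..<n}"
    using finite_nat_iff_bounded by metis
  then show ?thesis by (auto simp: polys_def intro!: exI[of _ n])
qed

lemma hom_eq_on_polys:
  assumes F: "comm_ring_hom F" and G: "comm_ring_hom G" and f: "f \<in> polys n"
    and "\<And>c. F (Const c) = G (Const c)" "\<And>i. i < n \<Longrightarrow> F (Var i) = G (Var i)"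
  shows "F f = G f"
proof -
  interpret F: comm_ring_hom F by fact
  interpret G: comm_ring_hom G by fact
  show ?thesis using f
    by (induction rule: polys_induct) (use assms in \<open>auto simp: F.hom_add F.hom_mult G.hom_add G.hom_mult\<close>)
qed

lemma hom_eq:
  assumes "comm_ring_hom F" "comm_ring_hom G"
    and "\<And>c. F (Const c) = G (Const c)" "\<And>i. F (Var i) = G (Var i)"
  shows "F f = G f"
  using polys_exhaust[of f] hom_eq_on_polys[OF assms(1,2) _ assms(3,4)] by blast

lemma single_independent:
  assumes "finite I" "inj_on \<mu> I" "(\<Sum>t\<in>I. Const (c t) * Poly_Mapping.single (\<mu> t) 1) = 0" "t \<in> I"
  shows "c t = 0"
proof -
  have "Poly_Mapping.lookup (\<Sum>t\<in>I. Const (c t) * Poly_Mapping.single (\<mu> t) 1) (\<mu> t) = 0"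
    using assms(3) by simp
  also have "Poly_Mapping.lookup (\<Sum>t\<in>I. Const (c t) * Poly_Mapping.single (\<mu> t) 1) (\<mu> t)
      = (\<Sum>s\<in>I. if s = t then c s else 0)"
    unfolding lookup_sum
    using assms(2,4) by (intro sum.cong) (auto simp: Const_mult_single lookup_single when_def inj_on_eq_iff)
  finally show ?thesis using assms(1,4) by simp
qed

lemma is_subring_hom_image:
  assumes "comm_ring_hom h" "is_subring S"
  shows "is_subring (h ` S)"
proof -
  interpret comm_ring_hom h by fact
  show ?thesis
    unfolding is_subring_def
    using assms(2)
    by (auto simp: is_subring_def simp flip: hom_one hom_minus hom_mult)
qed

section \<open>Integral elements\<close>

inductive_set lspan :: "'m::comm_ring_1 set \<Rightarrow> 'm set \<Rightarrow> 'm set" for C B where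
  zero: "0 \<in> lspan C B"
| step: "c \<in> C \<Longrightarrow> b \<in> B \<Longrightarrow> v \<in> lspan C B \<Longrightarrow> c * b + v \<in> lspan C B"

text \<open>For finite \<open>B\<close> these are the elements that map a finitely generated
  \<open>C\<close>-module into itself. They form a ring, so sums and products of integral elements
  need no treatment of their own.\<close>

definition multipliers :: "'m::comm_ring_1 set \<Rightarrow> 'm set \<Rightarrow> 'm set" where
  "multipliers C B = {z. \<forall>b\<in>B. b * z \<in> lspan C B}"

lemma lspan_add: "v \<in> lspan C B \<Longrightarrow> w \<in> lspan C B \<Longrightarrow> v + w \<in> lspan C B"
  by (induction rule: lspan.induct) (auto simp: add.assoc intro: lspan.step)

lemma lspan_scale: "is_subring C \<Longrightarrow> c \<in> C \<Longrightarrow> v \<in> lspan C B \<Longrightarrow> c * v \<in> lspan C B"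
  by (rotate_tac 2, induction rule: lspan.induct)
    (auto simp: distrib_left mult.assoc[symmetric] intro!: lspan.zero lspan.step is_subring_mult)

lemma lspan_base: "is_subring C \<Longrightarrow> b \<in> B \<Longrightarrow> b \<in> lspan C B"
  using lspan.step[of 1 C b B 0] by (auto simp: is_subring_1 lspan.zero)

lemma lspan_sum: "(\<And>i. i \<in> I \<Longrightarrow> f i \<in> lspan C B) \<Longrightarrow> sum f I \<in> lspan C B"
  by (induction I rule: infinite_finite_induct) (auto intro: lspan.zero lspan_add)

lemma lspan_mult_right:
  assumes "is_subring C" "v \<in> lspan C B" "\<And>b. b \<in> B \<Longrightarrow> b * z \<in> lspan C B'"
  shows "v * z \<in> lspan C B'"
  using assms(2)
  by induction (auto simp: distrib_right mult.assoc intro!: lspan.zero lspan_add lspan_scale assms)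

lemma is_subring_multipliers:
  assumes "is_subring C"
  shows "is_subring (multipliers C B)"
proof -
  have "x - y \<in> multipliers C B" if "x \<in> multipliers C B" "y \<in> multipliers C B" for x y
    unfolding multipliers_def
  proof (intro CollectI ballI)
    fix b assume b: "b \<in> B"
    have "b * x \<in> lspan C B" "b * y \<in> lspan C B" using that b by (auto simp: multipliers_def)
    moreover have "- 1 \<in> C" by (rule is_subring_uminus[OF assms is_subring_1[OF assms]])
    ultimately have "b * x + (-1) * (b * y) \<in> lspan C B"
      using lspan_add[of "b * x" C B "- 1 * (b * y)"] lspan_scale[OF assms, of "- 1" "b * y" B] by blast
    then show "b * (x - y) \<in> lspan C B" by (simp add: algebra_simps)
  qed
  moreover have "x * y \<in> multipliers C B" if "x \<in> multipliers C B" "y \<in> multipliers C B" for x y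
    unfolding multipliers_def
  proof (intro CollectI ballI)
    fix b assume b: "b \<in> B"
    have "(b * x) * y \<in> lspan C B"
      by (rule lspan_mult_right[OF assms]) (use that b in \<open>auto simp: multipliers_def\<close>)
    then show "b * (x * y) \<in> lspan C B" by (simp add: mult.assoc)
  qed
  moreover have "1 \<in> multipliers C B" using assms by (auto simp: multipliers_def lspan_base)
  ultimately show ?thesis by (auto simp: is_subring_def)
qed

lemma subset_multipliers: "is_subring C \<Longrightarrow> C \<subseteq> multipliers C B"
  using lspan_scale[OF _ _ lspan_base] by (fastforce simp: multipliers_def mult.commute)

lemma lspan_coefficients:
  assumes "is_subring C" "finite B" "v \<in> lspan C B"
  shows "\<exists>a. (\<forall>b\<in>B. a b \<in> C) \<and> v = (\<Sum>b\<in>B. a b * b)"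
  using assms(3)
proof induction
  case zero
  then show ?case using assms(1) by (intro exI[of _ "\<lambda>_. 0"]) (auto simp: is_subring_0)
next
  case (step c b v)
  then obtain a where a: "\<forall>b\<in>B. a b \<in> C" "v = (\<Sum>b\<in>B. a b * b)" by auto
  have "c * b + v = (\<Sum>b'\<in>B. (if b' = b then c * b' else 0) + a b' * b')"
    using step.hyps assms(2) a(2) by (simp add: sum.distrib)
  also have "\<dots> = (\<Sum>b'\<in>B. (a b' + (if b' = b then c else 0)) * b')"
    by (intro sum.cong) (auto simp: algebra_simps)
  finally show ?case using a(1) step.hyps assms(1)
    by (intro exI[of _ "\<lambda>b'. a b' + (if b' = b then c else 0)"]) (auto intro: is_subring_add)
qed

text \<open>The determinant trick: the vector of all elements of \<open>B\<close>, nonzero because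
  of \<open>b0\<close>, is an eigenvector with eigenvalue \<open>z\<close> of a matrix over
  \<open>C\<close>, whose characteristic polynomial is monic over \<open>C\<close>.\<close>

lemma multipliers_integral:
  fixes C :: "'m::field set"
  assumes C: "is_subring C" and B: "finite B" "b0 \<in> B" "b0 \<noteq> 0" and z: "z \<in> multipliers C B"
  shows "\<exists>P\<in>polys_over C. lead_coeff P = 1 \<and> poly P z = 0"
proof -
  obtain bs where bs: "set bs = B" "distinct bs" using finite_distinct_list[OF B(1)] by auto
  define n where "n = length bs"
  have "\<exists>a. (\<forall>b'\<in>B. a b' \<in> C) \<and> b * z = (\<Sum>b'\<in>B. a b' * b')" if "b \<in> B" for b
    using lspan_coefficients[OF C B(1)] z that by (auto simp: multipliers_def)
  then obtain a where a: "\<And>b b'. b \<in> B \<Longrightarrow> b' \<in> B \<Longrightarrow> a b b' \<in> C"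
    "\<And>b. b \<in> B \<Longrightarrow> b * z = (\<Sum>b'\<in>B. a b b' * b')" by metis
  define M where "M = mat n n (\<lambda>(i, j). a (bs ! i) (bs ! j))"
  define v where "v = vec n (\<lambda>i. bs ! i)"
  have M: "M \<in> carrier_mat n n" by (simp add: M_def)
  have "M *\<^sub>v v = z \<cdot>\<^sub>v v"
  proof (rule eq_vecI)
    fix i assume "i < dim_vec (z \<cdot>\<^sub>v v)"
    then have i: "i < n" by (simp add: v_def)
    then have biB: "bs ! i \<in> B" using bs n_def nth_mem by metis
    have "(M *\<^sub>v v) $ i = (\<Sum>j<n. a (bs ! i) (bs ! j) * bs ! j)"
      using i by (simp add: M_def v_def scalar_prod_def lessThan_atLeast0)
    also have "\<dots> = (\<Sum>b'\<in>B. a (bs ! i) b' * b')"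
      using sum.reindex_bij_betw[OF bij_betw_nth[OF bs(2), of "{..<n}" B], of "\<lambda>b'. a (bs ! i) b' * b'"] bs(1)
      by (simp add: n_def)
    also have "\<dots> = bs ! i * z" using a(2)[OF biB] by simp
    finally show "(M *\<^sub>v v) $ i = (z \<cdot>\<^sub>v v) $ i" using i by (simp add: v_def mult.commute)
  qed (simp add: M_def v_def)
  moreover have "v \<noteq> 0\<^sub>v n"
  proof -
    obtain i where "i < n" "bs ! i = b0" using B(2) bs(1) by (metis in_set_conv_nth n_def)
    then show ?thesis using B(3) by (metis index_vec index_zero_vec(1) v_def)
  qed
  ultimately have "eigenvalue M z"
    unfolding eigenvalue_def eigenvector_def using M by (intro exI[of _ v]) (simp add: v_def)
  then have "poly (char_poly M) z = 0" using eigenvalue_root_char_poly[OF M] by simp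
  moreover have "lead_coeff (char_poly M) = 1" using degree_monic_char_poly[OF M] by simp
  moreover have "char_poly M \<in> polys_over C"
    unfolding char_poly_def
  proof (rule det_mem[OF is_subring_polys_over[OF C] char_poly_matrix_closed[OF M]])
    fix i j assume ij: "i < n" "j < n"
    have "a (bs ! i) (bs ! j) \<in> C" using ij bs n_def by (intro a(1)) auto
    then show "char_poly_matrix M $$ (i, j) \<in> polys_over C"
      using ij C by (auto simp: char_poly_matrix_def M_def polys_over_def coeff_pCons
          intro!: is_subring_intros split: nat.splits)
  qed
  ultimately show ?thesis by blast
qed

text \<open>The new module is generated by the products \<open>b * x ^ k\<close> with
  \<open>k\<close> below the degree of \<open>P\<close>. The coefficients of \<open>P\<close> need
  only be multipliers of the old module, so integral extensions can be stacked. The last clause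
  serves to bound denominators.\<close>

lemma multipliers_extend:
  fixes C :: "'m::idom set"
  assumes C: "is_subring C" and B: "finite B"
    and P: "P \<in> polys_over (multipliers C B)" "lead_coeff P = 1" "poly P x = 0"
  shows "\<exists>B'. finite B' \<and> B \<subseteq> B' \<and> multipliers C B \<subseteq> multipliers C B' \<and> x \<in> multipliers C B' \<and>
    (\<forall>b'\<in>B'. \<exists>b\<in>B. \<exists>k<degree P. b' = b * x ^ k)"
proof -
  define d where "d = degree P"
  have d: "d > 0"
  proof (rule ccontr)
    assume "\<not> d > 0"
    then obtain c where "P = [:c:]" by (auto simp: d_def elim: degree_eq_zeroE)
    then show False using P(2,3) by simp
  qed
  define B' where "B' = (\<lambda>(b, k). b * x ^ k) ` (B \<times> {..<d})"
  have base: "b * x ^ k \<in> lspan C B'" if "b \<in> B" "k < d" for b k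
    using that by (intro lspan_base[OF C]) (auto simp: B'_def)
  have "B \<subseteq> B'" using d by (force simp: B'_def)
  moreover have "multipliers C B \<subseteq> multipliers C B'"
  proof
    fix z assume z: "z \<in> multipliers C B"
    have "(b * x ^ k) * z \<in> lspan C B'" if "b \<in> B" "k < d" for b k
    proof -
      have "(b * z) * x ^ k \<in> lspan C B'"
        by (rule lspan_mult_right[OF C, of _ B]) (use z that base in \<open>auto simp: multipliers_def\<close>)
      then show ?thesis by (simp add: mult_ac)
    qed
    then show "z \<in> multipliers C B'" by (auto simp: multipliers_def B'_def)
  qed
  moreover have "x \<in> multipliers C B'"
  proof -
    have "(b * x ^ k) * x \<in> lspan C B'" if bk: "b \<in> B" "k < d" for b k
    proof (cases "Suc k < d")
      case True
      then show ?thesis using base[of b "Suc k"] bk by (simp add: mult_ac)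
    next
      case False
      then have k: "d = Suc k" using bk by simp
      have "0 = (\<Sum>j\<le>d. coeff P j * x ^ j)" using P(3) by (simp add: poly_altdef d_def)
      also have "\<dots> = (\<Sum>j<d. coeff P j * x ^ j) + x ^ d"
        using P(2) by (simp add: d_def lessThan_Suc_atMost[symmetric])
      finally have xd: "x ^ d = - (\<Sum>j<d. coeff P j * x ^ j)" by (simp add: eq_neg_iff_add_eq_0 add.commute)
      have "(b * x ^ k) * x = b * x ^ d" using k by (simp add: mult_ac)
      also have "\<dots> = (\<Sum>j<d. (-1) * (b * coeff P j * x ^ j))"
        by (simp add: xd mult.assoc sum_distrib_left sum_negf)
      also have "\<dots> \<in> lspan C B'"
      proof (rule lspan_sum)
        fix j assume j: "j \<in> {..<d}"
        have "b * coeff P j * x ^ j \<in> lspan C B'"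
          by (rule lspan_mult_right[OF C, of _ B]) (use P(1) bk base j in \<open>auto simp: polys_over_def multipliers_def\<close>)
        then show "(-1) * (b * coeff P j * x ^ j) \<in> lspan C B'"
          by (rule lspan_scale[OF C is_subring_uminus[OF C is_subring_1[OF C]]])
      qed
      finally show ?thesis .
    qed
    then show ?thesis by (auto simp: multipliers_def B'_def)
  qed
  moreover have "finite B'" using B by (simp add: B'_def)
  ultimately show ?thesis by (intro exI[of _ B']) (auto simp: B'_def d_def)
qed

text \<open>The elements are adjoined one after the other. The third hypothesis ranges over all
  rings \<open>D\<close> so that it can be used with the multipliers of the module built so far,
  which is what \<open>multipliers_extend\<close> asks for.\<close>

lemma triangular_integral:
  fixes C :: "'m::idom set" and n :: nat
  assumes C: "is_subring C"
    and P: "\<And>i. i < n \<Longrightarrow> lead_coeff (P i) = 1" "\<And>i. i < n \<Longrightarrow> poly (P i) (x i) = 0"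
      "\<And>i D. i < n \<Longrightarrow> is_subring D \<Longrightarrow> C \<subseteq> D \<Longrightarrow> (\<And>j. j < i \<Longrightarrow> x j \<in> D) \<Longrightarrow> P i \<in> polys_over D"
  shows "\<exists>B. finite B \<and> 1 \<in> B \<and> (\<forall>i<n. x i \<in> multipliers C B)"
proof -
  have "k \<le> n \<Longrightarrow> \<exists>B. finite B \<and> 1 \<in> B \<and> (\<forall>i<k. x i \<in> multipliers C B)" for k
  proof (induction k)
    case 0
    then show ?case by (intro exI[of _ "{1}"]) auto
  next
    case (Suc k)
    then obtain B where B: "finite B" "1 \<in> B" "\<And>i. i < k \<Longrightarrow> x i \<in> multipliers C B" by auto
    have "P k \<in> polys_over (multipliers C B)"
      using Suc.prems B(3) by (intro P(3) is_subring_multipliers C subset_multipliers) auto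
    from multipliers_extend[OF C B(1) this P(1,2)] Suc.prems obtain B' where
      "finite B'" "B \<subseteq> B'" "multipliers C B \<subseteq> multipliers C B'" "x k \<in> multipliers C B'" by auto
    then show ?case using B by (intro exI[of _ B']) (auto simp: less_Suc_eq)
  qed
  then show ?thesis by auto
qed

section \<open>Leading monomials and the integral closedness of polynomial rings\<close>

definition lead_monom :: "'a::zero mpoly \<Rightarrow> (nat \<Rightarrow>\<^sub>0 nat)" where
  "lead_monom f = Max (Poly_Mapping.keys f)"

lemma lead_monom_in_keys: "f \<noteq> 0 \<Longrightarrow> lead_monom f \<in> Poly_Mapping.keys f"
  unfolding lead_monom_def by (intro Max_in) auto

lemma lead_monom_ge: "\<alpha> \<in> Poly_Mapping.keys f \<Longrightarrow> \<alpha> \<le> lead_monom f"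
  unfolding lead_monom_def by (intro Max_ge) auto

text \<open>Exponents are ordered lexicographically, and addition is strictly monotone. So no other
  pair of exponents has the same sum as the two leading ones.\<close>

lemma lookup_mult_lead:
  fixes f g :: "'a::comm_ring_1 mpoly"
  shows "Poly_Mapping.lookup (f * g) (lead_monom f + lead_monom g) =
    Poly_Mapping.lookup f (lead_monom f) * Poly_Mapping.lookup g (lead_monom g)"
proof (cases "f = 0 \<or> g = 0")
  case False
  let ?s = "\<lambda>f \<alpha>. Poly_Mapping.single \<alpha> (Poly_Mapping.lookup f \<alpha>)"
  let ?a = "lead_monom f" and ?b = "lead_monom g"
  have "f * g = (\<Sum>\<alpha>\<in>Poly_Mapping.keys f. \<Sum>\<beta>\<in>Poly_Mapping.keys g. ?s f \<alpha> * ?s g \<beta>)"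
    by (subst (1) mpoly_sum_single[of f], subst (1) mpoly_sum_single[of g]) (rule sum_product)
  then have "Poly_Mapping.lookup (f * g) (?a + ?b) = (\<Sum>\<alpha>\<in>Poly_Mapping.keys f. \<Sum>\<beta>\<in>Poly_Mapping.keys g.
      Poly_Mapping.lookup (?s f \<alpha> * ?s g \<beta>) (?a + ?b))"
    by (simp add: lookup_sum)
  also have "\<dots> = (\<Sum>\<alpha>\<in>Poly_Mapping.keys f. \<Sum>\<beta>\<in>Poly_Mapping.keys g.
      if \<beta> = ?b then if \<alpha> = ?a then Poly_Mapping.lookup f ?a * Poly_Mapping.lookup g ?b else 0 else 0)"
  proof (intro sum.cong refl)
    fix \<alpha> \<beta> assume "\<alpha> \<in> Poly_Mapping.keys f" "\<beta> \<in> Poly_Mapping.keys g"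
    then have le: "\<alpha> \<le> ?a" "\<beta> \<le> ?b" by (auto intro: lead_monom_ge)
    have "\<alpha> + \<beta> = ?a + ?b \<longleftrightarrow> \<alpha> = ?a \<and> \<beta> = ?b"
    proof
      assume eq: "\<alpha> + \<beta> = ?a + ?b"
      have "\<not> \<alpha> < ?a" using add_less_le_mono[OF _ le(2), of \<alpha> ?a] eq by auto
      then have "\<alpha> = ?a" using le by auto
      then show "\<alpha> = ?a \<and> \<beta> = ?b" using eq by simp
    qed auto
    then show "Poly_Mapping.lookup (?s f \<alpha> * ?s g \<beta>) (?a + ?b) =
      (if \<beta> = ?b then if \<alpha> = ?a then Poly_Mapping.lookup f ?a * Poly_Mapping.lookup g ?b else 0 else 0)"
      by (auto simp: mult_single lookup_single when_def)
  qed
  also have "\<dots> = Poly_Mapping.lookup f ?a * Poly_Mapping.lookup g ?b"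
    using False lead_monom_in_keys[of f] lead_monom_in_keys[of g] by (simp add: sum.delta)
  finally show ?thesis .
qed auto

lemma lead_monom_mult:
  fixes f g :: "'a::idom mpoly"
  assumes "f \<noteq> 0" "g \<noteq> 0"
  shows "lead_monom (f * g) = lead_monom f + lead_monom g"
  unfolding lead_monom_def[of "f * g"]
proof (rule Max_eqI)
  fix \<gamma> assume "\<gamma> \<in> Poly_Mapping.keys (f * g)"
  then obtain \<alpha> \<beta> where "\<gamma> = \<alpha> + \<beta>" "\<alpha> \<in> Poly_Mapping.keys f" "\<beta> \<in> Poly_Mapping.keys g"
    using keys_mult[of f g] by blast
  then show "\<gamma> \<le> lead_monom f + lead_monom g" by (auto intro: add_mono lead_monom_ge)
next
  show "lead_monom f + lead_monom g \<in> Poly_Mapping.keys (f * g)"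
    using lead_monom_in_keys[OF assms(1)] lead_monom_in_keys[OF assms(2)]
    by (simp add: in_keys_iff lookup_mult_lead)
qed simp

lemma lookup_lead_monom_power:
  fixes f :: "'a::idom mpoly"
  assumes "f \<noteq> 0"
  shows "Poly_Mapping.lookup (lead_monom (f ^ k)) i = k * Poly_Mapping.lookup (lead_monom f) i"
proof (induction k)
  case 0
  show ?case by (simp add: lead_monom_def)
next
  case (Suc k)
  then show ?case using assms by (simp add: lead_monom_mult lookup_add)
qed

text \<open>With infinitely many variables the order is not well-founded: the exponents of
  \<open>Var 0\<close>, \<open>Var 1\<close>, \<open>Var 2\<close> and so on decrease. Bounding the
  variables by \<open>n\<close> turns it into the lexicographic order on lists of length
  \<open>n\<close>.\<close>

lemma wf_monomials: "wf {(\<alpha>, \<beta> :: nat \<Rightarrow>\<^sub>0 nat). \<alpha> < \<beta> \<and> Poly_Mapping.keys \<alpha> \<subseteq> {..<n} \<and> Poly_Mapping.keys \<beta> \<subseteq> {..<n}}"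
proof (rule wf_subset)
  let ?l = "\<lambda>\<alpha>. map (Poly_Mapping.lookup \<alpha>) [0..<n]"
  show "wf (inv_image (lex less_than) ?l)" by (intro wf_inv_image wf_lex) auto
  show "{(\<alpha>, \<beta>). \<alpha> < \<beta> \<and> Poly_Mapping.keys \<alpha> \<subseteq> {..<n} \<and> Poly_Mapping.keys \<beta> \<subseteq> {..<n}} \<subseteq> inv_image (lex less_than) ?l"
  proof clarify
    fix \<alpha> \<beta> :: "nat \<Rightarrow>\<^sub>0 nat"
    assume lt: "\<alpha> < \<beta>" and k: "Poly_Mapping.keys \<alpha> \<subseteq> {..<n}" "Poly_Mapping.keys \<beta> \<subseteq> {..<n}"
    obtain i where i: "Poly_Mapping.lookup \<alpha> i < Poly_Mapping.lookup \<beta> i"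
      "\<And>j. j < i \<Longrightarrow> Poly_Mapping.lookup \<alpha> j = Poly_Mapping.lookup \<beta> j"
      using lt unfolding less_poly_mapping.rep_eq less_fun_def by auto
    have "i \<in> Poly_Mapping.keys \<beta>" using i(1) by (simp add: in_keys_iff)
    then have "i < n" using k by auto
    then have "(?l \<alpha>, ?l \<beta>) \<in> lexord less_than"
      unfolding lexord_take_index_conv using i
      by (intro disjI2 exI[of _ i]) (auto simp: take_map)
    then show "(\<alpha>, \<beta>) \<in> inv_image (lex less_than) ?l" by (simp add: lexord_lex)
  qed
qed

text \<open>This is complete integral closedness, shown by division instead of factorization. All
  powers of \<open>a / b\<close> have the common denominator \<open>d\<close>; comparing leading
  monomials in \<open>d * a ^ k = c * b ^ k\<close> for large \<open>k\<close> shows that the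
  leading monomial of \<open>b\<close> divides that of \<open>a\<close>. After one division step the
  remainder over \<open>b\<close> is again in \<open>M\<close>, with a smaller leading
  monomial.\<close>

lemma polys_almost_integral:
  fixes b :: "'a::field mpoly"
  assumes b: "b \<in> polys n" "b \<noteq> 0"
    and M: "is_subring M" "to_fract ` polys n \<subseteq> M"
    and d: "d \<noteq> 0" "\<And>z. z \<in> M \<Longrightarrow> to_fract d * z \<in> range to_fract"
  shows "a \<in> polys n \<Longrightarrow> to_fract a / to_fract b \<in> M \<Longrightarrow> \<exists>c\<in>polys n. a = c * b"
proof (induction "lead_monom a" arbitrary: a rule: wf_induct_rule[OF wf_monomials[of n]])
  case (1 a)
  interpret tf: comm_ring_hom "to_fract :: 'a mpoly \<Rightarrow> _" by (rule comm_ring_hom_to_fract)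
  show ?case
  proof (cases "a = 0")
    case True
    then show ?thesis using is_subring_0[OF is_subring_polys] by auto
  next
    case False
    have tf0: "to_fract b \<noteq> 0" using b by simp
    have le: "Poly_Mapping.lookup (lead_monom b) i \<le> Poly_Mapping.lookup (lead_monom a) i" for i
    proof (rule ccontr)
      assume nle: "\<not> ?thesis"
      \<comment> \<open>One more than the exponent in \<open>d\<close>: a deficit of at least one in
        each factor of \<open>a ^ k\<close> cannot be made up by \<open>d\<close>.\<close>
      define k where "k = Suc (Poly_Mapping.lookup (lead_monom d) i)"
      have "to_fract d * (to_fract a / to_fract b) ^ k \<in> range to_fract"
        using 1(3) by (intro d is_subring_power[OF M(1)])
      then obtain c where c: "to_fract d * (to_fract a / to_fract b) ^ k = to_fract c" by auto
      then have "to_fract d * to_fract a ^ k = to_fract c * to_fract b ^ k"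
        using tf0 by (simp add: power_divide field_simps)
      then have "to_fract (d * a ^ k) = to_fract (c * b ^ k)"
        by (simp only: tf.hom_mult tf.hom_power)
      then have eq: "d * a ^ k = c * b ^ k" by (simp only: to_fract_eq_iff)
      then have "c \<noteq> 0" using d(1) False by auto
      have "lead_monom d + lead_monom (a ^ k) = lead_monom c + lead_monom (b ^ k)"
        using arg_cong[OF eq, of lead_monom] d(1) False \<open>c \<noteq> 0\<close> b(2) by (simp add: lead_monom_mult)
      then have "Poly_Mapping.lookup (lead_monom d) i + k * Poly_Mapping.lookup (lead_monom a) i =
          Poly_Mapping.lookup (lead_monom c) i + k * Poly_Mapping.lookup (lead_monom b) i"
        using lookup_lead_monom_power[OF False, of k i] lookup_lead_monom_power[OF b(2), of k i]
        by (metis lookup_add)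
      moreover have "k * Poly_Mapping.lookup (lead_monom a) i + k \<le> k * Poly_Mapping.lookup (lead_monom b) i"
        using nle mult_le_mono2[of "Suc (Poly_Mapping.lookup (lead_monom a) i)" "Poly_Mapping.lookup (lead_monom b) i" k]
        by simp
      ultimately show False unfolding k_def by linarith
    qed
    define \<gamma> where "\<gamma> = lead_monom a - lead_monom b"
    have \<gamma>: "\<gamma> + lead_monom b = lead_monom a"
      using le by (intro poly_mapping_eqI) (simp add: \<gamma>_def lookup_add lookup_minus)
    define s where "s = Poly_Mapping.single \<gamma> (Poly_Mapping.lookup a (lead_monom a) / Poly_Mapping.lookup b (lead_monom b))"
    have lca: "Poly_Mapping.lookup a (lead_monom a) \<noteq> 0" and lcb: "Poly_Mapping.lookup b (lead_monom b) \<noteq> 0"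
      using lead_monom_in_keys[OF False] lead_monom_in_keys[OF b(2)] by (simp_all add: in_keys_iff)
    have ka: "Poly_Mapping.keys (lead_monom a) \<subseteq> {..<n}"
      using 1(2) lead_monom_in_keys[OF False] unfolding polys_def by blast
    have "Poly_Mapping.keys \<gamma> \<subseteq> Poly_Mapping.keys (lead_monom a)"
      by (auto simp: \<gamma>_def in_keys_iff lookup_minus)
    then have "Poly_Mapping.keys \<gamma> \<subseteq> {..<n}" using ka by simp
    then have sP: "s \<in> polys n" by (auto simp: s_def polys_def)
    have "Poly_Mapping.lookup s \<gamma> = Poly_Mapping.lookup a (lead_monom a) / Poly_Mapping.lookup b (lead_monom b)"
      by (simp add: s_def)
    moreover from this have s0: "s \<noteq> 0" using lca lcb by auto
    moreover from s0 have "Poly_Mapping.keys s = {\<gamma>}" unfolding s_def by (metis keys_single single_zero)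
    ultimately have ls: "lead_monom s = \<gamma>"
      "Poly_Mapping.lookup s \<gamma> * Poly_Mapping.lookup b (lead_monom b) = Poly_Mapping.lookup a (lead_monom a)"
      using lcb by (simp_all add: lead_monom_def)
    define a' where "a' = a - s * b"
    have a'P: "a' \<in> polys n"
      unfolding a'_def by (intro is_subring_diff[OF is_subring_polys] is_subring_mult[OF is_subring_polys] sP b 1)
    have "to_fract a' / to_fract b = to_fract a / to_fract b - to_fract s"
      using tf0 by (simp add: a'_def to_fract_diff to_fract_mult diff_divide_distrib)
    also have "\<dots> \<in> M" using 1(3) M sP by (intro is_subring_diff[OF M(1)]) auto
    finally have a'M: "to_fract a' / to_fract b \<in> M" .
    have "\<exists>c\<in>polys n. a' = c * b"
    proof (cases "a' = 0")
      case True
      then show ?thesis using is_subring_0[OF is_subring_polys] by auto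
    next
      case a'0: False
      have lsb: "lead_monom (s * b) = lead_monom a" using s0 b(2) ls \<gamma> by (simp add: lead_monom_mult)
      have "Poly_Mapping.lookup (s * b) (lead_monom a) = Poly_Mapping.lookup a (lead_monom a)"
        using lookup_mult_lead[of s b] ls \<gamma> by simp
      then have "lead_monom a \<notin> Poly_Mapping.keys a'" by (simp add: a'_def in_keys_iff lookup_minus)
      moreover have "lead_monom a' \<in> Poly_Mapping.keys a'" by (rule lead_monom_in_keys[OF a'0])
      moreover have "lead_monom a' \<le> lead_monom a"
      proof -
        have "lead_monom a' \<in> Poly_Mapping.keys a \<or> lead_monom a' \<in> Poly_Mapping.keys (s * b)"
          using lead_monom_in_keys[OF a'0] by (auto simp: a'_def in_keys_iff lookup_minus)
        then show ?thesis using lead_monom_ge lsb by metis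
      qed
      ultimately have "lead_monom a' < lead_monom a" by (metis le_neq_trans)
      moreover have "Poly_Mapping.keys (lead_monom a') \<subseteq> {..<n}"
        using a'P lead_monom_in_keys[OF a'0] unfolding polys_def by blast
      ultimately show ?thesis using ka by (intro 1(1) a'P a'M) auto
    qed
    then obtain c where c: "c \<in> polys n" "a' = c * b" by auto
    then have "a = (c + s) * b" by (simp add: a'_def algebra_simps)
    then show ?thesis using is_subring_add[OF is_subring_polys c(1) sP] by blast
  qed
qed

text \<open>The powers of \<open>a / b\<close> below the degree of \<open>P\<close> generate a
  module that is stable under \<open>a / b\<close>, and \<open>b ^ degree P\<close> clears all their
  denominators.\<close>

lemma polys_integrally_closed:
  fixes a b :: "'a::field mpoly"
  assumes ab: "a \<in> polys n" "b \<in> polys n" "b \<noteq> 0"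
    and P: "P \<in> polys_over (to_fract ` polys n)" "lead_coeff P = 1" "poly P (to_fract a / to_fract b) = 0"
  shows "\<exists>c\<in>polys n. a = c * b"
proof -
  let ?C = "to_fract ` polys n" and ?z = "to_fract a / to_fract b"
  interpret tf: comm_ring_hom "to_fract :: 'a mpoly \<Rightarrow> _" by (rule comm_ring_hom_to_fract)
  have C: "is_subring ?C"
    by (rule is_subring_hom_image[OF comm_ring_hom_to_fract is_subring_polys])
  have "P \<in> polys_over (multipliers ?C {1})"
    using polys_over_mono[OF subset_multipliers[OF C] P(1)] .
  from multipliers_extend[OF C _ this P(2,3)] obtain B where B: "finite B" "1 \<in> B"
    "?C \<subseteq> multipliers ?C B" "?z \<in> multipliers ?C B" "\<forall>b'\<in>B. \<exists>k<degree P. b' = ?z ^ k"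
    using subset_multipliers[OF C] by auto
  show ?thesis
  proof (rule polys_almost_integral[OF ab(2,3) is_subring_multipliers[OF C, of B] B(3), of "b ^ degree P"])
    show "b ^ degree P \<noteq> 0" using ab by simp
    fix z assume "z \<in> multipliers ?C B"
    then have "1 * z \<in> lspan ?C B" using B(2) unfolding multipliers_def by blast
    then have "z \<in> lspan ?C B" by simp
    then show "to_fract (b ^ degree P) * z \<in> range to_fract"
    proof induction
      case zero
      then show ?case by (auto intro: image_eqI[of _ _ 0])
    next
      case (step c b' v)
      then obtain k where k: "k < degree P" "b' = ?z ^ k" using B(5) by auto
      obtain c' v' where cv: "c = to_fract c'" "to_fract (b ^ degree P) * v = to_fract v'" using step by auto
      have "to_fract (b ^ degree P) * b' = to_fract (a ^ k * b ^ (degree P - k))"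
      proof -
        have "b ^ degree P = b ^ k * b ^ (degree P - k)" using k by (simp flip: power_add)
        then show ?thesis using ab(3) by (simp add: k(2) power_divide tf.hom_mult tf.hom_power)
      qed
      then have "to_fract (b ^ degree P) * (c * b' + v) = to_fract (c' * (a ^ k * b ^ (degree P - k)) + v')"
        using cv by (simp add: tf.hom_add tf.hom_mult distrib_left mult.left_commute)
      then show ?case by blast
    qed
  qed (use ab B in auto)
qed

section \<open>Linear substitutions and Steenrod operations\<close>

definition linear_form :: "nat \<Rightarrow> (nat \<Rightarrow> 'a::comm_ring_1) \<Rightarrow> 'a mpoly" where
  "linear_form n a = (\<Sum>j<n. Const (a j) * Var j)"

text \<open>Substitution by any square matrix, also a singular one, since the conjugates of
  \<open>w\<close> come from all matrices. For invertible \<open>N\<close>, the operator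
  \<open>act N\<close> is \<open>lsub\<close> with the inverse of \<open>N\<close>.\<close>

definition lsub :: "nat \<Rightarrow> (nat \<Rightarrow> nat \<Rightarrow> 'a::comm_ring_1) \<Rightarrow> 'a mpoly \<Rightarrow> 'a mpoly" where
  "lsub n g = subst_hom Const (\<lambda>i. if i < n then linear_form n (g i) else Var i)"

interpretation Const: comm_ring_hom "Const :: 'a::comm_ring_1 \<Rightarrow> 'a mpoly"
  by (rule comm_ring_hom_Const)

interpretation lsub: comm_ring_hom "lsub n g :: 'a::comm_ring_1 mpoly \<Rightarrow> _" for n g
  unfolding lsub_def by (rule Const.comm_ring_hom_subst_hom)

lemma lsub_Const [simp]: "lsub n g (Const c) = Const c"
  by (simp add: lsub_def Const.subst_hom_Const)

lemma lsub_Var: "lsub n g (Var i) = (if i < n then linear_form n (g i) else Var i)"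
  by (simp add: lsub_def Const.subst_hom_Var)

lemma linear_form_in_polys: "linear_form n a \<in> polys n"
  unfolding linear_form_def
  by (intro is_subring_sum is_subring_mult is_subring_polys Const_in_polys Var_in_polys) auto

lemma lsub_linear_form:
  "lsub n h (linear_form n a) = linear_form n (\<lambda>k. \<Sum>j<n. a j * h j k)"
proof -
  have "lsub n h (linear_form n a) = (\<Sum>j<n. \<Sum>k<n. Const (a j * h j k) * Var k)"
    by (simp add: linear_form_def lsub.hom_sum lsub.hom_mult lsub_Var sum_distrib_left Const.hom_mult mult.assoc)
  also have "\<dots> = (\<Sum>k<n. \<Sum>j<n. Const (a j * h j k) * Var k)" by (rule sum.swap)
  finally show ?thesis by (simp add: linear_form_def Const.hom_sum sum_distrib_right)
qed

lemma lsub_lsub: "lsub n h (lsub n g f) = lsub n (\<lambda>i k. \<Sum>j<n. g i j * h j k) f"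
  by (rule hom_eq[of "\<lambda>f. lsub n h (lsub n g f)"])
    (auto simp: lsub_Var lsub_linear_form intro: comm_ring_hom_comp lsub.comm_ring_hom_axioms)

lemma linear_form_unit: "i < n \<Longrightarrow> linear_form n (\<lambda>j. if i = j then 1 else 0) = Var i"
  by (simp add: linear_form_def if_distrib[of Const] if_distrib[of "\<lambda>x. x * _"] cong: if_cong)

lemma linear_form_cong: "(\<And>j. j < n \<Longrightarrow> a j = b j) \<Longrightarrow> linear_form n a = linear_form n b"
  by (simp add: linear_form_def)

lemma lsub_cong:
  assumes "\<And>i j. i < n \<Longrightarrow> j < n \<Longrightarrow> g i j = h i j"
  shows "lsub n g f = lsub n h f"
proof -
  have "(\<lambda>i. if i < n then linear_form n (g i) else Var i) = (\<lambda>i. if i < n then linear_form n (h i) else Var i)"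
    by (rule ext, simp, intro impI linear_form_cong assms)
  then show ?thesis by (simp add: lsub_def)
qed

lemma lsub_id: "lsub n (\<lambda>i j. if i = j then 1 else 0) f = f"
  by (rule hom_eq[of _ "\<lambda>f. f"])
    (auto simp: lsub_Var linear_form_unit intro: lsub.comm_ring_hom_axioms, unfold_locales, auto)

lemma linear_form_independent:
  assumes "linear_form n a = linear_form n b" "j < n"
  shows "a j = b j"
proof -
  have "linear_form n a - linear_form n b = (\<Sum>j<n. Const (a j - b j) * Var j)"
    by (simp add: linear_form_def Const.hom_minus left_diff_distrib sum_subtractf)
  then have "(\<Sum>j\<in>{..<n}. Const (a j - b j) * Poly_Mapping.single (Poly_Mapping.single j 1) 1) = 0"
    using assms by (simp add: Var_def)
  moreover have "inj_on (\<lambda>j. Poly_Mapping.single j (1::nat)) {..<n}"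
    by (rule inj_onI) (metis keys_single one_neq_zero singleton_inject)
  ultimately have "a j - b j = 0"
    using assms(2) single_independent[of "{..<n}" "\<lambda>j. Poly_Mapping.single j 1" "\<lambda>j. a j - b j" j] by auto
  then show ?thesis by simp
qed

section \<open>Steenrod operations and their behaviour under linear substitution\<close>

lemma of_nat_mpoly_eq_0:
  assumes "of_nat p = (0::'a::comm_ring_1)"
  shows "of_nat p = (0::'a mpoly)"
proof -
  have "Const (of_nat p :: 'a) = of_nat p" by (rule Const.hom_of_nat)
  then show ?thesis using assms by simp
qed

lemma of_nat_fps_eq_0:
  assumes "of_nat p = (0::'b::comm_ring_1)"
  shows "of_nat p = (0::'b fps)"
  using assms by (simp flip: fps_of_nat)

definition steenrod_coeff :: "'a::{field,finite} \<Rightarrow> 'a mpoly fps" where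
  "steenrod_coeff c = fps_const (Const c)"

interpretation steenrod_coeff: comm_ring_hom "steenrod_coeff :: 'a::{field,finite} \<Rightarrow> _"
  by unfold_locales (auto simp: steenrod_coeff_def Const.hom_add Const.hom_mult)

lemma steenrod_hom_alt:
  "(steenrod_hom :: 'a::{field,finite} mpoly \<Rightarrow> _) = subst_hom steenrod_coeff
     (\<lambda>j. fps_const (Var j) + fps_const (Var j ^ CARD('a)) * fps_X)"
  by (simp add: steenrod_hom_def steenrod_coeff_def[abs_def])

interpretation steenrod_hom: comm_ring_hom "steenrod_hom :: 'a::{field,finite} mpoly \<Rightarrow> _"
  unfolding steenrod_hom_alt by (rule steenrod_coeff.comm_ring_hom_subst_hom)

lemma steenrod_hom_Const: "steenrod_hom (Const c) = fps_const (Const c)"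
  by (simp add: steenrod_hom_alt steenrod_coeff.subst_hom_Const steenrod_coeff_def)

lemma steenrod_hom_Var:
  "steenrod_hom (Var j :: 'a::{field,finite} mpoly) = fps_const (Var j) + fps_const (Var j ^ CARD('a)) * fps_X"
  by (simp add: steenrod_hom_alt steenrod_coeff.subst_hom_Var)

lemma steenrod_op_add: "steenrod_op i (f + g) = steenrod_op i f + steenrod_op i g"
  by (simp add: steenrod_op_def steenrod_hom.hom_add)

lemma steenrod_op_sum: "steenrod_op i (sum f I) = (\<Sum>k\<in>I. steenrod_op i (f k))"
  by (simp add: steenrod_op_def steenrod_hom.hom_sum fps_sum_nth)

lemma steenrod_op_scale: "steenrod_op i (Const c * f) = Const c * steenrod_op i f"
  by (simp add: steenrod_op_def steenrod_hom.hom_mult steenrod_hom_Const)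

definition lsub_fps :: "nat \<Rightarrow> (nat \<Rightarrow> nat \<Rightarrow> 'a::comm_ring_1) \<Rightarrow> 'a mpoly fps \<Rightarrow> 'a mpoly fps" where
  "lsub_fps n g F = Abs_fps (\<lambda>i. lsub n g (fps_nth F i))"

interpretation lsub_fps: comm_ring_hom "lsub_fps n g :: 'a::comm_ring_1 mpoly fps \<Rightarrow> _" for n g
  by unfold_locales
    (auto simp: lsub_fps_def fps_eq_iff fps_mult_nth lsub.hom_add lsub.hom_sum lsub.hom_mult)

lemma linear_form_power_card:
  fixes a :: "nat \<Rightarrow> 'a::{field,finite}"
  assumes p: "prime p" "of_nat p = (0::'a)" "\<exists>e. CARD('a) = p ^ e"
  shows "linear_form n a ^ CARD('a) = (\<Sum>j<n. Const (a j) * Var j ^ CARD('a))"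
proof -
  obtain e where e: "CARD('a) = p ^ e" using p(3) by auto
  have "Const (a j) ^ p ^ e = Const (a j)" for j
    using finite_field_power_card[of "a j"] by (simp add: e flip: Const.hom_power)
  then show ?thesis
    unfolding e linear_form_def frobenius_sum[OF p(1) of_nat_mpoly_eq_0[OF p(2)]]
    by (simp add: power_mult_distrib)
qed

text \<open>Both sides are homomorphisms, so variables suffice. There it comes down to the power
  \<open>CARD('a)\<close> of a linear form being taken variable by variable, because its
  coefficients are fixed by that power.\<close>

lemma steenrod_hom_lsub:
  fixes f :: "'a::{field,finite} mpoly"
  assumes p: "prime p" "of_nat p = (0::'a)" "\<exists>e. CARD('a) = p ^ e"
  shows "steenrod_hom (lsub n g f) = lsub_fps n g (steenrod_hom f)"
proof (rule hom_eq[of "\<lambda>f. steenrod_hom (lsub n g f)" "\<lambda>f. lsub_fps n g (steenrod_hom f)"])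
  show "comm_ring_hom (\<lambda>f. steenrod_hom (lsub n g f) :: 'a mpoly fps)"
    by (rule comm_ring_hom_comp[OF steenrod_hom.comm_ring_hom_axioms lsub.comm_ring_hom_axioms])
  show "comm_ring_hom (\<lambda>f. lsub_fps n g (steenrod_hom f) :: 'a mpoly fps)"
    by (rule comm_ring_hom_comp[OF lsub_fps.comm_ring_hom_axioms steenrod_hom.comm_ring_hom_axioms])
  have fc: "lsub_fps n g (fps_const u) = fps_const (lsub n g u)" for u :: "'a mpoly"
    by (simp add: lsub_fps_def fps_eq_iff)
  have fX: "lsub_fps n g fps_X = (fps_X :: 'a mpoly fps)"
    by (simp add: lsub_fps_def fps_eq_iff fps_X_def)
  show "steenrod_hom (lsub n g (Const c)) = lsub_fps n g (steenrod_hom (Const c))" for c :: 'a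
    by (simp add: steenrod_hom_Const fc)
  fix i
  show "steenrod_hom (lsub n g (Var i)) = lsub_fps n g (steenrod_hom (Var i :: 'a mpoly))"
  proof (cases "i < n")
    case True
    have sum_const: "(\<Sum>j<n. fps_const (u j)) = fps_const (\<Sum>j<n. u j)" for u :: "nat \<Rightarrow> 'a mpoly"
      by (simp add: fps_eq_iff fps_sum_nth)
    have "steenrod_hom (linear_form n (g i)) =
        (\<Sum>j<n. fps_const (Const (g i j) * Var j)) + (\<Sum>j<n. fps_const (Const (g i j) * Var j ^ CARD('a)) * fps_X)"
      by (simp add: linear_form_def steenrod_hom.hom_sum steenrod_hom.hom_mult steenrod_hom_Const
          steenrod_hom_Var distrib_left sum.distrib mult.assoc[symmetric])
    also have "\<dots> = fps_const (linear_form n (g i)) + fps_const (linear_form n (g i) ^ CARD('a)) * fps_X"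
      unfolding linear_form_power_card[OF p] by (simp add: linear_form_def sum_const flip: sum_distrib_right)
    finally show ?thesis
      using True by (simp add: lsub_Var steenrod_hom_Var lsub_fps.hom_add lsub_fps.hom_mult fc fX lsub.hom_power)
  qed (simp add: lsub_Var steenrod_hom_Var lsub_fps.hom_add lsub_fps.hom_mult fc fX lsub.hom_power)
qed

lemma steenrod_algebra_lsub:
  fixes f :: "'a::{field,finite} mpoly"
  assumes p: "prime p" "of_nat p = (0::'a)" "\<exists>e. CARD('a) = p ^ e"
    and "\<theta> \<in> steenrod_algebra"
  shows "\<theta> (lsub n g f) = lsub n g (\<theta> f)"
  using assms(4)
proof (induction arbitrary: f)
  case (op i)
  show ?case by (simp add: steenrod_op_def steenrod_hom_lsub[OF p] lsub_fps_def)
qed (simp_all add: lsub.hom_add lsub.hom_mult)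

lemma steenrod_op_polys:
  fixes f :: "'a::{field,finite} mpoly"
  assumes "f \<in> polys n"
  shows "steenrod_op i f \<in> polys n"
proof -
  have "\<forall>i. fps_nth (steenrod_hom f) i \<in> polys n"
    using assms
  proof (induction rule: polys_induct)
    case (Const c)
    then show ?case by (simp add: steenrod_hom_Const Const_in_polys is_subring_0[OF is_subring_polys])
  next
    case (Var i)
    note V = Var_in_polys[OF Var, where ?'a='a]
    show ?case
      using is_subring_0[OF is_subring_polys, of n, where ?'a1='a] is_subring_power[OF is_subring_polys V]
      by (auto simp: steenrod_hom_Var fps_X_def V)
  next
    case (add f g)
    then show ?case by (simp add: steenrod_hom.hom_add is_subring_add[OF is_subring_polys])
  next
    case (mult f g)
    then show ?case
      by (auto simp: steenrod_hom.hom_mult fps_mult_nth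
          intro!: is_subring_sum[OF is_subring_polys] is_subring_mult[OF is_subring_polys])
  qed
  then show ?thesis by (simp add: steenrod_op_def)
qed

lemma steenrod_algebra_polys:
  fixes f :: "'a::{field,finite} mpoly"
  assumes "\<theta> \<in> steenrod_algebra" "f \<in> polys n"
  shows "\<theta> f \<in> polys n"
  using assms
  by (induction arbitrary: f)
    (auto simp: steenrod_op_polys intro: is_subring_add is_subring_mult is_subring_polys Const_in_polys)

text \<open>With \<open>Z\<close> the series variable and \<open>r = CARD('a)\<close>, the total
  operation gives \<open>(x_i + x_i ^ r * Z) * (x_j ^ s + x_j ^ (s * r) * Z ^ s)\<close>. The
  exponents of \<open>Z\<close> are \<open>0\<close>, \<open>1\<close>, \<open>s\<close> and
  \<open>s + 1\<close>, and \<open>s \<ge> 2\<close> keeps \<open>s\<close> apart from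
  \<open>1\<close>.\<close>

lemma steenrod_op_frobenius:
  assumes p: "prime p" "of_nat p = (0::'a::{field,finite})" and s: "s = p ^ k" "s \<ge> 2"
  shows "steenrod_op s (Var i * Var j ^ s :: 'a mpoly) = Var i * Var j ^ (s * CARD('a))"
proof -
  let ?c = "fps_const :: 'a mpoly \<Rightarrow> _"
  note fr = frobenius_add[OF p(1) of_nat_fps_eq_0[OF of_nat_mpoly_eq_0[OF p(2)]]]
  have "steenrod_hom (Var i * Var j ^ s) =
      (?c (Var i) + ?c (Var i ^ CARD('a)) * fps_X) * (?c (Var j) + ?c (Var j ^ CARD('a)) * fps_X) ^ s"
    by (simp add: steenrod_hom.hom_mult steenrod_hom.hom_power steenrod_hom_Var)
  also have "(?c (Var j) + ?c (Var j ^ CARD('a)) * fps_X) ^ s =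
      ?c (Var j ^ s) + ?c (Var j ^ (s * CARD('a))) * fps_X ^ s"
    unfolding s(1) fr by (simp add: power_mult_distrib power_mult mult.commute[of _ "CARD('a)"])
  finally have "steenrod_hom (Var i * Var j ^ s) = ?c (Var i * Var j ^ s) + ?c (Var i ^ CARD('a) * Var j ^ s) * fps_X
      + ?c (Var i * Var j ^ (s * CARD('a))) * fps_X ^ s
      + ?c (Var i ^ CARD('a) * Var j ^ (s * CARD('a))) * fps_X ^ Suc s"
    by (simp add: algebra_simps flip: fps_const_mult)
  then show ?thesis using s(2) by (simp add: steenrod_op_def fps_X_power_iff del: power_Suc)
qed

text \<open>The source of the Gram matrix in the orthogonal cases: the first Steenrod operation
  turns a quadratic form into its polar form with the second argument raised to the power
  \<open>CARD('a)\<close>.\<close>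

lemma steenrod_op_1_quadratic:
  "steenrod_op 1 (Var i * Var j :: 'a::{field,finite} mpoly) =
    Var i * Var j ^ CARD('a) + Var j * Var i ^ CARD('a)"
  by (simp add: steenrod_op_def steenrod_hom.hom_mult steenrod_hom_Var fps_mult_nth fps_X_def)

section \<open>Unitriangular groups and orbit products\<close>

definition entries :: "'a mat \<Rightarrow> nat \<Rightarrow> nat \<Rightarrow> 'a" where
  "entries M i j = M $$ (i, j)"

lemma entries_mult:
  "M \<in> carrier_mat n n \<Longrightarrow> N \<in> carrier_mat n n \<Longrightarrow> i < n \<Longrightarrow> j < n \<Longrightarrow>
    entries (M * N) i j = (\<Sum>k<n. entries M i k * entries N k j)"
  by (simp add: entries_def scalar_prod_def lessThan_atLeast0)

lemma unitri_carrier: "M \<in> unitri n \<Longrightarrow> M \<in> carrier_mat n n"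
  by (simp add: unitri_def)

lemma unitri_diag: "M \<in> unitri n \<Longrightarrow> i < n \<Longrightarrow> entries M i i = 1"
  and unitri_upper: "M \<in> unitri n \<Longrightarrow> i < j \<Longrightarrow> j < n \<Longrightarrow> entries M i j = 0"
  by (auto simp: unitri_def entries_def)

lemma unitri_one: "1\<^sub>m n \<in> unitri n"
  by (auto simp: unitri_def)

lemma unitri_mult:
  assumes M: "M \<in> unitri n" and N: "N \<in> unitri n"
  shows "M * N \<in> unitri n"
proof -
  note c = unitri_carrier[OF M] unitri_carrier[OF N]
  have "entries (M * N) i i = 1" if i: "i < n" for i
  proof -
    have "entries (M * N) i i = (\<Sum>k<n. if k = i then 1 else 0)"
      unfolding entries_mult[OF c i i]
      using i unitri_diag[OF M] unitri_diag[OF N] unitri_upper[OF M] unitri_upper[OF N]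
      by (intro sum.cong refl) (metis lessThan_iff linorder_neqE_nat mult_1 mult_zero_left mult_zero_right)
    then show ?thesis using i by simp
  qed
  moreover have "entries (M * N) i j = 0" if "i < j" "j < n" for i j
  proof -
    have "entries M i k * entries N k j = 0" if "k < n" for k
      using unitri_upper[OF M, of i k] unitri_upper[OF N, of k j] that \<open>i < j\<close> \<open>j < n\<close>
      by (cases "i < k") auto
    then show ?thesis using entries_mult[OF c, of i j] that by (simp add: sum.neutral)
  qed
  ultimately show ?thesis using c by (simp add: unitri_def entries_def)
qed

lemma unitri_inverse:
  fixes M :: "'a::field mat"
  assumes "M \<in> unitri n"
  obtains B where "B \<in> carrier_mat n n" "B * M = 1\<^sub>m n" "M * B = 1\<^sub>m n"
proof -
  note M = unitri_carrier[OF assms]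
  have "det M = prod_list (diag_mat M)"
    using assms by (intro det_lower_triangular[OF _ M]) (auto simp: unitri_def)
  also have "\<dots> = 1"
    using assms by (intro prod_list_neutral) (auto simp: diag_mat_def unitri_def)
  finally have "det M = 1" .
  then show ?thesis using adj_mat[OF M] by (intro that[of "adj_mat M"]) auto
qed

lemma unitri_cancel:
  fixes M :: "'a::field mat"
  assumes M: "M \<in> unitri n" and XY: "X \<in> carrier_mat n n" "Y \<in> carrier_mat n n"
  shows "M * X = M * Y \<Longrightarrow> X = Y" and "X * M = Y * M \<Longrightarrow> X = Y"
proof -
  obtain B where B: "B \<in> carrier_mat n n" "B * M = 1\<^sub>m n" "M * B = 1\<^sub>m n"
    by (rule unitri_inverse[OF M])
  note Mc = unitri_carrier[OF M]
  show "X = Y" if "M * X = M * Y"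
  proof -
    have "X = B * (M * X)" using assoc_mult_mat[OF B(1) Mc XY(1)] B XY by simp
    also have "\<dots> = B * (M * Y)" using that by simp
    also have "\<dots> = Y" using assoc_mult_mat[OF B(1) Mc XY(2)] B XY by simp
    finally show ?thesis .
  qed
  show "X = Y" if "X * M = Y * M"
  proof -
    have "X = (X * M) * B" using assoc_mult_mat[OF XY(1) Mc B(1)] B XY by simp
    also have "\<dots> = (Y * M) * B" using that by simp
    also have "\<dots> = Y" using assoc_mult_mat[OF XY(2) Mc B(1)] B XY by simp
    finally show ?thesis .
  qed
qed

lemma unitri_card:
  "finite (unitri n :: 'a::{field,finite} mat set)"
  "\<exists>k. card (unitri n :: 'a mat set) = CARD('a) ^ k"
proof -
  define I where "I = {(i, j). j < i \<and> i < n}"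
  have fI: "finite I"
    by (rule finite_subset[of _ "{..<n} \<times> {..<n}"]) (auto simp: I_def)
  let ?f = "\<lambda>a :: nat \<times> nat \<Rightarrow> 'a. mat n n (\<lambda>(i, j). if i = j then 1 else if j < i then a (i, j) else 0)"
  have img: "unitri n = ?f ` (I \<rightarrow>\<^sub>E UNIV)"
  proof (intro equalityI subsetI)
    fix M :: "'a mat" assume M: "M \<in> unitri n"
    have "M = ?f (restrict (\<lambda>ij. M $$ ij) I)"
      using M by (intro eq_matI) (auto simp: unitri_def I_def)
    then show "M \<in> ?f ` (I \<rightarrow>\<^sub>E UNIV)" by (intro image_eqI[of _ ?f "restrict (\<lambda>ij. M $$ ij) I"]) auto
  qed (auto simp: unitri_def)
  have inj: "inj_on ?f (I \<rightarrow>\<^sub>E UNIV)"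
  proof (rule inj_onI)
    fix a b assume ab: "a \<in> I \<rightarrow>\<^sub>E (UNIV :: 'a set)" "b \<in> I \<rightarrow>\<^sub>E (UNIV :: 'a set)" and eq: "?f a = ?f b"
    show "a = b"
    proof (rule PiE_ext[OF ab])
      fix x assume "x \<in> I"
      then obtain i j where ij: "x = (i, j)" "j < i" "i < n" by (auto simp: I_def)
      then have "?f a $$ (i, j) = a x" "?f b $$ (i, j) = b x" by auto
      then show "a x = b x" using eq by simp
    qed
  qed
  show "finite (unitri n :: 'a mat set)" unfolding img by (intro finite_imageI finite_PiE fI) auto
  show "\<exists>k. card (unitri n :: 'a mat set) = CARD('a) ^ k"
    unfolding img card_image[OF inj] using fI by (auto simp: card_PiE)
qed

text \<open>Serves both as the orbit-stabilizer count and as Lagrange's theorem, on plain sets of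
  matrices.\<close>

lemma card_equal_fibres:
  assumes "finite A" "\<And>a. a \<in> A \<Longrightarrow> card {a' \<in> A. f a' = f a} = c"
  shows "card A = c * card (f ` A)"
proof -
  have "card A = (\<Sum>b\<in>f ` A. card {a \<in> A. f a = b})"
    using sum.image_gen[OF assms(1), of "\<lambda>_. 1 :: nat" f] by simp
  also have "\<dots> = (\<Sum>b\<in>f ` A. c)" using assms(2) by (intro sum.cong) auto
  finally show ?thesis by simp
qed

lemma act_eq_lsub:
  "N \<in> carrier_mat n n \<Longrightarrow> act N f = lsub n (entries (the (mat_inverse N))) f"
proof -
  assume "N \<in> carrier_mat n n"
  then have "dim_row N = n" by simp
  then show ?thesis by (simp add: act_def lsub_def linear_form_def entries_def cong: if_cong)
qed

section \<open>Fraction fields and polynomials in a primitive element\<close>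

lemma is_subfield_Quot:
  fixes R :: "'b::idom set"
  assumes R: "is_subring R"
  shows "is_subfield (Quot R)"
  unfolding is_subfield_def is_subring_def
proof (intro conjI ballI)
  interpret tf: comm_ring_hom "to_fract :: 'b \<Rightarrow> _" by (rule comm_ring_hom_to_fract)
  show "1 \<in> Quot R"
    unfolding Quot_def using is_subring_1[OF R] by (auto intro!: exI[of _ 1])
  fix x y assume "x \<in> Quot R" "y \<in> Quot R"
  then obtain a b c d where ab: "x = to_fract a / to_fract b" "a \<in> R" "b \<in> R" "b \<noteq> 0"
    and cd: "y = to_fract c / to_fract d" "c \<in> R" "d \<in> R" "d \<noteq> 0"
    unfolding Quot_def by blast
  have "x - y = to_fract (a * d - c * b) / to_fract (b * d)"
    using ab cd by (simp add: tf.hom_minus tf.hom_mult diff_frac_eq)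
  moreover have "x * y = to_fract (a * c) / to_fract (b * d)"
    using ab cd by (simp add: tf.hom_mult)
  moreover have "a * d - c * b \<in> R" "b * d \<in> R" "a * c \<in> R" "b * d \<noteq> 0"
    using ab cd R by (auto intro: is_subring_diff is_subring_mult)
  ultimately show "x - y \<in> Quot R" "x * y \<in> Quot R"
    unfolding Quot_def by blast+
next
  fix x assume "x \<in> Quot R"
  then obtain a b where ab: "x = to_fract a / to_fract b" "a \<in> R" "b \<in> R" "b \<noteq> 0"
    unfolding Quot_def by blast
  show "inverse x \<in> Quot R"
  proof (cases "a = 0")
    case True
    then have "inverse x = to_fract a / to_fract b" using ab by simp
    then show ?thesis unfolding Quot_def using ab by blast
  next
    case False
    then have "inverse x = to_fract b / to_fract a" using ab by simp
    then show ?thesis unfolding Quot_def using ab False by blast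
  qed
qed

lemma to_fract_in_Quot:
  fixes R :: "'a::idom set"
  assumes "is_subring R" "a \<in> R"
  shows "to_fract a \<in> Quot R"
proof -
  have "to_fract a = to_fract a / to_fract 1" by simp
  moreover have "(1 :: 'a) \<in> R" "(1 :: 'a) \<noteq> 0" using assms is_subring_1 by auto
  ultimately show ?thesis unfolding Quot_def using assms(2) by blast
qed

text \<open>If \<open>X j\<close> takes the value \<open>x_j\<close> at \<open>w\<close>, this
  writes \<open>f\<close> as a polynomial in \<open>w\<close>. At another point, where the
  \<open>X j\<close> take linear forms as values, the same polynomial gives a linear substitution of
  \<open>f\<close>.\<close>

definition poly_lift :: "(nat \<Rightarrow> 'a::field mpoly fract poly) \<Rightarrow> 'a mpoly \<Rightarrow> 'a mpoly fract poly" where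
  "poly_lift = subst_hom (\<lambda>c. [:to_fract (Const c):])"

interpretation poly_lift_coeff: comm_ring_hom "\<lambda>c :: 'a::field. [:to_fract (Const c):]"
  by unfold_locales (auto simp: Const.hom_add Const.hom_mult to_fract_add to_fract_mult one_pCons)

interpretation poly_lift: comm_ring_hom "poly_lift X :: 'a::field mpoly \<Rightarrow> _" for X
  unfolding poly_lift_def by (rule poly_lift_coeff.comm_ring_hom_subst_hom)

lemma poly_lift_Const: "poly_lift X (Const c) = [:to_fract (Const c):]"
  and poly_lift_Var: "poly_lift X (Var i) = X i"
  by (simp_all add: poly_lift_def poly_lift_coeff.subst_hom_Const poly_lift_coeff.subst_hom_Var)

lemma comm_ring_hom_poly_poly_lift: "comm_ring_hom (\<lambda>f. poly (poly_lift X f) w)"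
  by unfold_locales (auto simp: poly_lift.hom_add poly_lift.hom_mult)

lemma poly_lift_lsub:
  assumes "f \<in> polys n" "\<And>j. j < n \<Longrightarrow> poly (X j) w = to_fract (linear_form n (g j))"
  shows "poly (poly_lift X f) w = to_fract (lsub n g f)"
proof (rule hom_eq_on_polys[of "\<lambda>f. poly (poly_lift X f) w" "\<lambda>f. to_fract (lsub n g f)", OF _ _ assms(1)])
  show "comm_ring_hom (\<lambda>f. poly (poly_lift X f) w)" by (rule comm_ring_hom_poly_poly_lift)
  show "comm_ring_hom (\<lambda>f. to_fract (lsub n g f))"
    by (rule comm_ring_hom_comp[OF comm_ring_hom_to_fract lsub.comm_ring_hom_axioms])
qed (simp_all add: poly_lift_Const poly_lift_Var lsub_Var assms(2))

lemma poly_lift_eval: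
  assumes "f \<in> polys n" "\<And>j. j < n \<Longrightarrow> poly (X j) w = to_fract (Var j)"
  shows "poly (poly_lift X f) w = to_fract f"
proof (rule hom_eq_on_polys[of "\<lambda>f. poly (poly_lift X f) w" to_fract, OF _ _ assms(1)])
  show "comm_ring_hom (\<lambda>f. poly (poly_lift X f) w)" by (rule comm_ring_hom_poly_poly_lift)
qed (simp_all add: poly_lift_Const poly_lift_Var comm_ring_hom_to_fract assms(2))

lemma poly_lift_over:
  assumes "is_subring K" "\<And>c. to_fract (Const c) \<in> K" "f \<in> polys n" "\<And>j. j < n \<Longrightarrow> X j \<in> polys_over K"
  shows "poly_lift X f \<in> polys_over K"
  using assms(3)
  by (induction rule: polys_induct)
    (use assms in \<open>auto simp: poly_lift_Const poly_lift_Var poly_lift.hom_add poly_lift.hom_mult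
      intro: polys_over_const is_subring_add[OF is_subring_polys_over] is_subring_mult[OF is_subring_polys_over]\<close>)

lemma finite_subfield_mpoly:
  assumes "prime p" "\<exists>e. CARD('a::{field,finite}) = p ^ e"
  shows "finite_subfield (\<lambda>c :: 'a. to_fract (Const c)) p CARD('a)"
  by unfold_locales
    (use assms in \<open>auto simp: Const.hom_add Const.hom_mult to_fract_add to_fract_mult\<close>)

text \<open>What the six families have in common. The last assumption is the membership test that
  \<open>R\<close> can serve: orbit products only show that each row occurs in some element of
  \<open>G\<close>, and \<open>h\<close> has to force the rows to fit together.\<close>

locale classical_setup =
  fixes n p :: nat and G :: "'a::{field,finite} mat set" and h :: "'a mpoly"
  assumes p: "prime p" and card_power: "\<exists>e. CARD('a) = p ^ e"
    and G_unitri: "G \<subseteq> unitri n" and G_one: "1\<^sub>m n \<in> G"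
    and G_mult: "\<And>M N. M \<in> G \<Longrightarrow> N \<in> G \<Longrightarrow> M * N \<in> G"
    and h_polys: "h \<in> polys n"
    and h_inv: "\<And>N. N \<in> G \<Longrightarrow> lsub n (entries N) h = h"
    and G_char: "\<And>g. g \<in> unitri n \<Longrightarrow> (\<And>i. i < n \<Longrightarrow> \<exists>N\<in>G. \<forall>j<n. entries g i j = entries N i j) \<Longrightarrow>
      lsub n (entries g) h = h \<Longrightarrow> g \<in> G"
begin

sublocale fs: finite_subfield "\<lambda>c :: 'a. to_fract (Const c)" p "CARD('a)"
  by (rule finite_subfield_mpoly[OF p card_power])

lemma of_nat_p_field: "of_nat p = (0::'a)"
proof -
  obtain e where "CARD('a) = p ^ e" using card_power by auto
  then have "(of_nat p :: 'a) ^ e = 0" using of_nat_card_eq_0[where ?'a='a] by simp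
  then show ?thesis by simp
qed

lemma G_carrier: "N \<in> G \<Longrightarrow> N \<in> carrier_mat n n"
  using G_unitri unitri_carrier by auto

lemma finite_G: "finite G"
  using G_unitri unitri_card(1) by (rule finite_subset)

text \<open>Left multiplication by \<open>N\<close> is injective on the finite set \<open>G\<close>,
  hence onto, so closure under products already gives inverses.\<close>

lemma G_inverse:
  assumes N: "N \<in> G"
  obtains X where "X \<in> G" "N * X = 1\<^sub>m n" "X * N = 1\<^sub>m n" "the (mat_inverse N) = X"
proof -
  have "inj_on (\<lambda>X. N * X) G"
    using unitri_cancel(1)[of N n] N G_unitri G_carrier by (auto simp: inj_on_def)
  then have "(\<lambda>X. N * X) ` G = G"
    using G_mult[OF N] by (intro endo_inj_surj finite_G) auto
  then obtain X where X: "X \<in> G" "N * X = 1\<^sub>m n" using G_one by (metis imageE)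
  have XN: "X * N = 1\<^sub>m n"
    using mat_mult_left_right_inverse[OF G_carrier[OF N] G_carrier[OF X(1)] X(2)] .
  have "mat_inverse N = Some X"
  proof (cases "mat_inverse N")
    case None
    then have "N \<notin> Units (ring_mat TYPE('a) n ())" by (rule mat_inverse(1)[OF G_carrier[OF N]])
    moreover have "N \<in> Units (ring_mat TYPE('a) n ())"
      using X XN G_carrier N by (auto simp: Units_def ring_mat_def)
    ultimately show ?thesis by simp
  next
    case (Some B)
    then have B: "N * B = 1\<^sub>m n" "B \<in> carrier_mat n n" using mat_inverse(2)[OF G_carrier[OF N]] by auto
    have "B = X"
      using unitri_cancel(1)[of N n B X] N G_unitri B X G_carrier by auto
    then show ?thesis using Some by simp
  qed
  then show ?thesis using that[of X] X XN by simp
qed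

text \<open>Since \<open>G\<close> contains inverses, orbits can be computed from the rows of the
  elements of \<open>G\<close> themselves, without the inverse in \<open>act\<close>.\<close>

lemma act_image: "(\<lambda>N. act N f) ` G = (\<lambda>N. lsub n (entries N) f) ` G"
proof (intro equalityI subsetI)
  fix y assume "y \<in> (\<lambda>N. act N f) ` G"
  then obtain N where "N \<in> G" "y = act N f" by auto
  moreover obtain X where "X \<in> G" "the (mat_inverse N) = X" by (rule G_inverse[OF \<open>N \<in> G\<close>])
  ultimately show "y \<in> (\<lambda>N. lsub n (entries N) f) ` G" by (auto simp: act_eq_lsub[OF G_carrier])
next
  fix y assume "y \<in> (\<lambda>N. lsub n (entries N) f) ` G"
  then obtain N where N: "N \<in> G" "y = lsub n (entries N) f" by auto
  obtain X where X: "X \<in> G" "N * X = 1\<^sub>m n" by (rule G_inverse[OF N(1)])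
  obtain Y where Y: "Y \<in> G" "X * Y = 1\<^sub>m n" "the (mat_inverse X) = Y" by (rule G_inverse[OF X(1)])
  have "N = N * (X * Y)" using right_mult_one_mat[OF G_carrier[OF N(1)]] Y by simp
  also have "\<dots> = N * X * Y"
    using assoc_mult_mat[OF G_carrier[OF N(1)] G_carrier[OF X(1)] G_carrier[OF Y(1)]] by simp
  also have "\<dots> = Y" using left_mult_one_mat[OF G_carrier[OF Y(1)]] X by simp
  finally have "N = Y" .
  then have "y = act X f" using N Y by (simp add: act_eq_lsub[OF G_carrier[OF X(1)]])
  then show "y \<in> (\<lambda>N. act N f) ` G" using X by auto
qed

lemma invariants_eq: "invariants n G = {f \<in> polys n. \<forall>N\<in>G. lsub n (entries N) f = f}"
proof -
  have "(\<forall>N\<in>G. act N f = f) \<longleftrightarrow> (\<forall>y\<in>(\<lambda>N. act N f) ` G. y = f)" for f :: "'a mpoly" by auto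
  then show ?thesis unfolding invariants_def act_image by auto
qed

definition orbit :: "nat \<Rightarrow> 'a mpoly set" where
  "orbit i = (\<lambda>N. linear_form n (entries N i)) ` G"

lemma orbit_product_eq: "i < n \<Longrightarrow> orbit_product G (Var i) = (\<Prod>u\<in>orbit i. u)"
  by (simp add: orbit_product_def act_image orbit_def lsub_Var)

lemma finite_orbit: "finite (orbit i)"
  by (simp add: orbit_def finite_G)

lemma Var_in_orbit: "i < n \<Longrightarrow> Var i \<in> orbit i"
proof -
  assume i: "i < n"
  have "linear_form n (entries (1\<^sub>m n) i) = linear_form n (\<lambda>j. if i = j then 1 else 0)"
    using i by (intro linear_form_cong) (auto simp: entries_def)
  then show ?thesis unfolding orbit_def using G_one i
    by (metis (no_types, lifting) image_eqI linear_form_unit)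
qed

lemma lsub_G_inject:
  assumes "N \<in> G" "lsub n (entries N) f = lsub n (entries N) g"
  shows "f = g"
proof -
  obtain X where X: "X \<in> G" "N * X = 1\<^sub>m n" by (rule G_inverse[OF assms(1)])
  have id: "lsub n (entries X) (lsub n (entries N) f) = f" for f
  proof -
    have "lsub n (entries X) (lsub n (entries N) f) = lsub n (\<lambda>i j. if i = j then 1 else 0) f"
      unfolding lsub_lsub
    proof (rule lsub_cong)
      fix i j assume ij: "i < n" "j < n"
      show "(\<Sum>k<n. entries N i k * entries X k j) = (if i = j then 1 else 0)"
        unfolding entries_mult[OF G_carrier[OF assms(1)] G_carrier[OF X(1)] ij, symmetric] X(2)
        using ij by (simp add: entries_def)
    qed
    then show ?thesis by (simp add: lsub_id)
  qed
  have "f = lsub n (entries X) (lsub n (entries N) g)" unfolding assms(2)[symmetric] by (rule id[symmetric])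
  then show ?thesis unfolding id .
qed

lemma lsub_orbit_product:
  assumes N: "N \<in> G" and i: "i < n"
  shows "lsub n (entries N) (\<Prod>u\<in>orbit i. u) = (\<Prod>u\<in>orbit i. u)"
proof -
  have inj: "inj_on (lsub n (entries N)) (orbit i)"
    using lsub_G_inject[OF N] by (auto simp: inj_on_def)
  have "lsub n (entries N) u \<in> orbit i" if "u \<in> orbit i" for u
  proof -
    obtain M where M: "M \<in> G" "u = linear_form n (entries M i)" using \<open>u \<in> orbit i\<close> by (auto simp: orbit_def)
    have "lsub n (entries N) u = linear_form n (entries (M * N) i)"
      unfolding M lsub_linear_form using entries_mult[OF G_carrier[OF M(1)] G_carrier[OF N]] i by (intro linear_form_cong) simp
    then show ?thesis using G_mult[OF M(1) N] by (auto simp: orbit_def)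
  qed
  then have img: "lsub n (entries N) ` orbit i = orbit i"
    using inj by (intro endo_inj_surj finite_orbit) auto
  have "lsub n (entries N) (\<Prod>u\<in>orbit i. u) = (\<Prod>u\<in>orbit i. lsub n (entries N) u)"
    by (rule lsub.hom_prod)
  also have "\<dots> = (\<Prod>u\<in>lsub n (entries N) ` orbit i. u)"
    by (simp add: prod.reindex[OF inj])
  finally show ?thesis by (simp add: img)
qed

text \<open>The orbit length divides the order of \<open>G\<close>, by counting along cosets of the
  stabilizer. The order of \<open>G\<close> divides that of \<open>unitri n\<close>, a power of
  \<open>p\<close>, by counting along the cosets of \<open>G\<close>.\<close>

lemma card_orbit:
  assumes i: "i < n"
  shows "\<exists>k. card (orbit i) = p ^ k"
proof -
  define S where "S = {N \<in> G. linear_form n (entries N i) = Var i}"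
  have mult_row: "linear_form n (entries (M * N) i) = lsub n (entries N) (linear_form n (entries M i))"
    if "M \<in> G" "N \<in> G" for M N
    unfolding lsub_linear_form using entries_mult[OF G_carrier[OF that(1)] G_carrier[OF that(2)]] i
    by (intro linear_form_cong) simp
  have fib: "card {M \<in> G. linear_form n (entries M i) = linear_form n (entries N i)} = card S" if N: "N \<in> G" for N
  proof (rule bij_betw_same_card[symmetric], rule bij_betw_imageI)
    show "inj_on (\<lambda>M. M * N) S"
      using unitri_cancel(2)[of N n] N G_unitri G_carrier by (auto simp: inj_on_def S_def)
    show "(\<lambda>M. M * N) ` S = {M \<in> G. linear_form n (entries M i) = linear_form n (entries N i)}"
    proof (intro equalityI subsetI)
      fix Y assume "Y \<in> (\<lambda>M. M * N) ` S"
      then show "Y \<in> {M \<in> G. linear_form n (entries M i) = linear_form n (entries N i)}"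
        using N i G_mult mult_row by (auto simp: S_def lsub_Var)
    next
      fix Y assume Y: "Y \<in> {M \<in> G. linear_form n (entries M i) = linear_form n (entries N i)}"
      obtain X where X: "X \<in> G" "N * X = 1\<^sub>m n" "X * N = 1\<^sub>m n" by (rule G_inverse[OF N])
      have "linear_form n (entries (Y * X) i) = linear_form n (entries (N * X) i)"
        using mult_row[of Y X] mult_row[of N X] Y X(1) N by simp
      also have "\<dots> = linear_form n (\<lambda>j. if i = j then 1 else 0)"
        using X i by (intro linear_form_cong) (auto simp: entries_def)
      finally have "Y * X \<in> S" using Y X G_mult i by (simp add: S_def linear_form_unit)
      moreover have "Y = (Y * X) * N"
        using assoc_mult_mat[of Y n n X n N n] right_mult_one_mat[of Y n n] Y X N G_carrier by auto
      ultimately show "Y \<in> (\<lambda>M. M * N) ` S" by auto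
    qed
  qed
  have "card G = card S * card (orbit i)"
    unfolding orbit_def by (rule card_equal_fibres[OF finite_G fib])
  then have d1: "card (orbit i) dvd card G" by simp
  define coset where "coset = (\<lambda>u. (\<lambda>N. N * u) ` G)"
  have "card {u' \<in> unitri n. coset u' = coset u} = card G" if u: "u \<in> unitri n" for u :: "'a mat"
  proof -
    have uc: "u \<in> carrier_mat n n" using u by (rule unitri_carrier)
    have self: "v \<in> coset v" if "v \<in> unitri n" for v
      unfolding coset_def using G_one unitri_carrier[OF that] by (intro image_eqI[of _ _ "1\<^sub>m n"]) auto
    have "{u' \<in> unitri n. coset u' = coset u} = coset u"
    proof (intro equalityI subsetI)
      fix u' assume "u' \<in> {u' \<in> unitri n. coset u' = coset u}"
      then show "u' \<in> coset u" using self by auto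
    next
      fix u' assume "u' \<in> coset u"
      then obtain N where N: "N \<in> G" "u' = N * u" by (auto simp: coset_def)
      obtain X where X: "X \<in> G" "N * X = 1\<^sub>m n" "X * N = 1\<^sub>m n" by (rule G_inverse[OF N(1)])
      have 1: "M * u' = (M * N) * u" if "M \<in> G" for M
        using assoc_mult_mat[of M n n N n u n] that N uc G_carrier by auto
      have 2: "M * u = (M * X) * u'" if "M \<in> G" for M
      proof -
        have "(M * X) * u' = ((M * X) * N) * u" by (rule 1[OF G_mult[OF that X(1)]])
        also have "(M * X) * N = M"
          using assoc_mult_mat[of M n n X n N n] right_mult_one_mat[of M n n] that N X G_carrier by auto
        finally show ?thesis by simp
      qed
      have "coset u' = coset u"
        unfolding coset_def
      proof (intro equalityI image_subsetI)
        fix M assume M: "M \<in> G"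
        show "M * u' \<in> (\<lambda>N. N * u) ` G" unfolding 1[OF M] using G_mult[OF M N(1)] by simp
        show "M * u \<in> (\<lambda>N. N * u') ` G" unfolding 2[OF M] using G_mult[OF M X(1)] by simp
      qed
      moreover have "u' \<in> unitri n" using N u G_unitri unitri_mult by auto
      ultimately show "u' \<in> {u' \<in> unitri n. coset u' = coset u}" by simp
    qed
    moreover have "inj_on (\<lambda>N. N * u) G"
      using unitri_cancel(2)[OF u] G_carrier by (auto simp: inj_on_def)
    ultimately show ?thesis by (simp add: coset_def card_image)
  qed
  from card_equal_fibres[OF unitri_card(1) this]
  have "card G dvd card (unitri n :: 'a mat set)" by simp
  moreover obtain k where "card (unitri n :: 'a mat set) = CARD('a) ^ k" using unitri_card(2) by blast
  moreover obtain e where "CARD('a) = p ^ e" using card_power by auto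
  ultimately have "card (orbit i) dvd p ^ (e * k)" using d1 by (metis dvd_trans power_mult)
  then show ?thesis using p by (auto simp: divides_primepow_nat)
qed

end

lemma single_inject_pos:
  fixes k k' :: nat
  assumes "Poly_Mapping.single i k = Poly_Mapping.single i' k'" "k > 0"
  shows "i = i' \<and> k = k'"
proof -
  have "Poly_Mapping.lookup (Poly_Mapping.single i' k') i = k" by (simp flip: assms(1))
  then show ?thesis using assms(2) by (auto simp: lookup_single when_def split: if_splits)
qed

interpretation tf: comm_ring_hom "to_fract :: 'b::idom \<Rightarrow> _"
  by (rule comm_ring_hom_to_fract)

section \<open>The algebra of orbit products and Steenrod images\<close>

context classical_setup begin

definition R :: "'a mpoly set" where
  "R = subalgebra_gen ({orbit_product G (Var i) | i. i < n} \<union> {\<theta> h | \<theta>. \<theta> \<in> steenrod_algebra})"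

lemma is_subring_R: "is_subring R"
  unfolding R_def by (rule is_subring_subalgebra_gen)

lemma Const_in_R: "Const c \<in> R"
  unfolding R_def by (rule subalgebra_gen.const)

lemma steenrod_in_R: "\<theta> \<in> steenrod_algebra \<Longrightarrow> \<theta> h \<in> R"
  unfolding R_def by (intro subalgebra_gen.gen) auto

lemma orbit_in_R: "i < n \<Longrightarrow> (\<Prod>u\<in>orbit i. u) \<in> R"
  unfolding R_def orbit_product_eq[symmetric] by (intro subalgebra_gen.gen) auto

lemma h_in_R: "h \<in> R"
  using steenrod_in_R[OF steenrod_algebra.id] by simp

lemma R_subset_invariants: "R \<subseteq> invariants n G"
  unfolding R_def
proof (rule subalgebra_gen_least)
  show "is_subring (invariants n G)"
    unfolding is_subring_def invariants_eq
    by (auto simp: lsub.hom_minus lsub.hom_mult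
        intro: is_subring_diff[OF is_subring_polys] is_subring_mult[OF is_subring_polys] is_subring_1[OF is_subring_polys])
  show "Const c \<in> invariants n G" for c by (simp add: invariants_eq Const_in_polys)
  have "(\<Prod>u\<in>orbit i. u) \<in> invariants n G" if "i < n" for i
    unfolding invariants_eq using lsub_orbit_product[OF _ that]
    by (auto simp: orbit_def intro!: is_subring_prod[OF is_subring_polys] linear_form_in_polys)
  moreover have "\<theta> h \<in> invariants n G" if \<theta>: "\<theta> \<in> steenrod_algebra" for \<theta>
  proof -
    have "lsub n (entries N) (\<theta> h) = \<theta> h" if "N \<in> G" for N
      using steenrod_algebra_lsub[OF p of_nat_p_field card_power \<theta>, of n "entries N" h] h_inv[OF that] by simp
    then show ?thesis using steenrod_algebra_polys[OF \<theta> h_polys] by (simp add: invariants_eq)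
  qed
  ultimately show "{orbit_product G (Var i) | i. i < n} \<union> {\<theta> h | \<theta>. \<theta> \<in> steenrod_algebra} \<subseteq> invariants n G"
    by (auto simp: orbit_product_eq)
qed

lemma R_polys: "R \<subseteq> polys n"
  using R_subset_invariants by (auto simp: invariants_eq)

lemma orbit_lower:
  assumes "u \<in> orbit i" "i < n"
  obtains N where "N \<in> G" "u = linear_form n (entries N i)" "entries N i i = 1" "\<And>j. i < j \<Longrightarrow> j < n \<Longrightarrow> entries N i j = 0"
  using assms G_unitri unitri_diag unitri_upper unfolding orbit_def by blast

lemma linear_form_nonzero:
  assumes "j < n" "a j \<noteq> 0"
  shows "linear_form n a \<noteq> (0 :: 'a mpoly)"
proof
  assume "linear_form n a = 0"
  then have "linear_form n a = linear_form n (\<lambda>_. 0)" by (simp add: linear_form_def)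
  then show False using linear_form_independent assms by metis
qed

lemma orbit_product_nonzero: "i < n \<Longrightarrow> (\<Prod>u\<in>orbit i. u) \<noteq> 0"
proof -
  assume i: "i < n"
  have "u \<noteq> 0" if "u \<in> orbit i" for u
    using orbit_lower[OF that i] linear_form_nonzero[OF i] by (metis one_neq_zero)
  then show ?thesis using finite_orbit by auto
qed

text \<open>A linear form is prime: the substitution that kills it must kill one of the factors.\<close>

lemma linear_form_dvd_prod:
  fixes l :: "nat \<Rightarrow> 'a"
  assumes k: "k < n" "l k \<noteq> 0" and U: "finite U" "\<And>u. u \<in> U \<Longrightarrow> \<exists>b. u = linear_form n b"
    and dvd: "linear_form n l dvd (\<Prod>u\<in>U. u)"
  shows "\<exists>b. linear_form n b \<in> U \<and> (\<forall>j<n. b j = b k / l k * l j)"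
proof -
  \<comment> \<open>This substitution fixes all variables except \<open>x_k\<close>, which is
    eliminated by setting the linear form of \<open>l\<close> to zero.\<close>
  define s where "s = (\<lambda>i j. (if i = j then 1 else 0) - (if i = k then l j / l k else 0))"
  have s: "lsub n s (linear_form n b) = linear_form n (\<lambda>j. b j - b k / l k * l j)" for b
  proof -
    have "(\<Sum>i<n. b i * s i j) = b j - b k / l k * l j" if "j < n" for j
    proof -
      have "(\<Sum>i<n. b i * s i j) = (\<Sum>i<n. (if i = j then b i else 0) - (if i = k then b i * (l j / l k) else 0))"
        unfolding s_def by (intro sum.cong) (auto simp: algebra_simps)
      then show ?thesis using that k by (simp add: sum_subtractf)
    qed
    then show ?thesis unfolding lsub_linear_form by (intro linear_form_cong)
  qed
  have "lsub n s (linear_form n l) = 0"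
    unfolding s using k by (simp add: linear_form_def)
  then have "0 dvd lsub n s (\<Prod>u\<in>U. u)" using dvd lsub.hom_dvd by metis
  then have "(\<Prod>u\<in>U. lsub n s u) = 0" by (simp add: lsub.hom_prod)
  then obtain u where u: "u \<in> U" "lsub n s u = 0" using U(1) by auto
  obtain b where b: "u = linear_form n b" using U(2)[OF u(1)] by auto
  have "linear_form n (\<lambda>j. b j - b k / l k * l j) = linear_form n (\<lambda>_. 0)"
    using u(2) unfolding b s by (simp add: linear_form_def)
  then have "\<forall>j<n. b j - b k / l k * l j = 0" using linear_form_independent by blast
  then show ?thesis using u(1) b by auto
qed

lemma frob_root_one:
  assumes "(\<mu> :: 'a) ^ p ^ k = 1"
  shows "\<mu> = 1"
proof -
  have "(\<mu> - 1) ^ p ^ k = 0"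
    using assms frobenius_diff[OF p of_nat_p_field, of \<mu> 1 k] by simp
  then show ?thesis by simp
qed

lemma fixing_R_in_G:
  assumes fixR: "\<And>\<theta>. \<theta> \<in> R \<Longrightarrow> lsub n g \<theta> = \<theta>"
  obtains N where "N \<in> G" "\<And>i j. i < n \<Longrightarrow> j < n \<Longrightarrow> g i j = entries N i j"
proof -
  \<comment> \<open>The image of \<open>Var i\<close> under \<open>g\<close> divides the orbit
    product, which \<open>g\<close> fixes, so it is proportional to a member of the orbit. The
    factor is \<open>g i i\<close>, as all orbit members have coefficient \<open>1\<close> at
    \<open>Var i\<close>.\<close>
  have row: "\<exists>N\<in>G. \<forall>j<n. g i j = g i i * entries N i j" if i: "i < n" for i
  proof -
    have "Var i dvd (\<Prod>u\<in>orbit i. u)"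
      using dvd_prodI[OF finite_orbit Var_in_orbit[OF i], of "\<lambda>u. u"] .
    then have "lsub n g (Var i) dvd lsub n g (\<Prod>u\<in>orbit i. u)" by (rule lsub.hom_dvd)
    then have dvd: "linear_form n (g i) dvd (\<Prod>u\<in>orbit i. u)"
      using fixR[OF orbit_in_R[OF i]] i by (simp add: lsub_Var)
    then have "linear_form n (g i) \<noteq> 0" using orbit_product_nonzero[OF i] by auto
    then obtain k where k: "k < n" "g i k \<noteq> 0"
      unfolding linear_form_def by (metis (no_types, lifting) Const.hom_zero lessThan_iff mult_zero_left sum.neutral)
    obtain b where b: "linear_form n b \<in> orbit i" "\<forall>j<n. b j = b k / g i k * g i j"
      using linear_form_dvd_prod[OF k finite_orbit _ dvd] by (auto simp: orbit_def)
    obtain N where N: "N \<in> G" "linear_form n b = linear_form n (entries N i)" "entries N i i = 1"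
      using orbit_lower[OF b(1) i] by metis
    have bN: "b j = entries N i j" if "j < n" for j using linear_form_independent[OF N(2) that] .
    define c where "c = b k / g i k"
    have 1: "entries N i j = c * g i j" if "j < n" for j using b(2) bN that by (simp add: c_def)
    then have "c * g i i = 1" using N(3) i by simp
    then have "g i j = g i i * entries N i j" if "j < n" for j
      using 1[OF that] by (simp add: mult.left_commute mult.commute[of c])
    then show ?thesis using N(1) by auto
  qed
  have upper: "g i j = 0" if ij: "i < j" "j < n" for i j
  proof -
    have "i < n" using ij by simp
    from row[OF this] obtain N where N: "N \<in> G" "g i j = g i i * entries N i j" using ij(2) by blast
    have "entries N i j = 0" using N(1) G_unitri unitri_upper[OF _ ij] by blast
    then show ?thesis by (subst N(2)) simp
  qed
  have diag: "g i i = 1" if i: "i < n" for i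
  proof -
    \<comment> \<open>All variables except \<open>x_i\<close> are set to \<open>0\<close>. By
      triangularity each orbit member becomes \<open>x_i\<close> and its image under
      \<open>g\<close> becomes \<open>g i i * x_i\<close>, so
      \<open>g i i ^ card (orbit i) = 1\<close>. The exponent is a power of \<open>p\<close>, which
      leaves only \<open>g i i = 1\<close>.\<close>
    define \<tau> where "\<tau> = lsub n (\<lambda>j j'. if j = i \<and> j' = i then 1 else (0::'a))"
    have \<tau>: "\<tau> (linear_form n a) = Const (a i) * Var i" for a
    proof -
      have "\<tau> (linear_form n a) = linear_form n (\<lambda>j. a i * (if i = j then 1 else 0))"
        unfolding \<tau>_def lsub_linear_form using i
        by (intro linear_form_cong) (simp add: if_distrib[of "\<lambda>x. _ * x"] sum.delta' cong: if_cong conj_cong)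
      also have "\<dots> = Const (a i) * linear_form n (\<lambda>j. if i = j then 1 else 0)"
        by (simp add: linear_form_def sum_distrib_left Const.hom_mult mult.assoc)
      finally show ?thesis using i by (simp add: linear_form_unit)
    qed
    have \<tau>_prod: "\<tau> (prod f A) = (\<Prod>a\<in>A. \<tau> (f a))" for f :: "'a mpoly \<Rightarrow> 'a mpoly" and A
      unfolding \<tau>_def by (rule lsub.hom_prod)
    have 1: "\<tau> u = Var i" and 2: "\<tau> (lsub n g u) = Const (g i i) * Var i" if u: "u \<in> orbit i" for u
    proof -
      obtain N where N: "N \<in> G" "u = linear_form n (entries N i)" "entries N i i = 1"
        "\<And>j. i < j \<Longrightarrow> j < n \<Longrightarrow> entries N i j = 0"
        using orbit_lower[OF u i] by metis
      show "\<tau> u = Var i" using N by (simp add: \<tau>)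
      have "(\<Sum>j<n. entries N i j * g j i) = (\<Sum>j<n. if j = i then g i i else 0)"
        using N(3,4) upper i by (intro sum.cong refl) (metis lessThan_iff linorder_neqE_nat mult_1 mult_zero_left mult_zero_right)
      then show "\<tau> (lsub n g u) = Const (g i i) * Var i"
        using i by (simp add: N(2) lsub_linear_form \<tau>)
    qed
    have "Var i ^ card (orbit i) = \<tau> (\<Prod>u\<in>orbit i. u)" using 1 by (simp add: \<tau>_prod)
    also have "\<dots> = \<tau> (lsub n g (\<Prod>u\<in>orbit i. u))" using fixR[OF orbit_in_R[OF i]] by simp
    also have "\<dots> = (Const (g i i) * Var i) ^ card (orbit i)"
      using 2 by (simp add: lsub.hom_prod \<tau>_prod)
    finally have "Var i ^ card (orbit i) = Const (g i i ^ card (orbit i)) * Var i ^ card (orbit i)"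
      by (simp add: power_mult_distrib Const.hom_power)
    then have "g i i ^ card (orbit i) = 1"
      unfolding Var_power Const_mult_single by (metis lookup_single_eq mult_1_right)
    then show ?thesis using card_orbit[OF i] frob_root_one by auto
  qed
  define M where "M = mat n n (\<lambda>(i, j). g i j)"
  have M: "entries M i j = g i j" if "i < n" "j < n" for i j using that by (simp add: M_def entries_def)
  have "M \<in> unitri n" using diag upper by (auto simp: unitri_def M_def)
  moreover have "\<exists>N\<in>G. \<forall>j<n. entries M i j = entries N i j" if "i < n" for i
    using row[OF that] diag[OF that] M that by auto
  moreover have "lsub n (entries M) h = h"
    using fixR[OF h_in_R] lsub_cong[of n "entries M" g h] M by simp
  ultimately have "M \<in> G" by (rule G_char)
  then show ?thesis using that[of M] M by simp
qed

lemma indep_var_powers: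
  assumes inj: "inj_on (\<lambda>t. (v t, k t)) {..<N}" and pos: "\<And>t. t < N \<Longrightarrow> k t > 0"
  shows "fs.indep N (\<lambda>t. to_fract (Var (v t)) ^ k t)"
  unfolding fs.indep_def
proof (intro allI impI)
  fix a :: "nat \<Rightarrow> 'a" and t
  assume "(\<Sum>l<N. to_fract (Const (a l)) * to_fract (Var (v l)) ^ k l) = 0" and t: "t < N"
  then have "to_fract (\<Sum>l<N. Const (a l) * Var (v l) ^ k l) = to_fract 0"
    by (simp only: tf.hom_sum tf.hom_mult tf.hom_power tf.hom_zero)
  then have "(\<Sum>l<N. Const (a l) * Var (v l) ^ k l) = 0" by (simp only: to_fract_eq_iff)
  then have 0: "(\<Sum>l\<in>{..<N}. Const (a l) * Poly_Mapping.single (Poly_Mapping.single (v l) (k l)) 1) = 0"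
    by (simp add: Var_power)
  have "inj_on (\<lambda>l. Poly_Mapping.single (v l) (k l)) {..<N}"
  proof (rule inj_onI)
    fix l l' assume "l \<in> {..<N}" "l' \<in> {..<N}" "Poly_Mapping.single (v l) (k l) = Poly_Mapping.single (v l') (k l')"
    then show "l = l'" using single_inject_pos[of "v l" "k l" "v l'" "k l'"] pos[of l] inj by (auto simp: inj_on_def)
  qed
  from single_independent[OF _ this 0] show "a t = 0" using t by auto
qed

lemma indep_frobenius_vars:
  assumes v: "inj_on v {..<N}"
  shows "fs.indep (N * N) (\<lambda>t. to_fract (Var (v (t mod N))) ^ CARD('a) ^ (t div N))"
proof (rule indep_var_powers)
  show "inj_on (\<lambda>t. (v (t mod N), CARD('a) ^ (t div N))) {..<N * N}"
  proof (rule inj_onI)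
    fix s t assume st: "s \<in> {..<N * N}" "t \<in> {..<N * N}"
      and eq: "(v (s mod N), CARD('a) ^ (s div N)) = (v (t mod N), CARD('a) ^ (t div N))"
    have "N > 0" using st by (cases N) auto
    then have "s mod N = t mod N" using eq v by (auto simp: inj_on_def)
    moreover have "s div N = t div N" using eq fs.r_gt_1 by (simp add: power_inject_exp)
    ultimately show "s = t" by (metis div_mult_mod_eq)
  qed
  show "CARD('a) ^ (t div N) > 0" for t using fs.r_gt_1 by simp
qed

section \<open>The invariants as integral closure, given a Frobenius relation over the fraction
  field\<close>

abbreviation K :: "'a mpoly fract set" where "K \<equiv> Quot R"

lemma K_subfield: "is_subfield K"
  by (rule is_subfield_Quot[OF is_subring_R])

lemma R_in_K: "f \<in> R \<Longrightarrow> to_fract f \<in> K"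
  by (rule to_fract_in_Quot[OF is_subring_R])

lemma invariants_in_Quot:
  assumes d: "\<And>i. i < n \<Longrightarrow> d i \<in> K"
    and rel: "\<And>j. j < n \<Longrightarrow> to_fract (Var j) ^ CARD('a) ^ n = (\<Sum>i<n. d i * to_fract (Var j) ^ CARD('a) ^ i)"
    and f: "f \<in> invariants n G"
  shows "to_fract f \<in> K"
proof -
  have CK: "to_fract (Const c) \<in> K" for c by (intro R_in_K Const_in_R)
  obtain w A Q X where A: "finite A" "w \<in> A" "Q \<in> polys_over K" "Q \<noteq> 0" "degree Q = card A"
    "\<forall>a\<in>A. poly Q a = 0"
    and X': "\<forall>j<n. X j \<in> polys_over K \<and> poly (X j) w = to_fract (Var j)"
    and conj: "\<forall>w'\<in>A. \<exists>g. \<forall>j<n. poly (X j) w' = (\<Sum>l<n. to_fract (Const (g j l)) * to_fract (Var l))"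
    by (rule exE[OF fs.primitive_element[OF K_subfield CK d rel indep_frobenius_vars[of "\<lambda>j. j", OF inj_on_id2]]],
        assumption, assumption) (elim exE conjE, rule that)
  have X: "\<And>j. j < n \<Longrightarrow> X j \<in> polys_over K" "\<And>j. j < n \<Longrightarrow> poly (X j) w = to_fract (Var j)"
    using X' by auto
  have lift: "poly_lift X \<theta> \<in> polys_over K" if "\<theta> \<in> polys n" for \<theta>
    using poly_lift_over[OF is_subfield_subring[OF K_subfield] CK that X(1)] .
  have fP: "f \<in> polys n" using f by (simp add: invariants_eq)
  show ?thesis
  proof (rule galois_descent[where K = K and Q = Q and A = A and w = w and \<beta> = 1 and \<gamma> = "poly_lift X f"])
    show "1 \<in> polys_over K"
      by (rule is_subring_1[OF is_subring_polys_over[OF is_subfield_subring[OF K_subfield]]])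
    show "poly_lift X f \<in> polys_over K" by (rule lift[OF fP])
    fix w' assume w': "w' \<in> A" and spec: "\<And>P. P \<in> polys_over K \<Longrightarrow> poly P w = 0 \<Longrightarrow> poly P w' = 0"
    obtain g where "\<forall>j<n. poly (X j) w' = (\<Sum>l<n. to_fract (Const (g j l)) * to_fract (Var l))"
      using conj w' by blast
    then have g: "poly (X j) w' = to_fract (linear_form n (g j))" if "j < n" for j
      using that by (simp add: linear_form_def tf.hom_sum tf.hom_mult)
    have "lsub n g \<theta> = \<theta>" if \<theta>: "\<theta> \<in> R" for \<theta>
    proof -
      have \<theta>P: "\<theta> \<in> polys n" using \<theta> R_polys by auto
      \<comment> \<open>The polynomial compares \<open>\<theta>\<close> as a polynomial in
        \<open>w\<close> with \<open>\<theta>\<close> as an element of \<open>K\<close>. It vanishes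
        at \<open>w\<close>, hence at the conjugate \<open>w'\<close>, where this says that
        \<open>g\<close> fixes \<open>\<theta>\<close>.\<close>
      define P where "P = poly_lift X \<theta> - [:to_fract \<theta>:]"
      have "P \<in> polys_over K"
        unfolding P_def using is_subfield_subring[OF K_subfield]
        by (intro is_subring_diff[OF is_subring_polys_over] lift \<theta>P polys_over_const R_in_K \<theta>)
      moreover have "poly P w = 0" by (simp add: P_def poly_lift_eval[OF \<theta>P X(2)])
      ultimately have "poly P w' = 0" by (rule spec)
      then have "to_fract (lsub n g \<theta>) = to_fract \<theta>" by (simp add: P_def poly_lift_lsub[OF \<theta>P g])
      then show ?thesis by (simp only: to_fract_eq_iff)
    qed
    then obtain N where N: "N \<in> G" "\<And>i j. i < n \<Longrightarrow> j < n \<Longrightarrow> g i j = entries N i j"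
      using fixing_R_in_G by metis
    have "lsub n g f = f" using lsub_cong[of n g "entries N" f] N f by (auto simp: invariants_eq)
    then show "poly (poly_lift X f) w' = to_fract f * poly 1 w'"
      by (simp add: poly_lift_lsub[OF fP g])
  qed (use A K_subfield in auto)
qed

lemma invariants_integral:
  assumes f: "f \<in> polys n"
  shows "\<exists>P\<in>polys_over (to_fract ` R). lead_coeff P = 1 \<and> poly P (to_fract f) = 0"
proof -
  let ?C = "to_fract ` R"
  have C: "is_subring ?C" by (rule is_subring_hom_image[OF comm_ring_hom_to_fract is_subring_R])
  \<comment> \<open>The product of all \<open>T + (u - x_i)\<close> minus the orbit product, as a
    polynomial in \<open>T\<close>. It vanishes at \<open>T = x_i\<close>, and
    \<open>u - x_i\<close> involves only variables before \<open>x_i\<close>, because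
    \<open>u\<close> has coefficient \<open>1\<close> at \<open>x_i\<close>.\<close>
  define P where "P = (\<lambda>i. (\<Prod>u\<in>orbit i. [:to_fract (u - Var i), 1:]) - [:to_fract (\<Prod>u\<in>orbit i. u):])"
  have "\<exists>B. finite B \<and> 1 \<in> B \<and> (\<forall>i<n. to_fract (Var i) \<in> multipliers ?C B)"
  proof (rule triangular_integral[OF C, of n P])
    fix i assume i: "i < n"
    define A where "A = (\<Prod>u\<in>orbit i. [:to_fract (u - Var i), 1:])"
    have "degree A = card (orbit i)"
      unfolding A_def by (subst degree_prod_eq_sum_degree) auto
    then have dA: "degree A > 0" using Var_in_orbit[OF i] finite_orbit by (auto simp: card_gt_0_iff)
    have lA: "lead_coeff A = 1" unfolding A_def by (simp add: lead_coeff_prod)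
    have PA: "P i = A - [:to_fract (\<Prod>u\<in>orbit i. u):]" by (simp only: P_def A_def)
    have "degree (P i) = degree A"
      unfolding PA diff_conv_add_uminus using dA by (intro degree_add_eq_left) simp
    moreover have "coeff [:to_fract (\<Prod>u\<in>orbit i. u):] (degree A) = 0" using dA by (intro coeff_eq_0) simp
    ultimately show "lead_coeff (P i) = 1" using lA unfolding PA by simp
    show "poly (P i) (to_fract (Var i)) = 0"
      by (simp add: P_def poly_prod tf.hom_minus tf.hom_prod)
    fix D assume D: "is_subring D" "?C \<subseteq> D" "\<And>j. j < i \<Longrightarrow> to_fract (Var j) \<in> D"
    have CD: "to_fract (Const c) \<in> D" for c using D(2) Const_in_R by auto
    have "to_fract (u - Var i) \<in> D" if u: "u \<in> orbit i" for u
    proof -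
      obtain N where N: "N \<in> G" "u = linear_form n (entries N i)" "entries N i i = 1"
        "\<And>j. i < j \<Longrightarrow> j < n \<Longrightarrow> entries N i j = 0"
        using orbit_lower[OF u i] by metis
      have "u = (\<Sum>j<n. Const (entries N i j) * Var j)" by (simp add: N linear_form_def)
      also have "\<dots> = (\<Sum>j<Suc i. Const (entries N i j) * Var j)"
        using i N(4) by (intro sum.mono_neutral_right) auto
      finally have "to_fract (u - Var i) = (\<Sum>j<i. to_fract (Const (entries N i j)) * to_fract (Var j))"
        using N(3) by (simp add: tf.hom_sum tf.hom_mult)
      then show ?thesis using D CD by (auto intro!: is_subring_sum is_subring_mult)
    qed
    then have "A \<in> polys_over D"
      unfolding A_def using D(1)
      by (intro is_subring_prod[OF is_subring_polys_over])
        (auto simp: polys_over_def coeff_pCons is_subring_1 is_subring_0 split: nat.splits)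
    moreover have "to_fract (\<Prod>u\<in>orbit i. u) \<in> D" using D(2) orbit_in_R[OF i] by auto
    ultimately show "P i \<in> polys_over D"
      unfolding P_def A_def[symmetric] using D(1)
      by (intro is_subring_diff[OF is_subring_polys_over] polys_over_const)
  qed
  then obtain B where B: "finite B" "1 \<in> B" "\<And>i. i < n \<Longrightarrow> to_fract (Var i) \<in> multipliers ?C B" by auto
  have "to_fract f \<in> multipliers ?C B"
    using f
  proof (induction rule: polys_induct)
    case (Const c)
    then show ?case using subset_multipliers[OF C, of B] Const_in_R by auto
  qed (use B in \<open>auto simp: tf.hom_add tf.hom_mult intro: is_subring_add[OF is_subring_multipliers[OF C]]
      is_subring_mult[OF is_subring_multipliers[OF C]]\<close>)
  then show ?thesis by (rule multipliers_integral[OF C B(1,2) one_neq_zero])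
qed

text \<open>The relation over \<open>K\<close> is isolated as a hypothesis because nondegenerate and
  degenerate forms supply it in different ways.\<close>

theorem invariants_eq_integral_closure:
  assumes d: "\<And>i. i < n \<Longrightarrow> d i \<in> K"
    and rel: "\<And>j. j < n \<Longrightarrow> to_fract (Var j) ^ CARD('a) ^ n = (\<Sum>i<n. d i * to_fract (Var j) ^ CARD('a) ^ i)"
  shows "to_fract ` invariants n G = integral_closure R K"
proof (intro equalityI subsetI)
  fix z assume "z \<in> to_fract ` invariants n G"
  then obtain f where f: "f \<in> invariants n G" "z = to_fract f" by auto
  have "f \<in> polys n" using f by (simp add: invariants_eq)
  from invariants_integral[OF this] invariants_in_Quot[OF d rel f(1)]
  show "z \<in> integral_closure R K"
    unfolding integral_closure_def f(2) polys_over_def by auto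
next
  fix z assume "z \<in> integral_closure R K"
  then obtain P where z: "z \<in> K" and P: "lead_coeff P = 1" "P \<in> polys_over (to_fract ` R)" "poly P z = 0"
    unfolding integral_closure_def polys_over_def by blast
  obtain a b where ab: "z = to_fract a / to_fract b" "a \<in> R" "b \<in> R" "b \<noteq> 0"
    using z unfolding Quot_def by blast
  have abP: "a \<in> polys n" "b \<in> polys n" using ab R_polys by auto
  have "P \<in> polys_over (to_fract ` polys n)"
    using polys_over_mono[OF image_mono[OF R_polys] P(2)] .
  from polys_integrally_closed[OF abP ab(4) this P(1)] P(3) ab(1)
  obtain c where c: "c \<in> polys n" "a = c * b" by auto
  have "lsub n (entries N) c = c" if N: "N \<in> G" for N
  proof -
    have "lsub n (entries N) a = a" "lsub n (entries N) b = b"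
      using ab N R_subset_invariants by (auto simp: invariants_eq)
    then have "lsub n (entries N) c * b = c * b" using c(2) by (simp add: lsub.hom_mult)
    then show ?thesis using ab(4) by simp
  qed
  then have "c \<in> invariants n G" using c by (simp add: invariants_eq)
  moreover have "z = to_fract c" using ab c by (simp add: tf.hom_mult)
  ultimately show "z \<in> to_fract ` invariants n G" by simp
qed

end

section \<open>Forms and their Gram relations\<close>

lemma sum_square_split:
  fixes c :: "nat \<Rightarrow> nat \<Rightarrow> 'b::comm_monoid_add"
  shows "(\<Sum>i<n. \<Sum>j<n. c i j) = (\<Sum>i<n. c i i) + (\<Sum>j<n. \<Sum>i<j. c i j + c j i)"
proof (induction n)
  case (Suc n)
  have "(\<Sum>i<Suc n. \<Sum>j<Suc n. c i j) = (\<Sum>i<n. \<Sum>j<n. c i j) + (\<Sum>i<n. c i n) + (\<Sum>j<n. c n j) + c n n"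
    by (simp add: sum.distrib ac_simps)
  then show ?case unfolding Suc by (simp add: sum.distrib ac_simps)
qed simp

lemma sum_lessThan_double:
  fixes f :: "nat \<Rightarrow> 'b::comm_monoid_add"
  shows "(\<Sum>i<2 * m. f i) = (\<Sum>i<m. f i + f (2 * m - 1 - i))"
proof -
  have "{..<2 * m} = {..<m} \<union> {m..<2 * m}" by auto
  then have "(\<Sum>i<2 * m. f i) = (\<Sum>i<m. f i) + (\<Sum>i\<in>{m..<2 * m}. f i)"
    using sum.union_disjoint[of "{..<m}" "{m..<2 * m}" f] by (simp add: disjoint_iff)
  also have "(\<Sum>i\<in>{m..<2 * m}. f i) = (\<Sum>i<m. f (2 * m - 1 - i))"
    by (rule sum.reindex_bij_witness[of _ "\<lambda>i. 2 * m - 1 - i" "\<lambda>i. 2 * m - 1 - i"]) auto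
  finally show ?thesis by (simp add: sum.distrib)
qed

context classical_setup begin

text \<open>The Steenrod operation with index \<open>s = q * r ^ k\<close> multiplies the exponent
  \<open>s\<close> of the second variable by \<open>r\<close> and leaves the first variable alone.
  Iteration gives all twists of the form.\<close>

lemma form_in_R:
  assumes q: "q = p ^ e" "q \<ge> 2"
    and "\<theta> \<in> steenrod_algebra" "\<theta> h = (\<Sum>i<N. \<Sum>j<N. Const (H i j) * (Var (v i) * Var (v j) ^ q))"
  shows "(\<Sum>i<N. \<Sum>j<N. Const (H i j) * (Var (v i) * Var (v j) ^ (q * CARD('a) ^ k))) \<in> R"
proof -
  let ?F = "\<lambda>k. (\<Sum>i<N. \<Sum>j<N. Const (H i j) * (Var (v i) * Var (v j) ^ (q * CARD('a) ^ k)))"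
  obtain e' where e': "CARD('a) = p ^ e'" using card_power by auto
  have "\<exists>\<theta>\<in>steenrod_algebra. \<theta> h = ?F k"
  proof (induction k)
    case 0
    then show ?case using assms(3,4) by auto
  next
    case (Suc k)
    then obtain \<theta> where \<theta>: "\<theta> \<in> steenrod_algebra" "\<theta> h = ?F k" by blast
    define s where "s = q * CARD('a) ^ k"
    have "s = p ^ (e + e' * k)" by (simp add: s_def q(1) e' power_add power_mult)
    moreover have "s \<ge> 2"
    proof -
      have "q * 1 \<le> q * CARD('a) ^ k" using fs.r_gt_1 by (intro mult_le_mono2) simp
      then show ?thesis unfolding s_def using q(2) by linarith
    qed
    ultimately have "steenrod_op s (Var i * Var j ^ s :: 'a mpoly) = Var i * Var j ^ (s * CARD('a))" for i j
      by (rule steenrod_op_frobenius[OF p of_nat_p_field])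
    moreover have "s * CARD('a) = q * CARD('a) ^ Suc k" by (simp add: s_def mult_ac)
    ultimately have "(steenrod_op s \<circ> \<theta>) h = ?F (Suc k)"
      by (simp only: comp_apply \<theta>(2) s_def[symmetric] steenrod_op_sum steenrod_op_scale)
    then show ?case using steenrod_algebra.comp[OF steenrod_algebra.op \<theta>(1)] by blast
  qed
  then show ?thesis using steenrod_in_R by metis
qed

lemma form_pow:
  assumes "(\<Sum>i<N. \<Sum>j<N. Const (H i j) * (Var (v i) * Var (v j) ^ s)) \<in> R"
  shows "(\<Sum>i<N. \<Sum>j<N. to_fract (Const (H i j)) * to_fract (Var (v i)) ^ CARD('a) ^ a * to_fract (Var (v j)) ^ (s * CARD('a) ^ a)) \<in> K"
proof -
  have "(\<Sum>i<N. \<Sum>j<N. to_fract (Const (H i j)) * to_fract (Var (v i)) ^ CARD('a) ^ a * to_fract (Var (v j)) ^ (s * CARD('a) ^ a))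
      = to_fract (\<Sum>i<N. \<Sum>j<N. Const (H i j) * (Var (v i) * Var (v j) ^ s)) ^ CARD('a) ^ a"
    by (simp only: tf.hom_sum tf.hom_mult tf.hom_power fs.frob_sum power_mult_distrib fs.\<iota>_frob power_mult[symmetric] mult.assoc)
  then show ?thesis
    using is_subring_power[OF is_subfield_subring[OF K_subfield] R_in_K[OF assms]] by simp
qed

text \<open>The map \<open>v\<close> selects the variables involved, so that the radical variable of
  a degenerate form can be left out.\<close>

lemma relation_of_form:
  assumes q: "q = p ^ e" "q \<ge> 2" and v: "inj_on v {..<N}"
    and \<theta>: "\<theta> \<in> steenrod_algebra" "\<theta> h = (\<Sum>i<N. \<Sum>j<N. Const (H i j) * (Var (v i) * Var (v j) ^ q))"
    and H: "\<And>u :: nat \<Rightarrow> 'a mpoly fract. (\<And>j. j < N \<Longrightarrow> (\<Sum>i<N. u i * to_fract (Const (H i j))) = 0) \<Longrightarrow> (\<forall>i<N. u i = 0)"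
  shows "\<exists>d. (\<forall>i<N. d i \<in> K) \<and> (\<forall>j<N. to_fract (Var (v j)) ^ CARD('a) ^ N =
    (\<Sum>i<N. d i * to_fract (Var (v j)) ^ CARD('a) ^ i))"
proof -
  let ?x = "\<lambda>j. to_fract (Var (v j)) :: 'a mpoly fract"
  \<comment> \<open>With this twist the second variable of a Gram entry has exponent
    \<open>q * r ^ (N + b)\<close>, and \<open>N + b - a\<close> is never negative for
    \<open>a \<le> N\<close>. So the entry is the power \<open>r ^ a\<close> of an element of
    \<open>R\<close>.\<close>
  define s where "s = q * CARD('a) ^ N"
  have s: "s > 0" using q(2) fs.r_gt_1 by (simp add: s_def)
  have inj: "inj_on (\<lambda>t. (v t, k)) {..<N}" for k :: nat using v by (auto simp: inj_on_def)
  have ind: "fs.indep N ?x" using indep_var_powers[OF inj, of 1] by simp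
  have ind_s: "fs.indep N (\<lambda>j. ?x j ^ s)" using indep_var_powers[OF inj, of s] s by simp
  have gram: "(\<Sum>i<N. \<Sum>j<N. to_fract (Const (H i j)) * ?x i ^ CARD('a) ^ a * (?x j ^ s) ^ CARD('a) ^ b) \<in> K"
    if "a \<le> N" "b < N" for a b
  proof -
    have "q * CARD('a) ^ (N + b - a) * CARD('a) ^ a = s * CARD('a) ^ b"
      using that by (simp add: s_def mult.assoc flip: power_add)
    then have "(?x j ^ s) ^ CARD('a) ^ b = ?x j ^ (q * CARD('a) ^ (N + b - a) * CARD('a) ^ a)" for j
      by (simp flip: power_mult)
    then show ?thesis
      using form_pow[OF form_in_R[OF q \<theta>, of "N + b - a"], of a] by simp
  qed
  show ?thesis
  proof (rule fs.frobenius_relation[OF K_subfield ind ind_s, where H = "\<lambda>i j. to_fract (Const (H i j))"])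
    show "\<forall>i<N. u i = 0" if "\<And>j. j < N \<Longrightarrow> (\<Sum>i<N. u i * to_fract (Const (H i j))) = 0" for u
      using that by (rule H)
  qed (use gram in auto)
qed

theorem invariants_nondegenerate:
  assumes q: "q = p ^ e" "q \<ge> 2"
    and \<theta>: "\<theta> \<in> steenrod_algebra" "\<theta> h = (\<Sum>i<n. \<Sum>j<n. Const (H i j) * (Var i * Var j ^ q))"
    and H: "\<And>u :: nat \<Rightarrow> 'a mpoly fract. (\<And>j. j < n \<Longrightarrow> (\<Sum>i<n. u i * to_fract (Const (H i j))) = 0) \<Longrightarrow> (\<forall>i<n. u i = 0)"
  shows "to_fract ` invariants n G = integral_closure R K"
proof -
  have "\<exists>d. (\<forall>i<n. d i \<in> K) \<and> (\<forall>j<n. to_fract (Var j) ^ CARD('a) ^ n =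
    (\<Sum>i<n. d i * to_fract (Var j) ^ CARD('a) ^ i))"
    by (rule relation_of_form[where v = "\<lambda>j. j", OF q inj_on_id2 \<theta>]) (rule H)
  then show ?thesis using invariants_eq_integral_closure by blast
qed

text \<open>In characteristic two every polynomial is \<open>\<alpha> + \<beta> * x_m\<close> with
  \<open>\<alpha>\<close> and \<open>\<beta>\<close> free of odd powers of \<open>x_m\<close>, and
  \<open>\<beta>\<close> is its derivative in \<open>x_m\<close>. For a product of linear forms of
  derivative \<open>1\<close> the product rule shows that it is nonzero.\<close>

lemma orbit_product_derivative:
  assumes two: "(2::'a) = 0" and m: "m < n"
    and C: "is_subring C" "\<And>c. Const c \<in> C" "\<And>j. j < n \<Longrightarrow> j \<noteq> m \<Longrightarrow> Var j \<in> C" "Var m ^ 2 \<in> C"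
  obtains \<alpha> \<beta> where "(\<Prod>u\<in>orbit m. u) = \<alpha> + \<beta> * Var m" "\<alpha> \<in> C" "\<beta> \<in> C" "\<beta> \<noteq> 0"
proof -
  interpret cc: comm_ring_hom "\<lambda>c :: 'a. [:Const c:]"
    by unfold_locales (auto simp: Const.hom_add Const.hom_mult one_pCons)
  \<comment> \<open>The substitution of \<open>x_m + T\<close> for \<open>x_m\<close>; the
    derivative with respect to \<open>T\<close> detects the derivative with respect to
    \<open>x_m\<close>.\<close>
  define \<Psi> where "\<Psi> = subst_hom (\<lambda>c :: 'a. [:Const c:]) (\<lambda>j. if j = m then [:Var m, 1:] else [:Var j:])"
  interpret \<Psi>: comm_ring_hom \<Psi> unfolding \<Psi>_def by (rule cc.comm_ring_hom_subst_hom)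
  have \<Psi>_Const: "\<Psi> (Const c) = [:Const c:]" for c by (simp add: \<Psi>_def cc.subst_hom_Const)
  have \<Psi>_Var: "\<Psi> (Var j) = (if j = m then [:Var m, 1:] else [:Var j:])" for j by (simp add: \<Psi>_def cc.subst_hom_Var)
  have two': "(2 :: 'a mpoly) = 0"
    using of_nat_mpoly_eq_0[of 2, where ?'a='a] two by simp
  have dbl: "x + x = 0" for x :: "'a mpoly"
    unfolding mult_2[symmetric] two' by simp
  define D where "D = {f \<in> C. pderiv (\<Psi> f) = 0}"
  have D: "is_subring D"
    unfolding is_subring_def D_def using C(1)
    by (auto simp: \<Psi>.hom_minus \<Psi>.hom_mult pderiv_diff pderiv_mult intro: is_subring_diff is_subring_mult is_subring_1)
  have DC: "Const c \<in> D" for c using C(2) by (simp add: D_def \<Psi>_Const)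
  have DV: "Var j \<in> D" if "j < n" "j \<noteq> m" for j using C(3) that by (simp add: D_def \<Psi>_Var)
  have D2: "Var m ^ 2 \<in> D"
    using C(4) by (simp add: D_def \<Psi>.hom_mult \<Psi>_Var power2_eq_square pderiv_mult pderiv_pCons dbl)
  define E where "E = {a + b * Var m | a b. a \<in> D \<and> b \<in> D}"
  have E: "is_subring E"
    unfolding is_subring_def
  proof (intro conjI ballI)
    show "1 \<in> E" unfolding E_def using is_subring_1[OF D] is_subring_0[OF D] by force
    fix f g assume "f \<in> E" "g \<in> E"
    then obtain a b a' b' where fg: "f = a + b * Var m" "g = a' + b' * Var m" "a \<in> D" "b \<in> D" "a' \<in> D" "b' \<in> D"
      by (auto simp: E_def)
    have "f - g = (a - a') + (b - b') * Var m" by (simp add: fg algebra_simps)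
    then show "f - g \<in> E" unfolding E_def using fg is_subring_diff[OF D] by blast
    have "f * g = (a * a' + b * b' * Var m ^ 2) + (a * b' + b * a') * Var m"
      by (simp add: fg algebra_simps power2_eq_square)
    moreover have "a * a' + b * b' * Var m ^ 2 \<in> D" "a * b' + b * a' \<in> D"
      using fg D2 by (auto intro!: is_subring_add[OF D] is_subring_mult[OF D])
    ultimately show "f * g \<in> E" unfolding E_def by blast
  qed
  have "D \<subseteq> E"
  proof
    fix f assume "f \<in> D"
    moreover have "f = f + 0 * Var m" by simp
    ultimately show "f \<in> E" unfolding E_def using is_subring_0[OF D] by blast
  qed
  moreover have "Var m \<in> E"
  proof -
    have "Var m = 0 + 1 * Var m" by simp
    then show ?thesis unfolding E_def using is_subring_0[OF D] is_subring_1[OF D] by blast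
  qed
  ultimately have "Var ` {..<n} \<subseteq> E" using DV by auto
  moreover have "Const c \<in> E" for c using DC \<open>D \<subseteq> E\<close> by auto
  ultimately have "polys n \<subseteq> E"
    unfolding polys_eq_subalgebra_gen by (intro subalgebra_gen_least E)
  moreover have "(\<Prod>u\<in>orbit m. u) \<in> polys n" using orbit_in_R[OF m] R_polys by auto
  ultimately obtain \<alpha> \<beta> where ab: "(\<Prod>u\<in>orbit m. u) = \<alpha> + \<beta> * Var m" "\<alpha> \<in> D" "\<beta> \<in> D"
    unfolding E_def by blast
  have "\<beta> \<noteq> 0"
  proof
    assume "\<beta> = 0"
    then have "pderiv (\<Psi> (\<Prod>u\<in>orbit m. u)) = 0" using ab by (simp add: D_def)
    moreover have \<Psi>u: "\<Psi> u = [:u, 1:]" if u: "u \<in> orbit m" for u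
    proof -
      obtain N where N: "u = linear_form n (entries N m)" "entries N m m = 1"
        using orbit_lower[OF u m] by metis
      have "\<Psi> u = (\<Sum>j<n. [:Const (entries N m j) * Var j:] + (if j = m then [:0, 1:] else 0))"
        unfolding N(1) linear_form_def \<Psi>.hom_sum
        by (intro sum.cong refl) (auto simp: \<Psi>.hom_mult \<Psi>_Const \<Psi>_Var N(2))
      also have "\<dots> = (\<Sum>j<n. [:Const (entries N m j) * Var j:]) + [:0, 1:]"
        using m by (simp add: sum.distrib)
      also have "(\<Sum>j<n. [:Const (entries N m j) * Var j:]) = [:u:]"
      proof -
        have "(\<Sum>j\<in>I. [:f j:]) = [:\<Sum>j\<in>I. f j:]" for I :: "nat set" and f :: "nat \<Rightarrow> 'a mpoly"
          by (induction I rule: infinite_finite_induct) auto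
        then show ?thesis by (simp add: N(1) linear_form_def)
      qed
      finally show ?thesis by simp
    qed
    then have "\<Psi> (\<Prod>u\<in>orbit m. u) = (\<Prod>u\<in>orbit m. [:u, 1:])" by (simp add: \<Psi>.hom_prod)
    ultimately have "pderiv (\<Prod>u\<in>orbit m. [:u, 1:]) = 0" by simp
    then have "(\<Sum>a\<in>orbit m. \<Prod>u\<in>orbit m - {a}. [:u, 1:]) = 0"
      by (simp add: pderiv_prod pderiv_pCons)
    \<comment> \<open>At \<open>T = - x_m\<close> the factor of the orbit member \<open>x_m\<close>
      vanishes, so only the summand that omits it survives. That summand is a product of nonzero
      differences.\<close>
    then have "poly (\<Sum>a\<in>orbit m. \<Prod>u\<in>orbit m - {a}. [:u, 1:]) (- Var m) = 0" by simp
    then have "(\<Sum>a\<in>orbit m. \<Prod>u\<in>orbit m - {a}. u - Var m) = 0"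
      by (simp add: poly_sum poly_prod)
    also have "(\<Sum>a\<in>orbit m. \<Prod>u\<in>orbit m - {a}. u - Var m) = (\<Sum>a\<in>orbit m. if a = Var m then \<Prod>u\<in>orbit m - {Var m}. u - Var m else 0)"
      using finite_orbit Var_in_orbit[OF m] by (intro sum.cong refl) (auto intro!: prod_zero)
    also have "\<dots> = (\<Prod>u\<in>orbit m - {Var m}. u - Var m)"
      using finite_orbit Var_in_orbit[OF m] by simp
    finally show False using finite_orbit by auto
  qed
  then show ?thesis using that ab by (auto simp: D_def)
qed

end

section \<open>Antidiagonal forms and the case of a degenerate polar form\<close>

lemma sum_antidiagonal:
  fixes f :: "nat \<Rightarrow> nat \<Rightarrow> 'b::comm_monoid_add"
  shows "(\<Sum>i<n. \<Sum>j<n. if i + j + 1 = n then f i j else 0) = (\<Sum>i<n. f i (n - 1 - i))"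
proof (rule sum.cong[OF refl])
  fix i assume i: "i \<in> {..<n}"
  have "(\<Sum>j<n. if i + j + 1 = n then f i j else 0) = (\<Sum>j<n. if j = n - 1 - i then f i j else 0)"
    using i by (intro sum.cong) auto
  then show "(\<Sum>j<n. if i + j + 1 = n then f i j else 0) = f i (n - 1 - i)"
    using i by simp
qed

lemma sum_antidiagonal_weighted:
  fixes c :: "'a::zero_neq_one \<Rightarrow> 'b::comm_ring_1" and m :: nat
  assumes "c 1 = 1" "c 0 = 0"
  shows "(\<Sum>i<2 * m. \<Sum>j<2 * m. c (if i + j + 1 = 2 * m then 1 else 0) * f i j) =
    (\<Sum>i<m. f i (2 * m - 1 - i) + f (2 * m - 1 - i) i)"
proof -
  let ?N = "2 * m"
  have "(\<Sum>i<?N. \<Sum>j<?N. c (if i + j + 1 = ?N then 1 else 0) * f i j) = (\<Sum>i<?N. \<Sum>j<?N. if i + j + 1 = ?N then f i j else 0)"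
    using assms by (intro sum.cong refl) simp
  also have "\<dots> = (\<Sum>i<?N. f i (?N - 1 - i))" by (rule sum_antidiagonal)
  also have "\<dots> = (\<Sum>i<m. f i (?N - 1 - i) + f (?N - 1 - i) (?N - 1 - (?N - 1 - i)))"
    by (rule sum_lessThan_double)
  also have "\<dots> = (\<Sum>i<m. f i (?N - 1 - i) + f (?N - 1 - i) i)" by (intro sum.cong) auto
  finally show ?thesis .
qed

context classical_setup begin

text \<open>For \<open>O(2m+1,q)\<close> with \<open>q\<close> even, the polar form has the radical \<open>x\<^sub>m\<close>.  The relation
  \<open>L\<close> satisfied by the other variables has the value \<open>\<zeta>\<close> at \<open>x\<^sub>m\<close>; \<open>\<zeta>\<^sup>2\<close> is the value of the quadratic
  form at \<open>L(x)\<close>, so \<open>\<zeta>\<close> is purely inseparable over \<open>K\<close>.  The orbit product of \<open>x\<^sub>m\<close>, which has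
  a nonzero derivative with respect to \<open>x\<^sub>m\<close>, shows that \<open>\<zeta>\<close> is also separable.\<close>

theorem invariants_degenerate:
  assumes p2: "p = 2" and n: "n = 2 * m + 1" and m: "m \<ge> 1"
    and h: "h = (\<Sum>i<m. Var (2 * m - i) * Var i) + Var m ^ 2"
  shows "to_fract ` invariants n G = integral_closure R K"
proof -
  let ?r = "CARD('a)" and ?N = "2 * m"
  define x where "x = (\<lambda>j. to_fract (Var j) :: 'a mpoly fract)"
  define v where "v = (\<lambda>l. if l < m then l else Suc l)"
  have v_surj: "\<exists>l<?N. v l = j" if "j < n" "j \<noteq> m" for j
    using that by (intro exI[of _ "if j < m then j else j - 1"]) (auto simp: v_def n)
  have v_inj: "inj_on v {..<?N}" by (auto simp: inj_on_def v_def split: if_splits)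
  have v_small: "v i = i" "v (?N - Suc i) = ?N - i" if "i < m" for i using that by (auto simp: v_def)
  have two: "(2::'a) = 0" using of_nat_p_field p2 by simp
  have twoM: "(2 :: 'a mpoly) = 0" using of_nat_mpoly_eq_0[OF of_nat_p_field] p2 by simp
  have twoF: "(2 :: 'a mpoly fract) = 0" using fs.of_nat_p p2 by simp
  have dblM: "y + y = 0" for y :: "'a mpoly" unfolding mult_2[symmetric] twoM by simp
  have dblF: "y + y = 0" for y :: "'a mpoly fract" unfolding mult_2[symmetric] twoF by simp
  obtain e where e: "?r = 2 ^ e" using card_power p2 by auto
  have r2: "?r \<ge> 2" using fs.r_gt_1 by simp
  have e0: "e \<ge> 1" using e r2 by (cases e) auto
  note KS = is_subfield_subring[OF K_subfield]

  \<comment> \<open>On the \<open>2 * m\<close> variables other than \<open>x_m\<close> the polar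
    form is antidiagonal; \<open>x_m ^ 2\<close> contributes nothing because
    \<open>2 = 0\<close>.\<close>
  define H where "H = (\<lambda>i j. if i + j + 1 = ?N then 1 else (0::'a))"
  have op1: "steenrod_op 1 h = (\<Sum>i<?N. \<Sum>j<?N. Const (H i j) * (Var (v i) * Var (v j) ^ ?r))"
  proof -
    have "steenrod_op 1 h = (\<Sum>i<m. Var (?N - i) * Var i ^ ?r + Var i * Var (?N - i) ^ ?r)"
      unfolding h steenrod_op_add steenrod_op_sum steenrod_op_1_quadratic power2_eq_square by (simp add: dblM)
    also have "\<dots> = (\<Sum>i<m. Var (v i) * Var (v (?N - 1 - i)) ^ ?r + Var (v (?N - 1 - i)) * Var (v i) ^ ?r)"
      by (intro sum.cong refl) (simp add: v_small add.commute)
    finally show ?thesis unfolding H_def by (subst sum_antidiagonal_weighted) simp_all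
  qed
  have H_nondeg: "\<forall>i<?N. u i = 0" if u: "\<And>j. j < ?N \<Longrightarrow> (\<Sum>i<?N. u i * to_fract (Const (H i j))) = 0" for u :: "nat \<Rightarrow> 'a mpoly fract"
  proof (intro allI impI)
    fix i assume i: "i < ?N"
    have "(\<Sum>k<?N. u k * to_fract (Const (H k (?N - 1 - i)))) = (\<Sum>k<?N. if k = i then u k else 0)"
      using i by (intro sum.cong refl) (auto simp: H_def)
    then show "u i = 0" using u[of "?N - 1 - i"] i by simp
  qed
  have q: "?r = p ^ e" using e p2 by simp
  have "\<exists>d. (\<forall>i<?N. d i \<in> K) \<and> (\<forall>j<?N. x (v j) ^ ?r ^ ?N = (\<Sum>i<?N. d i * x (v j) ^ ?r ^ i))"
    unfolding x_def
    by (rule relation_of_form[OF q r2 v_inj steenrod_algebra.op op1]) (rule H_nondeg)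
  then obtain d where d: "\<And>i. i < ?N \<Longrightarrow> d i \<in> K"
    and d_rel: "\<And>j. j < ?N \<Longrightarrow> x (v j) ^ ?r ^ ?N = (\<Sum>i<?N. d i * x (v j) ^ ?r ^ i)" by blast
  define L where "L = (\<lambda>u. u ^ ?r ^ ?N - (\<Sum>i<?N. d i * u ^ ?r ^ i))"
  define \<zeta> where "\<zeta> = L (x m)"
  have L0: "L (x j) = 0" if "j < n" "j \<noteq> m" for j
    using v_surj[OF that] d_rel by (auto simp: L_def)

  have \<zeta>2: "\<zeta> ^ 2 \<in> K"
  proof -
    define ec where "ec = (\<lambda>i. if i = ?N then 1 else - d i)"
    have ecK: "ec i \<in> K" if "i < Suc ?N" for i
      using that d KS by (auto simp: ec_def is_subring_1 is_subring_uminus)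
    have L_ec: "L u = (\<Sum>i<Suc ?N. ec i * u ^ ?r ^ i)" for u
      by (simp add: L_def ec_def sum_negf)
    define c where "c = (\<lambda>i i'. ec i * ec i' * (\<Sum>j<m. x (?N - j) ^ ?r ^ i * x j ^ ?r ^ i'))"
    have "0 = (\<Sum>j<m. L (x (?N - j)) * L (x j))"
      by (rule sum.neutral[symmetric]) (auto simp: L0 n)
    also have "\<dots> = (\<Sum>j<m. \<Sum>i<Suc ?N. \<Sum>i'<Suc ?N. ec i * ec i' * (x (?N - j) ^ ?r ^ i * x j ^ ?r ^ i'))"
      unfolding L_ec sum_product by (intro sum.cong refl) (simp add: mult_ac)
    also have "\<dots> = (\<Sum>i<Suc ?N. \<Sum>j<m. \<Sum>i'<Suc ?N. ec i * ec i' * (x (?N - j) ^ ?r ^ i * x j ^ ?r ^ i'))"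
      by (rule sum.swap)
    also have "\<dots> = (\<Sum>i<Suc ?N. \<Sum>i'<Suc ?N. \<Sum>j<m. ec i * ec i' * (x (?N - j) ^ ?r ^ i * x j ^ ?r ^ i'))"
      by (intro sum.cong refl sum.swap)
    also have "\<dots> = (\<Sum>i<Suc ?N. \<Sum>i'<Suc ?N. c i i')"
      by (simp only: c_def sum_distrib_left)
    \<comment> \<open>The diagonal terms, together with the squares from \<open>\<zeta> ^ 2\<close>,
      are multiples of Frobenius powers of \<open>h\<close>; the terms off the diagonal are values
      of the polar form at two Frobenius powers of the variables.\<close>
    also have "\<dots> = (\<Sum>i<Suc ?N. c i i) + (\<Sum>i'<Suc ?N. \<Sum>i<i'. c i i' + c i' i)"
      by (rule sum_square_split)
    finally have split: "0 = (\<Sum>i<Suc ?N. c i i) + (\<Sum>i'<Suc ?N. \<Sum>i<i'. c i i' + c i' i)" by (simp only:)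
    have "\<zeta> ^ 2 = (\<Sum>i<Suc ?N. (ec i * x m ^ ?r ^ i) ^ 2)"
      unfolding \<zeta>_def L_ec using frobenius_sum[OF p fs.of_nat_p, of _ "{..<Suc ?N}" 1] p2 by simp
    then have "\<zeta> ^ 2 = (\<Sum>i<Suc ?N. c i i + (ec i * x m ^ ?r ^ i) ^ 2) + (\<Sum>i'<Suc ?N. \<Sum>i<i'. c i i' + c i' i)"
      using split by (simp only: sum.distrib) (simp add: algebra_simps)
    also have "\<dots> \<in> K"
    proof (rule is_subring_add[OF KS is_subring_sum[OF KS] is_subring_sum[OF KS is_subring_sum[OF KS]]])
      fix i assume i: "i \<in> {..<Suc ?N}"
      have "to_fract h ^ ?r ^ i = (\<Sum>j<m. x (?N - j) ^ ?r ^ i * x j ^ ?r ^ i) + (x m ^ ?r ^ i) ^ 2"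
      proof -
        obtain k where k: "?r ^ i = p ^ k" using fs.r_pow by auto
        have "to_fract h = (\<Sum>j<m. x (?N - j) * x j) + x m ^ 2"
          by (simp add: h x_def tf.hom_add tf.hom_sum tf.hom_mult tf.hom_power)
        then show ?thesis
          by (simp add: k frobenius_add[OF p fs.of_nat_p] frobenius_sum[OF p fs.of_nat_p] power_mult_distrib
              power_mult[symmetric] mult.commute)
      qed
      then have "c i i + (ec i * x m ^ ?r ^ i) ^ 2 = ec i ^ 2 * to_fract h ^ ?r ^ i"
        by (simp add: c_def power_mult_distrib distrib_left power2_eq_square)
      also have "\<dots> \<in> K"
        using i by (intro is_subring_mult[OF KS] is_subring_power[OF KS] ecK R_in_K h_in_R) auto
      finally show "c i i + (ec i * x m ^ ?r ^ i) ^ 2 \<in> K" .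
    next
      fix i' i assume i': "i' \<in> {..<Suc ?N}" and i: "i \<in> {..<i'}"
      \<comment> \<open>The form given by the first Steenrod operation already has exponent
        \<open>r\<close>, so only \<open>i' - i - 1\<close> further twists are needed for
        \<open>r ^ (i' - i)\<close>.\<close>
      let ?s = "?r * ?r ^ (i' - i - 1)"
      have s: "?s * ?r ^ i = ?r ^ i'"
        using i by (simp flip: power_Suc power_add)
      have "(\<Sum>a<?N. \<Sum>b<?N. to_fract (Const (H a b)) * (x (v a) ^ ?r ^ i * x (v b) ^ ?r ^ i')) \<in> K"
        using form_pow[OF form_in_R[OF q r2 steenrod_algebra.op op1, of "i' - i - 1"], of i]
        unfolding s x_def by (simp only: mult.assoc)
      then have "(\<Sum>a<m. x a ^ ?r ^ i * x (?N - a) ^ ?r ^ i' + x (?N - a) ^ ?r ^ i * x a ^ ?r ^ i') \<in> K"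
        unfolding H_def by (subst (asm) sum_antidiagonal_weighted) (simp_all add: v_small)
      moreover have "c i i' + c i' i = ec i * ec i' *
          (\<Sum>a<m. x a ^ ?r ^ i * x (?N - a) ^ ?r ^ i' + x (?N - a) ^ ?r ^ i * x a ^ ?r ^ i')"
        by (simp add: c_def sum.distrib algebra_simps)
      ultimately show "c i i' + c i' i \<in> K"
        using i i' ecK by (auto intro!: is_subring_mult[OF KS])
    qed
    finally show ?thesis .
  qed

  have \<zeta>K: "\<zeta> \<in> K"
  proof -
    have CK: "to_fract (Const c) \<in> K" for c by (intro R_in_K Const_in_R)
    obtain w A Q X where A: "finite A" "w \<in> A" "Q \<in> polys_over K" "Q \<noteq> 0" "degree Q = card A"
      "\<forall>a\<in>A. poly Q a = 0"
      and X: "\<forall>j<?N. X j \<in> polys_over K \<and> poly (X j) w = to_fract (Var (v j))"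
      by (rule exE[OF fs.primitive_element[OF K_subfield CK d d_rel[unfolded x_def] indep_frobenius_vars[OF v_inj]]],
          assumption, assumption) (elim exE conjE, rule that)
    note PS = is_subring_polys_over[OF KS]
    \<comment> \<open>The ring generated by \<open>w\<close> over \<open>K\<close>. Here
      \<open>w\<close> is built without \<open>x_m\<close>, so only \<open>x_m ^ 2\<close> is
      available in it, by way of \<open>h\<close>.\<close>
    define M where "M = {z. \<exists>P\<in>polys_over K. z = poly P w}"
    have M: "is_subring M"
      unfolding is_subring_def
    proof (intro conjI ballI)
      show "1 \<in> M" unfolding M_def using is_subring_1[OF PS] by (force intro: bexI[of _ 1])
      fix y z assume "y \<in> M" "z \<in> M"
      then obtain P P' where "P \<in> polys_over K" "P' \<in> polys_over K" "y = poly P w" "z = poly P' w"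
        by (auto simp: M_def)
      then show "y - z \<in> M" "y * z \<in> M"
        unfolding M_def using is_subring_diff[OF PS, of P P'] is_subring_mult[OF PS, of P P'] poly_diff poly_mult
        by (metis (mono_tags, lifting) mem_Collect_eq)+
    qed
    have KM: "y \<in> M" if "y \<in> K" for y
      unfolding M_def using polys_over_const[OF KS that] by (auto intro!: bexI[of _ "[:y:]"])
    have xM: "x j \<in> M" if "j < n" "j \<noteq> m" for j
      using v_surj[OF that] X by (force simp: M_def x_def)
    define C where "C = {f. to_fract f \<in> M}"
    have xm2: "x m ^ 2 \<in> M"
    proof -
      have "to_fract h = (\<Sum>j<m. x (?N - j) * x j) + x m ^ 2"
        by (simp add: h x_def tf.hom_add tf.hom_sum tf.hom_mult tf.hom_power)
      then have "x m ^ 2 = to_fract h - (\<Sum>j<m. x (?N - j) * x j)" by simp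
      also have "\<dots> \<in> M"
        by (intro is_subring_diff[OF M] is_subring_sum[OF M] is_subring_mult[OF M] KM R_in_K h_in_R xM) (auto simp: n)
      finally show ?thesis .
    qed
    have C: "is_subring C"
      unfolding is_subring_def C_def
      using M by (auto simp: is_subring_def tf.hom_minus tf.hom_mult)
    have mn: "m < n" using n by simp
    obtain \<alpha> \<beta> where ab: "(\<Prod>u\<in>orbit m. u) = \<alpha> + \<beta> * Var m" "\<alpha> \<in> C" "\<beta> \<in> C" "\<beta> \<noteq> 0"
    proof (rule orbit_product_derivative[OF two mn C])
      show "Const c \<in> C" for c using KM[OF CK] by (simp add: C_def)
      show "Var j \<in> C" if "j < n" "j \<noteq> m" for j using xM[OF that] by (simp add: C_def x_def)
      show "Var m ^ 2 \<in> C" using xm2 by (simp add: C_def x_def tf.hom_power)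
    qed
    have "to_fract (\<Prod>u\<in>orbit m. u) = to_fract \<alpha> + to_fract \<beta> * x m"
      unfolding ab(1) x_def by (simp only: tf.hom_add tf.hom_mult)
    then have bx: "to_fract \<beta> * x m \<in> M"
      using is_subring_diff[OF M KM[OF R_in_K[OF orbit_in_R[OF mn]]], of "to_fract \<alpha>"] ab(2) by (simp add: C_def)
    \<comment> \<open>As \<open>r ^ i\<close> is even for \<open>i \<ge> 1\<close>, only the term
      with \<open>i = 0\<close> in \<open>\<zeta>\<close> has an odd power of \<open>x_m\<close>;
      the factor \<open>to_fract \<beta>\<close> brings this term into \<open>M\<close> as
      well.\<close>
    have even_pow: "x m ^ ?r ^ i \<in> M" if "i \<ge> 1" for i
    proof -
      have "?r ^ i = 2 * (2 ^ (e * i - 1))"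
        using e e0 that by (simp flip: power_mult power_Suc)
      then show ?thesis using is_subring_power[OF M xm2] by (simp add: power_mult)
    qed
    have \<zeta>_eq: "\<zeta> = x m ^ ?r ^ ?N - (\<Sum>i\<in>{1..<?N}. d i * x m ^ ?r ^ i) - d 0 * x m"
    proof -
      have "{..<?N} = insert 0 {1..<?N}" using m by auto
      then have "(\<Sum>i<?N. d i * x m ^ ?r ^ i) = d 0 * x m + (\<Sum>i\<in>{1..<?N}. d i * x m ^ ?r ^ i)" by simp
      then show ?thesis by (simp add: \<zeta>_def L_def)
    qed
    have bM: "to_fract \<beta> \<in> M" using ab(3) by (simp add: C_def)
    have "to_fract \<beta> * \<zeta> = to_fract \<beta> * (x m ^ ?r ^ ?N - (\<Sum>i\<in>{1..<?N}. d i * x m ^ ?r ^ i)) - d 0 * (to_fract \<beta> * x m)"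
      unfolding \<zeta>_eq by (simp add: algebra_simps)
    also have "\<dots> \<in> M"
      using m by (intro is_subring_diff[OF M] is_subring_mult[OF M] is_subring_sum[OF M] bM bx even_pow KM[OF d]) auto
    finally have "to_fract \<beta> * \<zeta> \<in> M" .
    then obtain B \<Gamma> where BG: "B \<in> polys_over K" "poly B w = to_fract \<beta>" "\<Gamma> \<in> polys_over K" "poly \<Gamma> w = to_fract \<beta> * \<zeta>"
      using bM unfolding M_def by auto
    show "\<zeta> \<in> K"
    proof (rule galois_descent[where K = K and Q = Q and A = A and w = w and \<beta> = B and \<gamma> = \<Gamma>])
      fix w' assume spec: "\<And>P. P \<in> polys_over K \<Longrightarrow> poly P w = 0 \<Longrightarrow> poly P w' = 0"
      \<comment> \<open>The squared identity has coefficients in \<open>K\<close> because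
        \<open>\<zeta> ^ 2\<close> lies there, so it passes to the conjugate \<open>w'\<close>.
        Square roots are unique in characteristic two.\<close>
      define P where "P = \<Gamma> ^ 2 - Polynomial.smult (\<zeta> ^ 2) (B ^ 2)"
      have "P \<in> polys_over K"
        unfolding P_def using BG \<zeta>2
        by (intro is_subring_diff[OF PS] polys_over_smult[OF KS] is_subring_power[OF PS]) auto
      moreover have "poly P w = 0" by (simp add: P_def BG power_mult_distrib mult.commute)
      ultimately have "poly P w' = 0" by (rule spec)
      then have "poly \<Gamma> w' ^ 2 = (\<zeta> * poly B w') ^ 2" by (simp add: P_def power_mult_distrib)
      then have "(poly \<Gamma> w' + \<zeta> * poly B w') ^ 2 = 0"
        using frobenius_add[OF p fs.of_nat_p, of _ _ 1] p2 by (simp add: dblF)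
      then have "poly \<Gamma> w' + \<zeta> * poly B w' = \<zeta> * poly B w' + \<zeta> * poly B w'" by (simp add: dblF)
      then show "poly \<Gamma> w' = \<zeta> * poly B w'" by simp
    qed (use A BG K_subfield ab(4) in auto)
  qed

  \<comment> \<open>The coefficients come from \<open>L u ^ r = \<zeta> ^ (r - 1) * L u\<close>,
    which holds at every variable: both sides are \<open>0\<close> away from \<open>x_m\<close>, and
    \<open>L (x m) = \<zeta>\<close>. Expanding \<open>L u ^ r\<close> raises the length of the
    relation from \<open>2 * m\<close> to \<open>n\<close>.\<close>
  define c where "c = (\<lambda>i. (if i = 0 then 0 else d (i - 1) ^ ?r) + \<zeta> ^ (?r - 1) * (if i = ?N then 1 else - d i))"
  have cK: "c i \<in> K" if "i < n" for i
  proof -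
    have iN: "i < ?N \<or> i = ?N" using that n by auto
    have "(if i = 0 then 0 else d (i - 1) ^ ?r) \<in> K"
    proof (cases "i = 0")
      case False
      then have "d (i - 1) \<in> K" using iN by (intro d) auto
      then show ?thesis using False is_subring_power[OF KS] by simp
    qed (simp add: is_subring_0[OF KS])
    moreover have "(if i = ?N then 1 else - d i) \<in> K"
      using iN d[of i] is_subring_1[OF KS] is_subring_uminus[OF KS] by auto
    ultimately show ?thesis
      unfolding c_def by (intro is_subring_add[OF KS _ is_subring_mult[OF KS is_subring_power[OF KS \<zeta>K]]])
  qed
  have "x j ^ ?r ^ n = (\<Sum>i<n. c i * x j ^ ?r ^ i)" if j: "j < n" for j
  proof -
    have "\<zeta> ^ (?r - 1) * L (x j) = L (x j) ^ ?r"
    proof (cases "j = m")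
      case True
      have "\<zeta> ^ (?r - 1) * \<zeta> = \<zeta> ^ ?r" using r2 by (intro power_minus_mult) simp
      then show ?thesis using True by (simp add: \<zeta>_def)
    next
      case False
      then show ?thesis using L0[OF j] r2 by (simp add: power_0_left)
    qed
    also have "\<dots> = x j ^ ?r ^ n - (\<Sum>i<?N. d i ^ ?r * x j ^ ?r ^ Suc i)"
      using fs.frob_diff[of _ _ 1] fs.frob_sum[of "\<lambda>i. d i * x j ^ ?r ^ i" "{..<?N}" 1]
      by (simp add: L_def n power_mult_distrib mult.commute flip: power_mult)
    finally have "x j ^ ?r ^ n = (\<Sum>i<?N. d i ^ ?r * x j ^ ?r ^ Suc i) + \<zeta> ^ (?r - 1) * L (x j)" by simp
    also have "(\<Sum>i<?N. d i ^ ?r * x j ^ ?r ^ Suc i) = (\<Sum>i<n. (if i = 0 then 0 else d (i - 1) ^ ?r) * x j ^ ?r ^ i)"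
      unfolding n add_0_right Suc_eq_plus1[symmetric] sum.lessThan_Suc_shift by simp
    also have "\<zeta> ^ (?r - 1) * L (x j) = (\<Sum>i<n. \<zeta> ^ (?r - 1) * (if i = ?N then 1 else - d i) * x j ^ ?r ^ i)"
      by (simp add: L_def n sum_negf sum_distrib_left algebra_simps)
    finally show ?thesis by (simp add: c_def sum.distrib distrib_right)
  qed
  then show ?thesis using cK unfolding x_def by (intro invariants_eq_integral_closure)
qed

end

section \<open>The classical groups\<close>

lemma J_form_carrier:
  "X2 \<in> carrier_mat l l \<Longrightarrow> J_form \<epsilon> k X2 \<in> carrier_mat (2 * k + l) (2 * k + l)"
  by (auto simp: J_form_def Let_def append_rows_def J_def)

lemma J_form_index:
  assumes "X2 \<in> carrier_mat l l" "i < 2 * k + l" "j < 2 * k + l"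
  shows "J_form \<epsilon> k X2 $$ (i, j) =
    (if i < k then if i + j + 1 = 2 * k + l then 1 else 0
     else if i < k + l then if k \<le> j \<and> j < k + l then X2 $$ (i - k, j - k) else 0
     else if i + j + 1 = 2 * k + l then \<epsilon> else 0)"
  using assms by (auto simp: J_form_def Let_def append_rows_def J_def)

lemma sum_three_blocks:
  fixes f :: "nat \<Rightarrow> 'b::comm_monoid_add"
  shows "(\<Sum>i<2 * k + l. f i) = (\<Sum>i<k. f i) + (\<Sum>i<l. f (k + i)) + (\<Sum>i<k. f (2 * k + l - 1 - i))"
proof -
  have "(\<Sum>i<2 * k + l. f i) = (\<Sum>i<k + l. f i) + (\<Sum>i\<in>{k + l..<2 * k + l}. f i)"
    using sum.atLeastLessThan_concat[of 0 "k + l" "2 * k + l" f] by (simp add: lessThan_atLeast0)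
  also have "(\<Sum>i\<in>{k + l..<2 * k + l}. f i) = (\<Sum>i<k. f (2 * k + l - 1 - i))"
    by (rule sum.reindex_bij_witness[of _ "\<lambda>i. 2 * k + l - 1 - i" "\<lambda>i. 2 * k + l - 1 - i"]) auto
  also have "(\<Sum>i<k + l. f i) = (\<Sum>i<k. f i) + (\<Sum>i\<in>{k..<k + l}. f i)"
    using sum.atLeastLessThan_concat[of 0 k "k + l" f] by (simp add: lessThan_atLeast0)
  also have "(\<Sum>i\<in>{k..<k + l}. f i) = (\<Sum>i<l. f (k + i))"
    by (rule sum.reindex_bij_witness[of _ "\<lambda>i. k + i" "\<lambda>i. i - k"]) auto
  finally show ?thesis .
qed

lemma sum_J_form:
  fixes c :: "'a::field \<Rightarrow> 'b::comm_ring_1"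
  assumes X2: "X2 \<in> carrier_mat l l" and c: "c 0 = 0" "c 1 = 1"
  shows "(\<Sum>i<2 * k + l. \<Sum>j<2 * k + l. c (J_form \<epsilon> k X2 $$ (i, j)) * f i j) =
    (\<Sum>i<k. f i (2 * k + l - 1 - i) + c \<epsilon> * f (2 * k + l - 1 - i) i) +
    (\<Sum>i<l. \<Sum>j<l. c (X2 $$ (i, j)) * f (k + i) (k + j))"
proof -
  let ?n = "2 * k + l"
  let ?g = "\<lambda>i. \<Sum>j<?n. c (J_form \<epsilon> k X2 $$ (i, j)) * f i j"
  have top: "?g i = f i (?n - 1 - i)" if "i < k" for i
  proof -
    have "?g i = (\<Sum>j<?n. if j = ?n - 1 - i then f i j else 0)"
      using that c by (intro sum.cong refl) (auto simp: J_form_index[OF X2])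
    then show ?thesis using that by simp
  qed
  have bottom: "?g (?n - 1 - i) = c \<epsilon> * f (?n - 1 - i) i" if "i < k" for i
  proof -
    have "?g (?n - 1 - i) = (\<Sum>j<?n. if j = i then c \<epsilon> * f (?n - 1 - i) j else 0)"
      using that c by (intro sum.cong refl) (auto simp: J_form_index[OF X2])
    then show ?thesis using that by simp
  qed
  have middle: "?g (k + i) = (\<Sum>j<l. c (X2 $$ (i, j)) * f (k + i) (k + j))" if "i < l" for i
  proof -
    have "?g (k + i) = (\<Sum>j<?n. if k \<le> j \<and> j < k + l then c (X2 $$ (i, j - k)) * f (k + i) j else 0)"
      using that c by (intro sum.cong refl) (auto simp: J_form_index[OF X2])
    also have "\<dots> = (\<Sum>j<l. c (X2 $$ (i, j)) * f (k + i) (k + j))"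
      unfolding sum_three_blocks by (simp, intro sum.neutral, auto)
    finally show ?thesis .
  qed
  show ?thesis
    unfolding sum_three_blocks[of ?g] using top bottom middle by (simp add: sum.distrib)
qed

text \<open>Each outer row and column has a single nonzero entry, which annihilates one outer
  coordinate at a time; what remains is the middle block.\<close>

lemma J_form_nondegenerate:
  fixes u :: "nat \<Rightarrow> 'a::field mpoly fract"
  assumes X2: "X2 \<in> carrier_mat l l" and \<epsilon>: "\<epsilon> \<noteq> 0"
    and nd: "\<And>w :: nat \<Rightarrow> 'a mpoly fract. (\<And>j. j < l \<Longrightarrow> (\<Sum>i<l. w i * to_fract (Const (X2 $$ (i, j)))) = 0) \<Longrightarrow> (\<forall>i<l. w i = 0)"
    and u: "\<And>j. j < 2 * k + l \<Longrightarrow> (\<Sum>i<2 * k + l. u i * to_fract (Const (J_form \<epsilon> k X2 $$ (i, j)))) = 0"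
  shows "\<forall>i<2 * k + l. u i = 0"
proof -
  let ?n = "2 * k + l"
  have \<epsilon>0: "to_fract (Const \<epsilon>) \<noteq> 0"
    using \<epsilon> by (metis Const_def lookup_single_eq lookup_zero to_fract_eq_0_iff)
  have bottom: "u (?n - 1 - j) = 0" if j: "j < k" for j
  proof -
    have "(\<Sum>i<?n. u i * to_fract (Const (J_form \<epsilon> k X2 $$ (i, j)))) = (\<Sum>i<?n. if i = ?n - 1 - j then u i * to_fract (Const \<epsilon>) else 0)"
      using j by (intro sum.cong refl) (auto simp: J_form_index[OF X2])
    then show ?thesis using u[of j] j \<epsilon>0 by simp
  qed
  have top: "u i = 0" if i: "i < k" for i
  proof -
    have "(\<Sum>i'<?n. u i' * to_fract (Const (J_form \<epsilon> k X2 $$ (i', ?n - 1 - i)))) = (\<Sum>i'<?n. if i' = i then u i' else 0)"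
      using i by (intro sum.cong refl) (auto simp: J_form_index[OF X2])
    then show ?thesis using u[of "?n - 1 - i"] i by simp
  qed
  have "\<forall>i<l. u (k + i) = 0"
  proof (rule nd)
    fix j assume j: "j < l"
    have "(\<Sum>i<?n. u i * to_fract (Const (J_form \<epsilon> k X2 $$ (i, k + j)))) =
        (\<Sum>i<?n. if k \<le> i \<and> i < k + l then u i * to_fract (Const (X2 $$ (i - k, j))) else 0)"
      using j by (intro sum.cong refl) (auto simp: J_form_index[OF X2])
    also have "\<dots> = (\<Sum>i<l. u (k + i) * to_fract (Const (X2 $$ (i, j))))"
      unfolding sum_three_blocks by (simp, intro sum.neutral, auto)
    finally show "(\<Sum>i<l. u (k + i) * to_fract (Const (X2 $$ (i, j)))) = 0" using u[of "k + j"] j by simp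
  qed
  show ?thesis
  proof (intro allI impI)
    fix i assume i: "i < ?n"
    consider "i < k" | "k \<le> i" "i < k + l" | "k + l \<le> i" by linarith
    then show "u i = 0"
    proof cases
      case 2
      then show ?thesis using \<open>\<forall>i<l. u (k + i) = 0\<close>[rule_format, of "i - k"] by auto
    next
      case 3
      then show ?thesis using bottom[of "?n - 1 - i"] i by simp
    qed (rule top)
  qed
qed

lemma lsub_form:
  fixes g :: "nat \<Rightarrow> nat \<Rightarrow> 'a::{field,finite}"
  assumes "prime p" "of_nat p = (0::'a)" "q = p ^ e"
  shows "lsub n g (\<Sum>i<n. \<Sum>j<n. Const (H i j) * (Var i * Var j ^ q)) =
    (\<Sum>a<n. \<Sum>b<n. Const (\<Sum>i<n. \<Sum>j<n. g i a * H i j * g j b ^ q) * (Var a * Var b ^ q))"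
proof -
  have pow: "linear_form n (g j) ^ q = (\<Sum>b<n. Const (g j b ^ q) * Var b ^ q)" for j
    unfolding linear_form_def assms(3) frobenius_sum[OF assms(1) of_nat_mpoly_eq_0[OF assms(2)]]
    by (simp add: power_mult_distrib Const.hom_power)
  have "lsub n g (\<Sum>i<n. \<Sum>j<n. Const (H i j) * (Var i * Var j ^ q)) =
      (\<Sum>i<n. \<Sum>j<n. \<Sum>a<n. \<Sum>b<n. Const (g i a * H i j * g j b ^ q) * (Var a * Var b ^ q))"
    unfolding lsub.hom_sum
  proof (intro sum.cong refl)
    fix i j assume ij: "i \<in> {..<n}" "j \<in> {..<n}"
    have "lsub n g (Const (H i j) * (Var i * Var j ^ q)) =
        Const (H i j) * (linear_form n (g i) * (\<Sum>b<n. Const (g j b ^ q) * Var b ^ q))"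
      using ij by (simp add: lsub.hom_mult lsub.hom_power lsub_Var pow)
    also have "\<dots> = (\<Sum>a<n. \<Sum>b<n. Const (H i j) * (Const (g i a) * Var a * (Const (g j b ^ q) * Var b ^ q)))"
      by (simp only: linear_form_def sum_product) (simp only: sum_distrib_left)
    also have "\<dots> = (\<Sum>a<n. \<Sum>b<n. Const (g i a * H i j * g j b ^ q) * (Var a * Var b ^ q))"
      by (intro sum.cong refl) (simp add: Const.hom_mult mult_ac)
    finally show "lsub n g (Const (H i j) * (Var i * Var j ^ q)) =
        (\<Sum>a<n. \<Sum>b<n. Const (g i a * H i j * g j b ^ q) * (Var a * Var b ^ q))" .
  qed
  also have "\<dots> = (\<Sum>i<n. \<Sum>a<n. \<Sum>j<n. \<Sum>b<n. Const (g i a * H i j * g j b ^ q) * (Var a * Var b ^ q))"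
    by (intro sum.cong refl sum.swap)
  also have "\<dots> = (\<Sum>a<n. \<Sum>i<n. \<Sum>j<n. \<Sum>b<n. Const (g i a * H i j * g j b ^ q) * (Var a * Var b ^ q))"
    by (rule sum.swap)
  also have "\<dots> = (\<Sum>a<n. \<Sum>i<n. \<Sum>b<n. \<Sum>j<n. Const (g i a * H i j * g j b ^ q) * (Var a * Var b ^ q))"
    by (intro sum.cong refl sum.swap)
  also have "\<dots> = (\<Sum>a<n. \<Sum>b<n. \<Sum>i<n. \<Sum>j<n. Const (g i a * H i j * g j b ^ q) * (Var a * Var b ^ q))"
    by (intro sum.cong refl sum.swap)
  finally show ?thesis by (simp add: Const.hom_sum sum_distrib_right)
qed

text \<open>For \<open>q \<ge> 2\<close> the monomials \<open>x_a * x_b ^ q\<close> are distinct, so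
  the polynomial determines its Gram matrix. With exponent \<open>1\<close> this fails by symmetry,
  and quadratic forms need their own criterion.\<close>

lemma form_eq_iff:
  fixes D :: "nat \<Rightarrow> nat \<Rightarrow> 'a::comm_ring_1"
  assumes q: "q \<ge> 2"
  shows "(\<Sum>a<n. \<Sum>b<n. Const (D a b) * (Var a * Var b ^ q)) = (\<Sum>a<n. \<Sum>b<n. Const (E a b) * (Var a * Var b ^ q))
    \<longleftrightarrow> (\<forall>a<n. \<forall>b<n. D a b = E a b)"
proof
  let ?\<mu> = "\<lambda>(a, b). Poly_Mapping.single a (1::nat) + Poly_Mapping.single b q"
  assume eq: "(\<Sum>a<n. \<Sum>b<n. Const (D a b) * (Var a * Var b ^ q)) = (\<Sum>a<n. \<Sum>b<n. Const (E a b) * (Var a * Var b ^ q))"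
  have mon: "Var a * Var b ^ q = Poly_Mapping.single (?\<mu> (a, b)) (1::'a)" for a b
    unfolding Var_power by (simp add: Var_def mult_single)
  have "(\<Sum>t\<in>{..<n} \<times> {..<n}. Const (D (fst t) (snd t) - E (fst t) (snd t)) * Poly_Mapping.single (?\<mu> t) 1) = 0"
    using eq by (simp add: mon sum.cartesian_product' Const.hom_minus left_diff_distrib sum_subtractf)
  moreover have "inj_on ?\<mu> ({..<n} \<times> {..<n})"
  proof (rule inj_onI)
    fix s t assume "?\<mu> s = ?\<mu> t"
    obtain a b a' b' where st: "s = (a, b)" "t = (a', b')" by (cases s, cases t) auto
    have l: "Poly_Mapping.lookup (?\<mu> s) i = Poly_Mapping.lookup (?\<mu> t) i" for i using \<open>?\<mu> s = ?\<mu> t\<close> by simp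
    have "b = b'"
      using l[of b] q by (auto simp: st lookup_add lookup_single when_def split: if_splits)
    moreover have "a = a'"
      using l[of a] q \<open>b = b'\<close> by (auto simp: st lookup_add lookup_single when_def split: if_splits)
    ultimately show "s = t" using st by simp
  qed
  ultimately have "D (fst t) (snd t) - E (fst t) (snd t) = 0" if "t \<in> {..<n} \<times> {..<n}" for t
    using single_independent[of "{..<n} \<times> {..<n}" ?\<mu> "\<lambda>t. D (fst t) (snd t) - E (fst t) (snd t)" t] that by simp
  from this[of "(a, b)" for a b] show "\<forall>a<n. \<forall>b<n. D a b = E a b" by auto
next
  assume "\<forall>a<n. \<forall>b<n. D a b = E a b"
  then show "(\<Sum>a<n. \<Sum>b<n. Const (D a b) * (Var a * Var b ^ q)) = (\<Sum>a<n. \<Sum>b<n. Const (E a b) * (Var a * Var b ^ q))"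
    by (intro sum.cong refl) auto
qed

text \<open>Evaluation at a unit vector isolates a diagonal entry, evaluation at a sum of two unit
  vectors a symmetrized one. There is no division by \<open>2\<close>, so characteristic two is
  covered.\<close>

lemma quadratic_zero_iff:
  fixes D :: "nat \<Rightarrow> nat \<Rightarrow> 'a::comm_ring_1"
  shows "(\<Sum>a<n. \<Sum>b<n. Const (D a b) * (Var a * Var b)) = 0 \<longleftrightarrow>
    (\<forall>a<n. D a a = 0) \<and> (\<forall>a<n. \<forall>b<n. D a b + D b a = 0)"
proof
  have id: "comm_ring_hom (\<lambda>x :: 'a. x)" by unfold_locales auto
  assume 0: "(\<Sum>a<n. \<Sum>b<n. Const (D a b) * (Var a * Var b)) = 0"
  have ev: "(\<Sum>a<n. \<Sum>b<n. D a b * (s a * s b)) = 0" for s :: "nat \<Rightarrow> 'a"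
  proof -
    interpret S: comm_ring_hom "subst_hom (\<lambda>x :: 'a. x) s" by (rule comm_ring_hom.comm_ring_hom_subst_hom[OF id])
    show ?thesis
      using arg_cong[OF 0, of "subst_hom (\<lambda>x. x) s"]
      by (simp add: S.hom_sum S.hom_mult comm_ring_hom.subst_hom_Const[OF id] comm_ring_hom.subst_hom_Var[OF id])
  qed
  have diag: "D a a = 0" if "a < n" for a
    using ev[of "\<lambda>i. if i = a then 1 else 0"] that
    by (simp add: if_distrib[of "\<lambda>x. x * _"] if_distrib[of "\<lambda>x. _ * x"] cong: if_cong)
  moreover have "D a b + D b a = 0" if ab: "a < n" "b < n" for a b
  proof (cases "a = b")
    case False
    have "(\<Sum>i<n. \<Sum>j<n. D i j * ((if i = a \<or> i = b then 1 else 0) * (if j = a \<or> j = b then 1 else 0)))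
        = (\<Sum>i\<in>{a, b}. \<Sum>j\<in>{a, b}. D i j)"
    proof -
      have "(\<Sum>j<n. D i j * ((if i = a \<or> i = b then 1 else 0) * (if j = a \<or> j = b then 1 else 0)))
          = (if i \<in> {a, b} then \<Sum>j\<in>{a, b}. D i j else 0)" for i
      proof -
        have "(\<Sum>j\<in>{a, b}. D i j) = (\<Sum>j<n. if j \<in> {a, b} then D i j else 0)"
          using ab by (subst sum.inter_restrict[symmetric]) (auto intro: sum.cong)
        then show ?thesis by (auto intro!: sum.cong)
      qed
      moreover have "(\<Sum>i<n. if i \<in> {a, b} then \<Sum>j\<in>{a, b}. D i j else 0) = (\<Sum>i\<in>{a, b}. \<Sum>j\<in>{a, b}. D i j)"
        using ab by (subst sum.inter_restrict[symmetric]) (auto intro: sum.cong)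
      ultimately show ?thesis by simp
    qed
    then show ?thesis using ev[of "\<lambda>i. if i = a \<or> i = b then 1 else 0"] False diag ab by simp
  qed (use diag ab in simp)
  ultimately show "(\<forall>a<n. D a a = 0) \<and> (\<forall>a<n. \<forall>b<n. D a b + D b a = 0)" by blast
next
  assume D: "(\<forall>a<n. D a a = 0) \<and> (\<forall>a<n. \<forall>b<n. D a b + D b a = 0)"
  have "Const (D a b) * (Var a * Var b) + Const (D b a) * (Var b * Var a) = 0" if "a < b" "b < n" for a b
  proof -
    have "Const (D a b) * (Var a * Var b) + Const (D b a) * (Var b * Var a) = Const (D a b + D b a) * (Var a * Var b)"
      by (simp add: Const.hom_add algebra_simps)
    moreover have "D a b + D b a = 0" using D that by auto
    ultimately show ?thesis by simp
  qed
  then show "(\<Sum>a<n. \<Sum>b<n. Const (D a b) * (Var a * Var b)) = 0"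
    unfolding sum_square_split using D by (simp add: sum.neutral)
qed

lemma G_form_iff:
  fixes X2 :: "'a::field mat"
  assumes X2: "X2 \<in> carrier_mat l l"
  shows "N \<in> G_form q \<epsilon> k X2 \<longleftrightarrow> N \<in> unitri (2 * k + l) \<and>
    (\<forall>a<2 * k + l. \<forall>b<2 * k + l. (\<Sum>i<2 * k + l. \<Sum>j<2 * k + l.
      entries N i a * J_form \<epsilon> k X2 $$ (i, j) * entries N j b ^ q) = J_form \<epsilon> k X2 $$ (a, b))"
proof -
  let ?n = "2 * k + l"
  define Y where "Y = J_form \<epsilon> k X2"
  have Y: "Y \<in> carrier_mat ?n ?n" unfolding Y_def by (rule J_form_carrier[OF X2])
  have ent: "(transpose_mat N * Y * bar q N) $$ (a, b) = (\<Sum>i<?n. \<Sum>j<?n. entries N i a * Y $$ (i, j) * entries N j b ^ q)"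
    if N: "N \<in> carrier_mat ?n ?n" and ab: "a < ?n" "b < ?n" for a b
  proof -
    show ?thesis
      using N Y ab by (simp add: bar_def scalar_prod_def entries_def lessThan_atLeast0 sum_distrib_left mult.assoc)
  qed
  have "transpose_mat N * Y * bar q N = Y \<longleftrightarrow>
      (\<forall>a<?n. \<forall>b<?n. (\<Sum>i<?n. \<Sum>j<?n. entries N i a * Y $$ (i, j) * entries N j b ^ q) = Y $$ (a, b))"
    if N: "N \<in> carrier_mat ?n ?n"
  proof
    assume eq: "transpose_mat N * Y * bar q N = Y"
    show "\<forall>a<?n. \<forall>b<?n. (\<Sum>i<?n. \<Sum>j<?n. entries N i a * Y $$ (i, j) * entries N j b ^ q) = Y $$ (a, b)"
      using ent[OF N] by (simp add: eq)
  next
    assume "\<forall>a<?n. \<forall>b<?n. (\<Sum>i<?n. \<Sum>j<?n. entries N i a * Y $$ (i, j) * entries N j b ^ q) = Y $$ (a, b)"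
    then show "transpose_mat N * Y * bar q N = Y"
      using ent[OF N] N Y by (intro eq_matI) (auto simp: bar_def)
  qed
  moreover have "dim_row X2 = l" using X2 by simp
  ultimately show ?thesis
    unfolding G_form_def Y_def[symmetric] using unitri_carrier by auto
qed

text \<open>\<open>F\<close> is what membership in \<open>G\<close> demands besides fixing
  \<open>h\<close>: nothing, except for even-dimensional orthogonal groups with \<open>q\<close>
  even, where the middle block has to be the identity. It must be recognizable row by row, since
  orbit products see only rows.\<close>

lemma classical_setupI:
  fixes h :: "'a::{field,finite} mpoly"
  assumes p: "prime p" "\<exists>e. CARD('a) = p ^ e" and h: "h \<in> polys n"
    and G: "G = {N \<in> unitri n. lsub n (entries N) h = h \<and> F N}"
    and F_one: "F (1\<^sub>m n)" and F_mult: "\<And>M N. M \<in> unitri n \<Longrightarrow> N \<in> unitri n \<Longrightarrow> F M \<Longrightarrow> F N \<Longrightarrow> F (M * N)"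
    and F_rows: "\<And>g. g \<in> unitri n \<Longrightarrow> (\<And>i. i < n \<Longrightarrow> \<exists>N\<in>G. \<forall>j<n. entries g i j = entries N i j) \<Longrightarrow> F g"
  shows "classical_setup n p G h"
proof
  show "1\<^sub>m n \<in> G"
  proof -
    have "lsub n (entries (1\<^sub>m n)) h = lsub n (\<lambda>i j. if i = j then 1 else 0) h"
      by (intro lsub_cong) (simp add: entries_def)
    then show ?thesis using F_one by (simp add: G unitri_one lsub_id)
  qed
  show "M * N \<in> G" if "M \<in> G" "N \<in> G" for M N
  proof -
    have MN: "M \<in> unitri n" "N \<in> unitri n" "F M" "F N" "lsub n (entries M) h = h" "lsub n (entries N) h = h"
      using that by (auto simp: G)
    have "lsub n (entries (M * N)) h = lsub n (entries N) (lsub n (entries M) h)"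
      unfolding lsub_lsub using MN by (intro lsub_cong) (simp add: entries_mult[OF unitri_carrier unitri_carrier])
    then show ?thesis using MN F_mult by (simp add: G unitri_mult)
  qed
qed (use p h F_rows in \<open>auto simp: G\<close>)

lemma Const_eq_0_iff: "Const c = 0 \<longleftrightarrow> c = 0"
  by (metis Const_def lookup_single_eq lookup_zero single_zero)

lemma nondegenerate_1:
  fixes w :: "nat \<Rightarrow> 'a::field mpoly fract"
  assumes "X2 $$ (0, 0) \<noteq> 0" "\<And>j. j < 1 \<Longrightarrow> (\<Sum>i<1. w i * to_fract (Const (X2 $$ (i, j)))) = 0"
  shows "\<forall>i<1. w i = 0"
  using assms(1) assms(2)[of 0] by (simp add: Const_eq_0_iff)

lemma nondegenerate_2:
  fixes w :: "nat \<Rightarrow> 'a::field mpoly fract"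
  assumes d: "X2 $$ (0, 0) * X2 $$ (1, 1) \<noteq> X2 $$ (0, 1) * X2 $$ (1, 0)"
    and w: "\<And>j. j < 2 \<Longrightarrow> (\<Sum>i<2. w i * to_fract (Const (X2 $$ (i, j)))) = 0"
  shows "\<forall>i<2. w i = 0"
proof -
  define c where "c = (\<lambda>i j. to_fract (Const (X2 $$ (i, j))))"
  have "c 0 0 * c 1 1 - c 0 1 * c 1 0 = to_fract (Const (X2 $$ (0, 0) * X2 $$ (1, 1) - X2 $$ (0, 1) * X2 $$ (1, 0)))"
    by (simp only: c_def tf.hom_mult[symmetric] tf.hom_minus[symmetric] Const.hom_mult[symmetric] Const.hom_minus[symmetric])
  then have nz: "c 0 0 * c 1 1 - c 0 1 * c 1 0 \<noteq> 0" using d by (simp add: Const_eq_0_iff)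
  have e: "w 0 * c 0 0 + w 1 * c 1 0 = 0" "w 0 * c 0 1 + w 1 * c 1 1 = 0"
    using w[of 0] w[of 1] by (simp_all add: c_def numeral_2_eq_2)
  have "w 0 * (c 0 0 * c 1 1 - c 0 1 * c 1 0) = (w 0 * c 0 0 + w 1 * c 1 0) * c 1 1 - (w 0 * c 0 1 + w 1 * c 1 1) * c 1 0"
    by (simp add: algebra_simps)
  then have "w 0 = 0" using nz unfolding e by simp
  moreover have "w 1 * (c 0 0 * c 1 1 - c 0 1 * c 1 0) = (w 0 * c 0 1 + w 1 * c 1 1) * c 0 0 - (w 0 * c 0 0 + w 1 * c 1 0) * c 0 1"
    by (simp add: algebra_simps)
  then have "w 1 = 0" using nz unfolding e by simp
  ultimately show ?thesis by (auto simp: less_2_cases_iff)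
qed

lemma of_nat_p_eq_0:
  assumes "CARD('a::{field,finite}) = p ^ e"
  shows "of_nat p = (0::'a)"
proof -
  have "(of_nat p :: 'a) ^ e = 0" using of_nat_card_eq_0[where ?'a='a] by (simp add: assms)
  then show ?thesis by simp
qed

lemma form_in_polys:
  "(\<Sum>i<n. \<Sum>j<n. Const (H i j) * (Var i * Var j ^ q)) \<in> polys n"
  by (intro is_subring_sum[OF is_subring_polys] is_subring_mult[OF is_subring_polys]
      is_subring_power[OF is_subring_polys] Const_in_polys Var_in_polys) auto

text \<open>Covers the unitary and the symplectic groups. Their \<open>h\<close> is itself a
  combination of terms \<open>x_i * x_j ^ q\<close>, so the identity of the Steenrod algebra already
  yields the Gram matrix.\<close>

theorem hermitian_case:
  fixes h :: "'a::{field,finite} mpoly"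
  assumes p: "prime p" "e \<ge> 1" and q: "q = p ^ e" and card: "CARD('a) = p ^ e'"
    and X2: "X2 \<in> carrier_mat l l" and \<epsilon>: "\<epsilon> \<noteq> 0"
    and nd: "\<And>w :: nat \<Rightarrow> 'a mpoly fract. (\<And>j. j < l \<Longrightarrow> (\<Sum>i<l. w i * to_fract (Const (X2 $$ (i, j)))) = 0) \<Longrightarrow> (\<forall>i<l. w i = 0)"
    and n: "n = 2 * k + l"
    and h: "h = (\<Sum>i<n. \<Sum>j<n. Const (J_form \<epsilon> k X2 $$ (i, j)) * (Var i * Var j ^ q))"
    and G: "G = G_form q \<epsilon> k X2"
    and R: "R = subalgebra_gen ({orbit_product G (Var i) | i. i < n} \<union> {\<theta> h | \<theta>. \<theta> \<in> steenrod_algebra})"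
  shows "to_fract ` invariants n G = integral_closure R (Quot R)"
proof -
  have q2: "q \<ge> 2"
    using p q prime_ge_2_nat[of p] power_increasing[of 1 e p] by simp
  note p0 = of_nat_p_eq_0[OF card]
  have G': "G = {N \<in> unitri n. lsub n (entries N) h = h \<and> True}"
    unfolding G h lsub_form[OF p(1) p0 q] form_eq_iff[OF q2] using G_form_iff[OF X2, of _ q \<epsilon> k] n by auto
  interpret classical_setup n p G h
    by (rule classical_setupI[OF p(1) _ _ G']) (use card in \<open>auto simp: h form_in_polys\<close>)
  show ?thesis
    unfolding R R_def[symmetric]
  proof (rule invariants_nondegenerate[OF q q2 steenrod_algebra.id])
    show "id h = (\<Sum>i<n. \<Sum>j<n. Const (J_form \<epsilon> k X2 $$ (i, j)) * (Var i * Var j ^ q))" by (simp add: h)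
    show "\<forall>i<n. u i = 0" if "\<And>j. j < n \<Longrightarrow> (\<Sum>i<n. u i * to_fract (Const (J_form \<epsilon> k X2 $$ (i, j)))) = 0" for u
      using J_form_nondegenerate[OF X2 \<epsilon> nd, of k u] that unfolding n by blast
  qed
qed

section \<open>Quadratic forms and their polar forms\<close>

context
  fixes k l n p e q :: nat and P :: "nat \<Rightarrow> nat \<Rightarrow> 'a::{field,finite}"
  assumes p: "prime p" "e \<ge> 1" and q: "q = p ^ e" and card: "CARD('a) = q" and n: "n = 2 * k + l"
begin

text \<open>The \<open>0\<close> in place of \<open>\<epsilon>\<close> counts each hyperbolic
  product once: this is a Gram matrix of the quadratic form, not of its polar form, and keeps its
  meaning in characteristic two.\<close>

definition Pf :: "nat \<Rightarrow> nat \<Rightarrow> 'a" where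
  "Pf i j = J_form 0 k (mat l l (\<lambda>(i, j). P i j)) $$ (i, j)"

definition polar :: "'a mat" where
  "polar = mat l l (\<lambda>(i, j). P i j + P j i)"

definition quadratic :: "'a mpoly" where
  "quadratic = (\<Sum>i<n. \<Sum>j<n. Const (Pf i j) * (Var i * Var j))"

lemma polar_carrier: "polar \<in> carrier_mat l l"
  by (simp add: polar_def)

lemma q2: "q \<ge> 2"
  using p q prime_ge_2_nat[of p] power_increasing[of 1 e p] by simp

lemma p0: "of_nat p = (0::'a)"
  using of_nat_p_eq_0 card q by metis

lemma power_q: "(x::'a) ^ q = x"
  using finite_field_power_card[of x] by (simp add: card)

lemma polar_Pf: "i < n \<Longrightarrow> j < n \<Longrightarrow> J_form 1 k polar $$ (i, j) = Pf i j + Pf j i"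
  unfolding n Pf_def by (auto simp: J_form_index[OF polar_carrier] J_form_index[of _ l] polar_def)

lemma sum_Pf:
  fixes c :: "'a \<Rightarrow> 'b::comm_ring_1"
  assumes "c 0 = 0" "c 1 = 1"
  shows "(\<Sum>i<n. \<Sum>j<n. c (Pf i j) * f i j) = (\<Sum>i<k. f i (n - 1 - i)) + (\<Sum>i<l. \<Sum>j<l. c (P i j) * f (k + i) (k + j))"
  unfolding n Pf_def using sum_J_form[OF _ assms, of "mat l l (\<lambda>(i, j). P i j)" l 0 k f] assms
  by (simp add: n)

lemma steenrod_op_1_quadratic_form:
  "steenrod_op 1 quadratic = (\<Sum>i<n. \<Sum>j<n. Const (J_form 1 k polar $$ (i, j)) * (Var i * Var j ^ q))"
proof -
  have "steenrod_op 1 quadratic = (\<Sum>i<n. \<Sum>j<n. Const (Pf i j) * (Var i * Var j ^ q)) + (\<Sum>i<n. \<Sum>j<n. Const (Pf i j) * (Var j * Var i ^ q))"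
    by (simp only: quadratic_def steenrod_op_sum steenrod_op_scale steenrod_op_1_quadratic card distrib_left sum.distrib)
  also have "(\<Sum>i<n. \<Sum>j<n. Const (Pf i j) * (Var j * Var i ^ q)) = (\<Sum>i<n. \<Sum>j<n. Const (Pf j i) * (Var i * Var j ^ q))"
    by (rule sum.swap)
  also have "(\<Sum>i<n. \<Sum>j<n. Const (Pf i j) * (Var i * Var j ^ q)) + \<dots> =
      (\<Sum>i<n. \<Sum>j<n. Const (J_form 1 k polar $$ (i, j)) * (Var i * Var j ^ q))"
    unfolding sum.distrib[symmetric]
    by (intro sum.cong refl) (simp add: polar_Pf Const.hom_add distrib_right)
  finally show ?thesis .
qed

text \<open>A quadratic form is determined by its polar form and its values at the standard basis
  vectors. The second condition compares these with the values at the columns of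
  \<open>N\<close>.\<close>

lemma quadratic_fixed_iff:
  assumes N: "N \<in> unitri n"
  shows "lsub n (entries N) quadratic = quadratic \<longleftrightarrow> N \<in> G_form q 1 k polar \<and>
    (\<forall>a<n. (\<Sum>i<n. \<Sum>j<n. Pf i j * (entries N i a * entries N j a)) = Pf a a)"
proof -
  define T where "T = (\<lambda>a b. \<Sum>i<n. \<Sum>j<n. entries N i a * Pf i j * entries N j b)"
  have "lsub n (entries N) quadratic = (\<Sum>a<n. \<Sum>b<n. Const (T a b) * (Var a * Var b))"
    using lsub_form[OF p(1) p0, of 1 0 n "entries N" Pf] by (simp add: quadratic_def T_def)
  then have "lsub n (entries N) quadratic - quadratic = (\<Sum>a<n. \<Sum>b<n. Const (T a b - Pf a b) * (Var a * Var b))"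
    by (simp add: quadratic_def Const.hom_minus left_diff_distrib sum_subtractf)
  then have "lsub n (entries N) quadratic = quadratic \<longleftrightarrow>
      (\<forall>a<n. T a a - Pf a a = 0) \<and> (\<forall>a<n. \<forall>b<n. T a b - Pf a b + (T b a - Pf b a) = 0)"
    using quadratic_zero_iff[where n = n and D = "\<lambda>a b. T a b - Pf a b"] by auto
  also have "(\<forall>a<n. \<forall>b<n. T a b - Pf a b + (T b a - Pf b a) = 0) \<longleftrightarrow> (\<forall>a<n. \<forall>b<n.
      (\<Sum>i<n. \<Sum>j<n. entries N i a * J_form 1 k polar $$ (i, j) * entries N j b ^ q) = J_form 1 k polar $$ (a, b))"
  proof -
    have "(\<Sum>i<n. \<Sum>j<n. entries N i a * J_form 1 k polar $$ (i, j) * entries N j b ^ q) = T a b + T b a" for a b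
    proof -
      have "T b a = (\<Sum>i<n. \<Sum>j<n. entries N i a * Pf j i * entries N j b)"
        unfolding T_def by (subst sum.swap) (simp add: mult_ac)
      moreover have "(\<Sum>i<n. \<Sum>j<n. entries N i a * J_form 1 k polar $$ (i, j) * entries N j b ^ q) =
          (\<Sum>i<n. \<Sum>j<n. entries N i a * Pf i j * entries N j b + entries N i a * Pf j i * entries N j b)"
        by (intro sum.cong refl) (simp add: power_q polar_Pf algebra_simps)
      ultimately show ?thesis by (simp add: T_def sum.distrib)
    qed
    then show ?thesis by (auto simp: polar_Pf algebra_simps)
  qed
  finally show ?thesis
    using G_form_iff[OF polar_carrier, of N q 1 k] N
    by (auto simp: T_def n mult_ac)
qed

text \<open>Twice the quadratic form is the polar form at equal arguments, so for invertible
  \<open>2\<close> the values at the columns are implied.\<close>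

lemma quadratic_fixed_iff_odd:
  assumes N: "N \<in> unitri n" and two: "(2::'a) \<noteq> 0"
  shows "lsub n (entries N) quadratic = quadratic \<longleftrightarrow> N \<in> G_form q 1 k polar"
proof -
  have "(\<Sum>i<n. \<Sum>j<n. Pf i j * (entries N i a * entries N j a)) = Pf a a"
    if G: "N \<in> G_form q 1 k polar" and a: "a < n" for a
  proof -
    let ?T = "\<Sum>i<n. \<Sum>j<n. Pf i j * (entries N i a * entries N j a)"
    have "(\<Sum>i<n. \<Sum>j<n. Pf j i * (entries N i a * entries N j a)) = ?T"
      by (subst sum.swap) (simp add: mult_ac)
    then have "(\<Sum>i<n. \<Sum>j<n. entries N i a * J_form 1 k polar $$ (i, j) * entries N j a ^ q) = ?T + ?T"
      by (simp add: power_q polar_Pf algebra_simps sum.distrib)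
    moreover have "(\<Sum>i<n. \<Sum>j<n. entries N i a * J_form 1 k polar $$ (i, j) * entries N j a ^ q) = J_form 1 k polar $$ (a, a)"
      using G a unfolding G_form_iff[OF polar_carrier] n[symmetric] by blast
    ultimately have "?T + ?T = Pf a a + Pf a a" using polar_Pf[OF a a] by metis
    then have "2 * ?T = 2 * Pf a a" by (simp only: mult_2)
    then show ?thesis using two mult_cancel_left[of "2::'a" ?T "Pf a a"] by blast
  qed
  then show ?thesis using quadratic_fixed_iff[OF N] by blast
qed

text \<open>The condition on values at columns splits by blocks: for the first \<open>k\<close>
  columns it concerns the diagonal of \<open>S\<close>, for the middle columns it is the hypothesis
  \<open>F\<close>, and for the last \<open>k\<close> columns both sides are \<open>0\<close> by
  triangularity.\<close>

lemma quadratic_fixed_iff_even: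
  assumes N: "N \<in> unitri n" and two: "(2::'a) = 0"
    and F: "\<And>a. a < l \<Longrightarrow> (\<Sum>i<l. \<Sum>j<l. P i j * (entries N (k + i) (k + a) * entries N (k + j) (k + a))) = P a a"
  shows "lsub n (entries N) quadratic = quadratic \<longleftrightarrow> N \<in> G_form q 1 k polar \<and>
    (\<forall>a<k. blk_S q k l N $$ (a, a) = (\<Sum>i<l. \<Sum>j<l. P i j * (blk_B k l N $$ (i, a) * blk_B k l N $$ (j, a))))"
proof -
  let ?T = "\<lambda>a. \<Sum>i<n. \<Sum>j<n. Pf i j * (entries N i a * entries N j a)"
  have T: "?T a = (\<Sum>i<k. entries N i a * entries N (n - 1 - i) a) +
      (\<Sum>i<l. \<Sum>j<l. P i j * (entries N (k + i) a * entries N (k + j) a))" for a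
    by (rule sum_Pf) auto
  have dbl: "x = y \<longleftrightarrow> x + y = 0" for x y :: 'a
  proof -
    have "y + y = 0" unfolding mult_2[symmetric] two by simp
    then show ?thesis by (metis add_right_cancel)
  qed
  have Pf0: "Pf a a = (if k \<le> a \<and> a < k + l then P (a - k) (a - k) else 0)" if "a < n" for a
    using that unfolding n Pf_def by (auto simp: J_form_index[of _ l])
  \<comment> \<open>\<open>J k\<close> pairs row \<open>b\<close> of the block \<open>A\<close> with
    row \<open>k - 1 - b\<close> of \<open>C\<close>, which is row \<open>n - 1 - b\<close> of
    \<open>N\<close>; \<open>bar\<close> is trivial as \<open>x ^ q = x\<close>.\<close>
  have S: "blk_S q k l N $$ (a, a) = (\<Sum>i<k. entries N i a * entries N (n - 1 - i) a)" if a: "a < k" for a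
  proof -
    have "blk_S q k l N $$ (a, a) = (\<Sum>c<k. (\<Sum>b<k. N $$ (b, a) * (if b + c + 1 = k then 1 else 0)) * N $$ (k + l + c, a))"
      using a by (simp add: blk_S_def blk_A_def blk_C_def bar_def J_def scalar_prod_def power_q lessThan_atLeast0 mult.assoc sum_distrib_left sum_distrib_right)
    also have "\<dots> = (\<Sum>c<k. \<Sum>b<k. if b + c + 1 = k then N $$ (b, a) * N $$ (k + l + c, a) else 0)"
      unfolding sum_distrib_right by (intro sum.cong refl) simp
    also have "\<dots> = (\<Sum>b<k. \<Sum>c<k. if b + c + 1 = k then N $$ (b, a) * N $$ (k + l + c, a) else 0)"
      by (rule sum.swap)
    also have "\<dots> = (\<Sum>b<k. N $$ (b, a) * N $$ (k + l + (k - 1 - b), a))"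
      by (rule sum_antidiagonal)
    also have "\<dots> = (\<Sum>b<k. entries N b a * entries N (n - 1 - b) a)"
    proof (intro sum.cong refl)
      fix b assume "b \<in> {..<k}"
      then have "k + l + (k - 1 - b) = n - 1 - b" using n by auto
      then show "N $$ (b, a) * N $$ (k + l + (k - 1 - b), a) = entries N b a * entries N (n - 1 - b) a"
        by (simp only: entries_def)
    qed
    finally show ?thesis .
  qed
  have "?T a = Pf a a \<longleftrightarrow> (a < k \<longrightarrow> blk_S q k l N $$ (a, a) = (\<Sum>i<l. \<Sum>j<l. P i j * (blk_B k l N $$ (i, a) * blk_B k l N $$ (j, a))))"
    if a: "a < n" for a
  proof (cases "a < k")
    case True
    have "(\<Sum>i<l. \<Sum>j<l. P i j * (blk_B k l N $$ (i, a) * blk_B k l N $$ (j, a))) =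
        (\<Sum>i<l. \<Sum>j<l. P i j * (entries N (k + i) a * entries N (k + j) a))"
      using True by (intro sum.cong refl) (simp add: blk_B_def entries_def)
    then show ?thesis unfolding T S[OF True, symmetric] Pf0[OF a] using True dbl by simp
  next
    case False
    have "(\<Sum>i<k. entries N i a * entries N (n - 1 - i) a) = 0"
      using False a unitri_upper[OF N] by (intro sum.neutral) auto
    moreover have "(\<Sum>i<l. \<Sum>j<l. P i j * (entries N (k + i) a * entries N (k + j) a)) = Pf a a"
    proof (cases "a < k + l")
      case True
      then show ?thesis using False F[of "a - k"] Pf0[OF a] by simp
    next
      case f: False
      have "entries N (k + i) a = 0" if "i < l" for i using f that a by (intro unitri_upper[OF N]) auto
      then show ?thesis using f Pf0[OF a] by simp
    qed
    ultimately show ?thesis unfolding T using False by simp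
  qed
  then have "(\<forall>a<n. ?T a = Pf a a) \<longleftrightarrow> (\<forall>a<k. blk_S q k l N $$ (a, a) = (\<Sum>i<l. \<Sum>j<l. P i j * (blk_B k l N $$ (i, a) * blk_B k l N $$ (j, a))))"
    using n by auto
  then show ?thesis using quadratic_fixed_iff[OF N] by simp
qed

lemma quadratic_polys: "quadratic \<in> polys n"
  using form_in_polys[where q = 1] by (simp add: quadratic_def)

theorem orthogonal_case:
  assumes cs: "classical_setup n p G quadratic"
    and nd: "\<And>w :: nat \<Rightarrow> 'a mpoly fract. (\<And>j. j < l \<Longrightarrow> (\<Sum>i<l. w i * to_fract (Const (polar $$ (i, j)))) = 0) \<Longrightarrow> (\<forall>i<l. w i = 0)"
    and R: "R = subalgebra_gen ({orbit_product G (Var i) | i. i < n} \<union> {\<theta> quadratic | \<theta>. \<theta> \<in> steenrod_algebra})"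
  shows "to_fract ` invariants n G = integral_closure R (Quot R)"
proof -
  interpret classical_setup n p G quadratic by (rule cs)
  show ?thesis
    unfolding R R_def[symmetric]
  proof (rule invariants_nondegenerate[OF q q2 steenrod_algebra.op steenrod_op_1_quadratic_form])
    show "\<forall>i<n. u i = 0" if "\<And>j. j < n \<Longrightarrow> (\<Sum>i<n. u i * to_fract (Const (J_form 1 k polar $$ (i, j)))) = 0" for u
      using J_form_nondegenerate[OF polar_carrier one_neq_zero nd, of k u] that unfolding n by blast
  qed
qed

end

section \<open>The orthogonal groups and the assembly of the six families\<close>

lemma blk_F_eq_one_iff:
  assumes N: "N \<in> unitri (2 * k + 2)"
  shows "blk_F k 2 N = 1\<^sub>m 2 \<longleftrightarrow> entries N (k + 1) k = 0"
proof
  assume F: "blk_F k 2 N = 1\<^sub>m 2"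
  have "entries N (k + 1) k = blk_F k 2 N $$ (1, 0)" by (simp add: blk_F_def entries_def)
  then show "entries N (k + 1) k = 0" unfolding F by simp
next
  assume 0: "entries N (k + 1) k = 0"
  show "blk_F k 2 N = 1\<^sub>m 2"
  proof (rule eq_matI)
    fix i j assume "i < dim_row (1\<^sub>m 2 :: 'a mat)" "j < dim_col (1\<^sub>m 2 :: 'a mat)"
    then have ij: "i \<in> {0, 1}" "j \<in> {0, 1}" by auto
    have "blk_F k 2 N $$ (i, j) = entries N (k + i) (k + j)" using ij by (auto simp: blk_F_def entries_def)
    then show "blk_F k 2 N $$ (i, j) = 1\<^sub>m 2 $$ (i, j)"
      using ij 0 unitri_diag[OF N] unitri_upper[OF N, of k "k + 1"] by auto
  qed (auto simp: blk_F_def)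
qed

lemma blk_F_mult:
  assumes M: "M \<in> unitri (2 * k + 2)" and N: "N \<in> unitri (2 * k + 2)"
    and "blk_F k 2 M = 1\<^sub>m 2" "blk_F k 2 N = 1\<^sub>m 2"
  shows "blk_F k 2 (M * N) = 1\<^sub>m 2"
proof -
  have 0: "entries M (k + 1) k = 0" "entries N (k + 1) k = 0"
    using assms by (simp_all add: blk_F_eq_one_iff)
  have "entries M (k + 1) j * entries N j k = 0" if "j < 2 * k + 2" for j
  proof -
    consider "j < k" | "j = k" | "j = k + 1" | "k + 1 < j" by linarith
    then show ?thesis
      using unitri_upper[OF N, of j k] unitri_upper[OF M, of "k + 1" j] that 0 by cases auto
  qed
  then have "(\<Sum>j<2 * k + 2. entries M (k + 1) j * entries N j k) = 0"
    by (intro sum.neutral) auto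
  then have "entries (M * N) (k + 1) k = 0"
    by (subst entries_mult[OF unitri_carrier[OF M] unitri_carrier[OF N]]) auto
  then show ?thesis using blk_F_eq_one_iff[OF unitri_mult[OF M N]] by simp
qed

text \<open>If \<open>4 * a = 1\<close>, then \<open>T ^ 2 + T + a\<close> is the square of
  \<open>T + 1 / 2\<close>. The value \<open>4 * a - 1\<close> is the determinant of the middle
  polar block.\<close>

lemma four_a_neq_1:
  fixes a :: "'a::field"
  assumes "irreducible [:a, 1, 1:]"
  shows "4 * a \<noteq> 1"
proof
  assume a: "4 * a = 1"
  then have four: "(4::'a) \<noteq> 0" by (metis mult_zero_left zero_neq_one)
  have "(4::'a) = 2 * 2" by simp
  then have two: "(2::'a) \<noteq> 0" using four by (metis mult_zero_left)
  have "[:a, 1, 1:] = [:1 / 2, 1:] * [:1 / 2, 1:]"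
    using a two four by (simp add: field_simps)
  then have "[:1 / 2 :: 'a, 1:] dvd 1" using irreducibleD[OF assms] by blast
  then show False by (simp add: is_unit_iff_degree)
qed

context
  fixes p e q :: nat and P :: "nat \<Rightarrow> nat \<Rightarrow> 'a::{field,finite}"
  assumes p: "prime p" "e \<ge> 1" and q: "q = p ^ e" and card: "CARD('a) = q"
begin

lemma card_p: "\<exists>e. CARD('a) = p ^ e"
  using card q by blast

lemma odd_two: "odd q \<Longrightarrow> (2::'a) \<noteq> 0"
proof
  assume "odd q" and two: "(2::'a) = 0"
  then have "odd p" using q p by simp
  then obtain t where "p = 2 * t + 1" by (elim oddE)
  then have "of_nat p = (1::'a)" using two by simp
  then show False using of_nat_p_eq_0[where ?'a='a, of p e] card q by simp
qed

lemma even_two: "even q \<Longrightarrow> p = 2 \<and> (2::'a) = 0"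
proof -
  assume "even q"
  then have "even p" using q by simp
  then have "p = 2" using p by (simp add: prime_nat_iff) (metis numeral_1_eq_Suc_0 one_eq_numeral_iff semiring_norm(85))
  then show ?thesis using of_nat_p_eq_0[where ?'a='a, of p e] card q by auto
qed

lemma setup_odd:
  assumes "odd q" and n: "n = 2 * k + l"
  shows "classical_setup n p (G_form q 1 k (polar l P)) (quadratic k l n P)"
proof (rule classical_setupI[OF p(1) card_p, where F = "\<lambda>_. True"])
  show "quadratic k l n P \<in> polys n" by (rule quadratic_polys[OF p q card n])
  have "G_form q 1 k (polar l P) \<subseteq> unitri n"
    using G_form_iff[OF polar_carrier[OF p q card n]] n by auto
  then show "G_form q 1 k (polar l P) = {N \<in> unitri n. lsub n (entries N) (quadratic k l n P) = quadratic k l n P \<and> True}"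
    using quadratic_fixed_iff_odd[OF p q card n _ odd_two[OF assms(1)]] by auto
qed auto

text \<open>The identity as middle block supplies the hypothesis on middle columns in
  \<open>quadratic_fixed_iff_even\<close>. Its only free entry lies in row \<open>k + 1\<close>, so
  the condition can be read off a matrix whose rows come from \<open>G\<close>.\<close>

lemma setup_even:
  assumes "even q" and n: "n = 2 * k + 2"
    and G: "G = {N \<in> G_form q 1 k (polar 2 P). blk_F k 2 N = 1\<^sub>m 2 \<and>
      (\<forall>a<k. blk_S q k 2 N $$ (a, a) = (\<Sum>i<2. \<Sum>j<2. P i j * (blk_B k 2 N $$ (i, a) * blk_B k 2 N $$ (j, a))))}"
  shows "classical_setup n p G (quadratic k 2 n P)"
proof -
  have two: "(2::'a) = 0" using even_two[OF assms(1)] by simp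
  have F: "(\<Sum>i<2. \<Sum>j<2. P i j * (entries N (k + i) (k + a) * entries N (k + j) (k + a))) = P a a"
    if N: "N \<in> unitri n" "blk_F k 2 N = 1\<^sub>m 2" and a: "a < 2" for N a
  proof -
    have "entries N (k + i) (k + a) = (if i = a then 1 else 0)" if i: "i < 2" for i
    proof -
      have "entries N (k + i) (k + a) = blk_F k 2 N $$ (i, a)" using i a by (simp add: blk_F_def entries_def)
      then show ?thesis using i a by (simp add: N(2))
    qed
    then have "(\<Sum>i<2. \<Sum>j<2. P i j * (entries N (k + i) (k + a) * entries N (k + j) (k + a))) =
        (\<Sum>i<2. \<Sum>j<2. if j = a then if i = a then P i j else 0 else 0)"
      by (intro sum.cong refl) auto
    then show ?thesis using a by simp
  qed
  have Gsub: "G_form q 1 k (polar 2 P) \<subseteq> unitri n"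
    using G_form_iff[OF polar_carrier[OF p q card n]] n by auto
  have G': "G = {N \<in> unitri n. lsub n (entries N) (quadratic k 2 n P) = quadratic k 2 n P \<and> blk_F k 2 N = 1\<^sub>m 2}"
    unfolding G using quadratic_fixed_iff_even[OF p q card n _ two F] Gsub by auto
  show ?thesis
  proof (rule classical_setupI[OF p(1) card_p _ G'])
    show "quadratic k 2 n P \<in> polys n" by (rule quadratic_polys[OF p q card n])
    show "blk_F k 2 (1\<^sub>m n :: 'a mat) = 1\<^sub>m 2"
      using blk_F_eq_one_iff[of "1\<^sub>m n" k] unitri_one[of n] n by (simp add: entries_def)
    show "blk_F k 2 (M * N) = 1\<^sub>m 2" if "M \<in> unitri n" "N \<in> unitri n" "blk_F k 2 M = 1\<^sub>m 2" "blk_F k 2 N = 1\<^sub>m 2" for M N :: "'a mat"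
      using that blk_F_mult n by auto
    fix g :: "'a mat" assume g: "g \<in> unitri n" and rows: "\<And>i. i < n \<Longrightarrow> \<exists>N\<in>G. \<forall>j<n. entries g i j = entries N i j"
    obtain N where N: "N \<in> G" "\<forall>j<n. entries g (k + 1) j = entries N (k + 1) j" using rows[of "k + 1"] n by auto
    then have "entries N (k + 1) k = 0" using blk_F_eq_one_iff[of N k] n by (auto simp: G')
    then show "blk_F k 2 g = 1\<^sub>m 2" using N(2) blk_F_eq_one_iff[of g k] g n by auto
  qed
qed

lemma orthogonal_case_2:
  assumes n: "n = 2 * k + 2" and X2: "polar 2 P = X2"
    and h: "h = (\<Sum>i<k. Var i * Var (n - 1 - i)) + (\<Sum>i<2. \<Sum>j<2. Const (P i j) * (Var (k + i) * Var (k + j)))"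
    and nd: "X2 $$ (0, 0) * X2 $$ (1, 1) \<noteq> X2 $$ (0, 1) * X2 $$ (1, 0)"
    and G: "G = (if odd q then G_form q 1 k X2 else {N \<in> G_form q 1 k X2. blk_F k 2 N = 1\<^sub>m 2 \<and>
      (\<forall>a<k. blk_S q k 2 N $$ (a, a) = (\<Sum>i<2. \<Sum>j<2. P i j * (blk_B k 2 N $$ (i, a) * blk_B k 2 N $$ (j, a))))})"
    and R: "R = subalgebra_gen ({orbit_product G (Var i) | i. i < n} \<union> {\<theta> h | \<theta>. \<theta> \<in> steenrod_algebra})"
  shows "to_fract ` invariants n G = integral_closure R (Quot R)"
proof -
  have hq: "h = quadratic k 2 n P"
    unfolding h quadratic_def[OF p q card n] sum_Pf[OF p q card n, of Const, OF Const.hom_zero Const.hom_one] ..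
  have "classical_setup n p G (quadratic k 2 n P)"
  proof (cases "odd q")
    case True
    then show ?thesis using setup_odd[OF True n] by (simp add: G X2)
  next
    case False
    then show ?thesis by (intro setup_even[OF _ n]) (simp_all add: G X2)
  qed
  then show ?thesis
    by (rule orthogonal_case[OF p q card n _ _ R[unfolded hq]]) (rule nondegenerate_2, use nd in \<open>simp_all add: X2\<close>)
qed

end

theorem corollary1p2:
  fixes p e q m n :: nat
    and X G :: "'a::{field,finite} mat set"
    and h :: "'a mpoly" and R :: "'a mpoly set"
  assumes "prime p" and "e \<ge> 1" and "q = p ^ e" and "m \<ge> 1"
    and "classical_group q m X n h G"
    and "R = subalgebra_gen
           ({orbit_product G (Var i) | i. i < n} \<union> {\<theta> h | \<theta>. \<theta> \<in> steenrod_algebra})"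
  shows "to_fract ` invariants n G = integral_closure R (Quot R)"
  using assms(5)
proof cases
  case GU_even
  \<comment> \<open>The middle block takes the innermost hyperbolic pair, so \<open>m - 1\<close>
    pairs remain outside.\<close>
  obtain k where m: "m = Suc k" using assms(4) by (cases m) auto
  have card: "CARD('a) = p ^ (e * 2)" using GU_even(1) assms(3) by (simp add: power_mult)
  have n: "n = 2 * k + 2" using GU_even(2) m by simp
  show ?thesis
  proof (rule hermitian_case[OF assms(1-3) card _ _ _ n _ _ assms(6)])
    show "J 2 \<in> carrier_mat 2 2" by (simp add: J_def)
    then show "h = (\<Sum>i<n. \<Sum>j<n. Const (J_form 1 k (J 2) $$ (i, j)) * (Var i * Var j ^ q))"
      unfolding n GU_even(4) m
      by (subst sum_J_form) (auto simp: J_def numeral_2_eq_2 add_ac mult_ac)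
    show "G = G_form q 1 k (J 2)" using GU_even(5) m by simp
  qed (simp, rule nondegenerate_2[of "J 2"], simp add: J_def, blast)
next
  case GU_odd
  have card: "CARD('a) = p ^ (e * 2)" using GU_odd(1) assms(3) by (simp add: power_mult)
  have n: "n = 2 * m + 1" using GU_odd(2) by simp
  show ?thesis
  proof (rule hermitian_case[OF assms(1-3) card _ _ _ n _ GU_odd(5) assms(6)])
    show "mat_of_rows_list 1 [[1]] \<in> carrier_mat 1 1" by (simp add: mat_of_rows_list_def)
    then show "h = (\<Sum>i<n. \<Sum>j<n. Const (J_form 1 m (mat_of_rows_list 1 [[1]]) $$ (i, j)) * (Var i * Var j ^ q))"
      unfolding n GU_odd(4)
      by (subst sum_J_form) (auto simp: mat_of_rows_list_def add_ac mult_ac)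
  qed (simp, rule nondegenerate_1[of "mat_of_rows_list 1 [[1]]"], simp add: mat_of_rows_list_def, blast)
next
  case Sp
  obtain k where m: "m = Suc k" using assms(4) by (cases m) auto
  have card: "CARD('a) = p ^ e" using Sp(1) assms(3) by simp
  have n: "n = 2 * k + 2" using Sp(2) m by simp
  show ?thesis
  proof (rule hermitian_case[OF assms(1-3) card _ _ _ n _ _ assms(6)])
    show "mat_of_rows_list 2 [[0, 1], [-1, 0]] \<in> carrier_mat 2 2"
      by (simp add: mat_of_rows_list_def numeral_2_eq_2)
    then show "h = (\<Sum>i<n. \<Sum>j<n. Const (J_form (-1) k (mat_of_rows_list 2 [[0, 1], [-1, 0]]) $$ (i, j)) * (Var i * Var j ^ q))"
      unfolding n Sp(5) m
      by (subst sum_J_form) (auto simp: mat_of_rows_list_def numeral_2_eq_2 Const.hom_uminus add_ac mult_ac)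
    show "G = G_form q (-1) k (mat_of_rows_list 2 [[0, 1], [-1, 0]])" using Sp(3,6) m by simp
  qed (simp, rule nondegenerate_2[of "mat_of_rows_list 2 [[0, 1], [-1, 0]]"], simp add: mat_of_rows_list_def, blast)
next
  case O_plus
  obtain k where m: "m = Suc k" using assms(4) by (cases m) auto
  \<comment> \<open>The upper triangular Gram matrix of the innermost product
    \<open>Var k * Var (k + 1)\<close>; it symmetrizes to \<open>J 2\<close>.\<close>
  define P where "P = (\<lambda>(i::nat) (j::nat). if i = 0 \<and> j = 1 then 1 else (0::'a))"
  have n: "n = 2 * k + 2" using O_plus(2) m by simp
  show ?thesis
  proof (rule orthogonal_case_2[where P = P, OF assms(1-3) O_plus(1) n _ _ _ _ assms(6)])
    show "polar 2 P = J 2"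
      unfolding polar_def[OF assms(1-3) O_plus(1) n]
      by (rule eq_matI) (auto simp: P_def J_def less_2_cases_iff)
    show "h = (\<Sum>i<k. Var i * Var (n - 1 - i)) + (\<Sum>i<2. \<Sum>j<2. Const (P i j) * (Var (k + i) * Var (k + j)))"
      unfolding n O_plus(4) m by (simp add: P_def numeral_2_eq_2 mult.commute)
    show "G = (if odd q then G_form q 1 k (J 2) else {N \<in> G_form q 1 k (J 2). blk_F k 2 N = 1\<^sub>m 2 \<and>
      (\<forall>a<k. blk_S q k 2 N $$ (a, a) = (\<Sum>i<2. \<Sum>j<2. P i j * (blk_B k 2 N $$ (i, a) * blk_B k 2 N $$ (j, a))))})"
      unfolding O_plus(5) m by (simp add: P_def numeral_2_eq_2)
  qed (auto simp: J_def)
next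
  case (O_minus a)
  define P where "P = (\<lambda>(i::nat) (j::nat). if i = 0 then 1 else if j = 0 then 0 else a)"
  have n: "n = 2 * m + 2" using O_minus(2) by simp
  define X2 where "X2 = mat_of_rows_list 2 [[2, 1], [1, 2 * a]]"
  \<comment> \<open>For even \<open>q\<close> the group is stated with \<open>J 2\<close>; as
    \<open>2 = 0\<close>, this is the same polar block as for odd \<open>q\<close>, and one argument
    serves both parities.\<close>
  have even: "X2 = J 2" if "even q"
  proof -
    have "(2::'a) = 0" using even_two[OF assms(1-3) O_minus(1) that] by simp
    then show ?thesis unfolding X2_def
      by (intro eq_matI) (auto simp: mat_of_rows_list_def J_def less_2_cases_iff)
  qed
  show ?thesis
  proof (rule orthogonal_case_2[where P = P, OF assms(1-3) O_minus(1) n _ _ _ _ assms(6)])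
    show "polar 2 P = X2"
      unfolding polar_def[OF assms(1-3) O_minus(1) n] X2_def
      by (rule eq_matI) (auto simp: P_def mat_of_rows_list_def less_Suc_eq numeral_2_eq_2)
    show "h = (\<Sum>i<m. Var i * Var (n - 1 - i)) + (\<Sum>i<2. \<Sum>j<2. Const (P i j) * (Var (m + i) * Var (m + j)))"
      unfolding n O_minus(5) by (simp add: P_def numeral_2_eq_2 mult.commute power2_eq_square add_ac)
    show "G = (if odd q then G_form q 1 m X2 else {N \<in> G_form q 1 m X2. blk_F m 2 N = 1\<^sub>m 2 \<and>
      (\<forall>b<m. blk_S q m 2 N $$ (b, b) = (\<Sum>i<2. \<Sum>j<2. P i j * (blk_B m 2 N $$ (i, b) * blk_B m 2 N $$ (j, b))))})"
      unfolding O_minus(6) X2_def[symmetric] using even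
      by (simp add: P_def numeral_2_eq_2 power2_eq_square add_ac mult_ac)
    show "X2 $$ (0, 0) * X2 $$ (1, 1) \<noteq> X2 $$ (0, 1) * X2 $$ (1, 0)"
      using four_a_neq_1[OF O_minus(3)] by (simp add: X2_def mat_of_rows_list_def)
  qed
next
  case O_odd
  define P where "P = (\<lambda>(i::nat) (j::nat). (1::'a))"
  have n: "n = 2 * m + 1" using O_odd(2) by simp
  note ctx = assms(1-3) O_odd(1) n
  have hq: "h = quadratic m 1 n P"
    unfolding quadratic_def[OF ctx] sum_Pf[OF ctx, of Const, OF Const.hom_zero Const.hom_one]
    unfolding n O_odd(4) by (simp add: P_def power2_eq_square mult.commute)
  have polar: "polar 1 P = mat_of_rows_list 1 [[2]]"
    unfolding polar_def[OF ctx] by (rule eq_matI) (auto simp: P_def mat_of_rows_list_def)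
  show ?thesis
  proof (cases "odd q")
    case True
    have "classical_setup n p G (quadratic m 1 n P)"
      using setup_odd[OF assms(1-3) O_odd(1) True n, of P, unfolded polar] O_odd(5) True by simp
    then show ?thesis
      by (rule orthogonal_case[OF ctx _ _ assms(6)[unfolded hq]])
        (rule nondegenerate_1[of "polar 1 P"], unfold polar,
          simp add: mat_of_rows_list_def odd_two[OF assms(1-3) O_odd(1) True], blast)
  next
    case False
    then have two: "p = 2" "(2::'a) = 0" using even_two[OF assms(1-3) O_odd(1)] by auto
    \<comment> \<open>The polar block vanishes in characteristic two, so the Gram matrix of all
      variables is singular and the degenerate case takes over.\<close>
    have polar0: "polar 1 P = mat_of_rows_list 1 [[0]]" unfolding polar two(2) ..
    have G: "G = {N \<in> G_form q 1 m (polar 1 P). \<forall>i<m. blk_S q m 1 N $$ (i, i) = (\<Sum>j<1. \<Sum>k<1. P j k * (blk_B m 1 N $$ (j, i) * blk_B m 1 N $$ (k, i)))}"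
      unfolding polar0 using O_odd(5) False by (simp add: P_def power2_eq_square)
    have "G = {N \<in> unitri n. lsub n (entries N) h = h \<and> True}"
    proof -
      have "(\<Sum>i<1. \<Sum>j<1. P i j * (entries N (m + i) (m + a) * entries N (m + j) (m + a))) = P a a"
        if "N \<in> unitri n" "a < 1" for N a
        using unitri_diag[OF that(1), of m] that(2) n by (simp add: P_def)
      moreover have "G_form q 1 m (polar 1 P) \<subseteq> unitri n"
        using G_form_iff[OF polar_carrier[OF ctx]] n by auto
      ultimately show ?thesis
        unfolding G hq using quadratic_fixed_iff_even[OF ctx _ two(2)] by auto
    qed
    moreover have "h \<in> polys n" unfolding hq by (rule quadratic_polys[OF ctx])
    ultimately interpret classical_setup n p G h
      by (intro classical_setupI[OF assms(1) card_p[OF assms(1-3) O_odd(1)], where F = "\<lambda>_. True"]) auto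
    have "h = (\<Sum>i<m. Var (2 * m - i) * Var i) + Var m ^ 2" by (rule O_odd(4))
    then show ?thesis
      unfolding assms(6) R_def[symmetric] by (rule invariants_degenerate[OF two(1) n assms(4)])
  qed
qed

end
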